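(* Let $X(\Sigma)$ be a quasi-transitive toric variety, let $D$ be a divisor of $X(\Sigma)$ in standard form, and let $\mu_1,\dots,\mu_k$ be non-negative integers. Then $$\dim\bigl(\mathcal{L}_{[D]}(\mu_1,\dots,\mu_k)\bigr)=\operatorname{rank}\bigl(M(D,\mu_1,\dots,\mu_k)\bigr).$$ In particular, the inequalities $$\dim(\mathcal{L})\ \ge\ \operatorname{tedim}(\mathcal{L})\ \ge\ \operatorname{edim}(\mathcal{L})$$ always hold for $\mathcal{L}=\mathcal{L}_{[D]}(\mu_1,\dots,\mu_k)$.
   Context: The base field $\mathbb{K}$ is algebraically closed of characteristic zero. A complete toric variety $X(\Sigma)$ of dimension $n$ with dense torus $T$ is quasi-transitive if it has a $T$-invariant point whose $\operatorname{Aut}(X(\Sigma))$-orbit contains $T$; such a point, and the corresponding full-dimensional cone of $\Sigma$, are called transitive on the torus. One fixes a basis $e_1,\dots,e_n$ of the lattice $N$ such that $\langle -e_1,\dots,-e_n\rangle\in\Sigma$ is transitive on the torus. Let $M=\operatorname{Hom}(N,\mathbb{Z})$ and $M_{\mathbb{Q}}=M\otimes_{\mathbb{Z}}\mathbb{Q}$. Let $\rho_1,\dots,\rho_r$ be the primitive generators of the rays of $\Sigma$, with $\rho_i=-e_i$ for $1\le i\le n$, and let $D_i$ be the $T$-invariant prime divisor of $\rho_i$. A divisor is in standard form if $D=\sum_{i=n+1}^r d_iD_i$ (put $d_1=\dots=d_n=0$); every class in the divisor class group $\operatorname{Cl}(X(\Sigma))$ has such a representative. Let $$P(D)=\{m\in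 M_{\mathbb{Q}}\mid \langle m,\rho_i\rangle\le d_i\text{ for } i=1,\dots,r\},$$ which is contained in the first orthant. In the Cox ring $\mathbb{K}[x_1,\dots,x_r]$ of $X(\Sigma)$ (with $\deg x_i=[D_i]$), the monomials $\prod_{i=1}^r x_i^{d_i-\langle m,\rho_i\rangle}$, $m\in P(D)\cap M$, form a basis of $H^0(X(\Sigma),\mathcal{O}(D))$; for $m\in P(D)\cap M$ let $y^m$ be this monomial evaluated at $x_{n+1}=\dots=x_r=1$. Linear systems: $\mathcal{L}_{[D]}(p_1^{\mu_1},\dots,p_k^{\mu_k})$ is the linear system of hypersurfaces of class $[D]$ passing through $p_i$ with multiplicity at least $\mu_i$ for each $i$, and $\dim$ is its dimension as a linear system ($-1$ if empty). Let $\mathcal{U}([D],\mu_1,\dots,\mu_k)$ be the open subset of the scheme parametrizing $k$-tuples of points of $X(\Sigma)$ where $\dim\mathcal{L}_{[D]}(p_1^{\mu_1},\dots,p_k^{\mu_k})$ attains its minimal value. Points $p_1,\dots,p_k$ are in very general position if the corresponding point of this scheme lies in $\mathcal{U}([D],\mu_1,\dots,\mu_k)$ for all classes $[D]$ and all $k$-tuples of non-negative integers. For such points the linear system is denoted $\mathcal{L}_{[D]}(\mu_1,\dots,\mu_k)$. The matrix: let $p_1,\dots,p_k\in(\mathbb{K}^* )^n$ be points in very general position. For $\mu\in\mathbb{Z}_{\ge0}$ let $$\Delta(\mu)=\{u\in M\mid\langle u,e_1+\dots+e_n\rangle\le\mu\text{ and }\langle u,e_i\rangle\ge0\text{ for each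 }i\},$$ and for $u\in\Delta(\mu)$ let $\frac{d}{dx^u}$ be the partial derivative of order $\langle u,e_j\rangle$ in $x_j$ for each $j=1,\dots,n$. $M(D,\mu_i)$ is the matrix with columns indexed by $m\in P(D)\cap M$, rows indexed by $u\in\Delta(\mu_i)$, and entry at $(m,u)$ equal to $\frac{dy^m}{dx^u}\big|_{p_i}$. $M(D,\mu_1,\dots,\mu_k)$ is obtained by stacking $M(D,\mu_1),\dots,M(D,\mu_k)$ vertically. Expected dimensions: with $\dim([D])=\dim_{\mathbb{K}}H^0(X(\Sigma),\mathcal{O}(D))=|P(D)\cap M|$, put $\operatorname{vdim}(\mathcal{L})=\dim([D])-\sum_{i=1}^k\binom{n+\mu_i-1}{n}-1$ and $\operatorname{edim}(\mathcal{L})=\max(\operatorname{vdim}(\mathcal{L}),-1)$. With $\Delta(D,\mu)=\Delta(\mu)\cap P(D)$, put $\operatorname{tvdim}(\mathcal{L})=\dim([D])-\sum_{i=1}^k|\Delta(D,\mu_i)|-1$ and $\operatorname{tedim}(\mathcal{L})=\max(\operatorname{tvdim}(\mathcal{L}),-1)$.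
   Formalization: The equality is corrected to dim L = dim([D]) − rank M − 1 (as printed it fails on P^1 with deg D = 1, k = 0), and Δ(μ) uses ≤ μ−1 instead of ≤ μ (as printed tedim ≥ edim fails on P^1 with deg D = 5, k = 1, μ = 1). *)

theory Defs
  imports
    "HOL-Analysis.Analysis"
    "HOL-Computational_Algebra.Polynomial"
    "HOL-Library.Poly_Mapping"
    "HOL-Library.Function_Algebras"
begin

text \<open>
  The lattice \<open>N\<close> and its dual \<open>M = Hom(N, \<int>)\<close> are both \<open>int^'n\<close>, paired by the standard
  bilinear form; cones live in \<open>N\<^sub>\<real> = real^'n\<close>, polytopes in \<open>M\<^sub>\<rat> = rat^'n\<close>.
\<close>

definition pairing :: "'a::comm_ring_1^'n \<Rightarrow> int^'n \<Rightarrow> 'a" where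
  "pairing m v = (\<Sum>j\<in>UNIV. m $ j * of_int (v $ j))"

definition rvec :: "int^'n \<Rightarrow> real^'n" where
  "rvec v = (\<chi> j. real_of_int (v $ j))"

definition qvec :: "int^'n \<Rightarrow> rat^'n" where
  "qvec m = (\<chi> j. rat_of_int (m $ j))"

definition lattice_basis :: "('n \<Rightarrow> int^'n) \<Rightarrow> bool" where
  "lattice_basis e \<longleftrightarrow> (\<forall>v. \<exists>!c. v = (\<Sum>j\<in>UNIV. c j *s e j))"

definition primitive :: "int^'n \<Rightarrow> bool" where
  "primitive v \<longleftrightarrow> Gcd (range (\<lambda>j. v $ j)) = 1"


section \<open>Fans\<close>

definition toric_cone :: "(real^'n) set \<Rightarrow> bool" where
  "toric_cone \<sigma> \<longleftrightarrow>
     (\<exists>S. finite S \<and> \<sigma> = convex_cone hull (rvec ` S)) \<and> \<sigma> \<inter> uminus ` \<sigma> = {0}"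

text \<open>In the library the empty set is a face of every convex set, hence the condition
  \<open>\<tau> \<noteq> {}\<close>.\<close>

definition complete_fan :: "(real^'n) set set \<Rightarrow> bool" where
  "complete_fan \<Sigma> \<longleftrightarrow>
     finite \<Sigma> \<and>
     (\<forall>\<sigma>\<in>\<Sigma>. toric_cone \<sigma>) \<and>
     (\<forall>\<sigma>\<in>\<Sigma>. \<forall>\<tau>. \<tau> face_of \<sigma> \<and> \<tau> \<noteq> {} \<longrightarrow> \<tau> \<in> \<Sigma>) \<and>
     (\<forall>\<sigma>\<in>\<Sigma>. \<forall>\<tau>\<in>\<Sigma>. (\<sigma> \<inter> \<tau>) face_of \<sigma> \<and> (\<sigma> \<inter> \<tau>) face_of \<tau>) \<and>
     \<Union>\<Sigma> = UNIV"

definition rays :: "(real^'n) set set \<Rightarrow> (int^'n) set" where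
  "rays \<Sigma> = {\<rho>. primitive \<rho> \<and> convex_cone hull {rvec \<rho>} \<in> \<Sigma>}"

definition cone_rays :: "(real^'n) set set \<Rightarrow> (real^'n) set \<Rightarrow> (int^'n) set" where
  "cone_rays \<Sigma> \<tau> = {\<rho> \<in> rays \<Sigma>. rvec \<rho> \<in> \<tau>}"

definition smooth_cone :: "(real^'n) set set \<Rightarrow> (real^'n) set \<Rightarrow> bool" where
  "smooth_cone \<Sigma> \<tau> \<longleftrightarrow> (\<exists>b. lattice_basis b \<and> cone_rays \<Sigma> \<tau> \<subseteq> range b)"

definition dual_lattice_points :: "(real^'n) set \<Rightarrow> (int^'n) set" where
  "dual_lattice_points \<sigma> = {m. \<forall>v\<in>\<sigma>. 0 \<le> rvec m \<bullet> v}"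

definition perp_lattice_points :: "(real^'n) set \<Rightarrow> (int^'n) set" where
  "perp_lattice_points \<sigma> = {m. \<forall>v\<in>\<sigma>. rvec m \<bullet> v = 0}"


section \<open>The toric variety and its automorphisms\<close>

text \<open>
  A closed point of \<open>X(\<Sigma>)\<close> is a pair \<open>(\<tau>, \<gamma>)\<close>: the cone \<open>\<tau>\<close> of the torus orbit containing it,
  and a group homomorphism \<open>\<gamma>\<close> from \<open>\<tau>\<^sup>\<bottom> \<inter> M\<close> to the units of the field, extended by zero to
  \<open>M\<close>. For each cone \<open>\<sigma>\<close> having \<open>\<tau>\<close> as a face, the restriction of the extended \<open>\<gamma>\<close> to
  \<open>\<sigma>\<^sup>\<or> \<inter> M\<close> is the semigroup homomorphism representing the point in the affine chart of \<open>\<sigma>\<close>;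
  that is, \<open>\<gamma> m\<close> is the value of the character \<open>\<chi>\<^sup>m\<close>. The field being algebraically closed,
  automorphisms are described on closed points.
\<close>

type_synonym ('n, 'k) tpoint = "(real^'n) set \<times> (int^'n \<Rightarrow> 'k)"

definition toric_variety :: "(real^'n) set set \<Rightarrow> ('n, 'k::field) tpoint set" where
  "toric_variety \<Sigma> = {(\<tau>, \<gamma>). \<tau> \<in> \<Sigma> \<and>
     (\<forall>m. \<gamma> m \<noteq> 0 \<longleftrightarrow> m \<in> perp_lattice_points \<tau>) \<and>
     (\<forall>m \<in> perp_lattice_points \<tau>. \<forall>m' \<in> perp_lattice_points \<tau>. \<gamma> (m + m') = \<gamma> m * \<gamma> m')}"

definition chart :: "(real^'n) set set \<Rightarrow> (real^'n) set \<Rightarrow> ('n, 'k::field) tpoint set" where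
  "chart \<Sigma> \<sigma> = {x \<in> toric_variety \<Sigma>. fst x face_of \<sigma>}"

text \<open>The group algebra of \<open>M\<close> is \<open>(int^'n) \<Rightarrow>\<^sub>0 'k\<close>; \<open>Poly_Mapping.single m 1\<close> is \<open>\<chi>\<^sup>m\<close>.\<close>

definition coord_ring :: "(real^'n) set \<Rightarrow> ((int^'n) \<Rightarrow>\<^sub>0 'k::field) set" where
  "coord_ring \<sigma> = {f. Poly_Mapping.keys f \<subseteq> dual_lattice_points \<sigma>}"

definition eval_at :: "((int^'n) \<Rightarrow>\<^sub>0 'k::field) \<Rightarrow> ('n, 'k) tpoint \<Rightarrow> 'k" where
  "eval_at f x = (\<Sum>m\<in>Poly_Mapping.keys f. Poly_Mapping.lookup f m * snd x m)"

definition zariski_open :: "(real^'n) set set \<Rightarrow> ('n, 'k::field) tpoint set \<Rightarrow> bool" where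
  "zariski_open \<Sigma> V \<longleftrightarrow> V \<subseteq> toric_variety \<Sigma> \<and>
     (\<forall>\<sigma>\<in>\<Sigma>. \<exists>F \<subseteq> coord_ring \<sigma>.
        V \<inter> chart \<Sigma> \<sigma> = {x \<in> chart \<Sigma> \<sigma>. \<exists>f\<in>F. eval_at f x \<noteq> 0})"

definition regular_on ::
  "(real^'n) set set \<Rightarrow> ('n, 'k::field) tpoint set \<Rightarrow> (('n, 'k) tpoint \<Rightarrow> 'k) \<Rightarrow> bool" where
  "regular_on \<Sigma> V \<phi> \<longleftrightarrow>
     (\<forall>x\<in>V. \<exists>\<sigma>\<in>\<Sigma>. \<exists>W. zariski_open \<Sigma> W \<and> x \<in> W \<and> W \<subseteq> V \<inter> chart \<Sigma> \<sigma> \<and>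
        (\<exists>f\<in>coord_ring \<sigma>. \<exists>h\<in>coord_ring \<sigma>.
           \<forall>y\<in>W. eval_at h y \<noteq> 0 \<and> \<phi> y = eval_at f y / eval_at h y))"

definition variety_endo ::
  "(real^'n) set set \<Rightarrow> (('n, 'k::field) tpoint \<Rightarrow> ('n, 'k) tpoint) \<Rightarrow> bool" where
  "variety_endo \<Sigma> g \<longleftrightarrow> g ` toric_variety \<Sigma> \<subseteq> toric_variety \<Sigma> \<and>
     (\<forall>V. zariski_open \<Sigma> V \<longrightarrow>
        zariski_open \<Sigma> (g -` V \<inter> toric_variety \<Sigma>) \<and>
        (\<forall>\<phi>. regular_on \<Sigma> V \<phi> \<longrightarrow> regular_on \<Sigma> (g -` V \<inter> toric_variety \<Sigma>) (\<phi> \<circ> g)))"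

definition variety_aut ::
  "(real^'n) set set \<Rightarrow> (('n, 'k::field) tpoint \<Rightarrow> ('n, 'k) tpoint) \<Rightarrow> bool" where
  "variety_aut \<Sigma> g \<longleftrightarrow> variety_endo \<Sigma> g \<and>
     (\<exists>h. variety_endo \<Sigma> h \<and> (\<forall>x\<in>toric_variety \<Sigma>. h (g x) = x \<and> g (h x) = x))"

text \<open>The dense torus is the orbit of the cone \<open>{0}\<close>; its points are the homomorphisms from
  \<open>M\<close> to the units of the field.\<close>

definition torus :: "(real^'n) set set \<Rightarrow> ('n, 'k::field) tpoint set" where
  "torus \<Sigma> = {x \<in> toric_variety \<Sigma>. fst x = {0}}"

definition torus_act :: "('n, 'k::field) tpoint \<Rightarrow> ('n, 'k) tpoint \<Rightarrow> ('n, 'k) tpoint" where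
  "torus_act t x = (fst x, \<lambda>m. snd t m * snd x m)"

definition transitive_point :: "(real^'n) set set \<Rightarrow> ('n, 'k::field) tpoint \<Rightarrow> bool" where
  "transitive_point \<Sigma> x \<longleftrightarrow> x \<in> toric_variety \<Sigma> \<and>
     (\<forall>t\<in>torus \<Sigma>. torus_act t x = x) \<and>
     (\<forall>y\<in>torus \<Sigma>. \<exists>g. variety_aut \<Sigma> g \<and> g x = y)"

text \<open>The field is not determined by the fan, hence the type argument.\<close>

definition transitive_cone ::
  "'k::field itself \<Rightarrow> (real^'n) set set \<Rightarrow> (real^'n) set \<Rightarrow> bool" where
  "transitive_cone K \<Sigma> \<sigma> \<longleftrightarrow> (\<exists>\<gamma> :: int^'n \<Rightarrow> 'k. transitive_point \<Sigma> (\<sigma>, \<gamma>))"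

definition quasi_transitive :: "'k::field itself \<Rightarrow> (real^'n) set set \<Rightarrow> bool" where
  "quasi_transitive K \<Sigma> \<longleftrightarrow> complete_fan \<Sigma> \<and>
     (\<exists>x :: ('n, 'k) tpoint. transitive_point \<Sigma> x)"


section \<open>Divisors, sections and linear systems\<close>

text \<open>
  A torus-invariant divisor \<open>\<Sum> d\<^sub>\<rho> D\<^sub>\<rho>\<close> is its coefficient function \<open>d\<close>, of which only the values
  on \<open>rays \<Sigma>\<close> matter. Every divisor class contains such divisors, and the dimensions below
  depend only on the class.
\<close>

definition standard_form :: "('n \<Rightarrow> int^'n) \<Rightarrow> (int^'n \<Rightarrow> int) \<Rightarrow> bool" where
  "standard_form e d \<longleftrightarrow> (\<forall>j. d (- e j) = 0)"

definition polytope_of :: "(real^'n) set set \<Rightarrow> (int^'n \<Rightarrow> int) \<Rightarrow> (rat^'n) set" where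
  "polytope_of \<Sigma> d = {m. \<forall>\<rho>\<in>rays \<Sigma>. pairing m \<rho> \<le> of_int (d \<rho>)}"

definition polytope_points :: "(real^'n) set set \<Rightarrow> (int^'n \<Rightarrow> int) \<Rightarrow> (int^'n) set" where
  "polytope_points \<Sigma> d = {m. qvec m \<in> polytope_of \<Sigma> d}"

text \<open>With the sign convention of \<open>polytope_of\<close>, the Cox monomial
  \<open>\<Prod> x\<^sub>\<rho>\<close> to the powers \<open>d\<^sub>\<rho> - \<langle>m, \<rho>\<rangle>\<close> is the rational function \<open>\<chi>\<close> to the power \<open>- m\<close>, whose
  order along \<open>D\<^sub>\<rho>\<close> is \<open>- \<langle>m, \<rho>\<rangle>\<close>.\<close>

definition global_sections ::
  "(real^'n) set set \<Rightarrow> (int^'n \<Rightarrow> int) \<Rightarrow> ((int^'n) \<Rightarrow>\<^sub>0 'k::field) set" where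
  "global_sections \<Sigma> d = {s. Poly_Mapping.keys s \<subseteq> uminus ` polytope_points \<Sigma> d}"

definition chart_sections ::
  "(real^'n) set set \<Rightarrow> (int^'n \<Rightarrow> int) \<Rightarrow> (real^'n) set \<Rightarrow> ((int^'n) \<Rightarrow>\<^sub>0 'k::field) set" where
  "chart_sections \<Sigma> d \<tau> =
     {s. Poly_Mapping.keys s \<subseteq> uminus ` {m. \<forall>\<rho>\<in>cone_rays \<Sigma> \<tau>. pairing m \<rho> \<le> d \<rho>}}"

definition point_ideal :: "('n, 'k::field) tpoint \<Rightarrow> ((int^'n) \<Rightarrow>\<^sub>0 'k) set" where
  "point_ideal x = {f \<in> coord_ring (fst x). eval_at f x = 0}"

definition alg_scale :: "'k::field \<Rightarrow> ((int^'n) \<Rightarrow>\<^sub>0 'k) \<Rightarrow> ((int^'n) \<Rightarrow>\<^sub>0 'k)" where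
  "alg_scale c f = Poly_Mapping.single 0 c * f"

lemma vector_space_alg_scale: "vector_space alg_scale"
  by unfold_locales
    (simp_all add: alg_scale_def algebra_simps single_add mult_single flip: mult.assoc)

text \<open>
  \<open>mult_sections \<Sigma> d x \<mu>\<close> is \<open>I\<^sup>\<mu> \<cdot> H\<^sup>0(U, \<O>(D))\<close>, where \<open>U\<close> is the smallest torus-invariant affine
  chart containing \<open>x\<close> and \<open>I\<close> the maximal ideal of \<open>x\<close>. No localization at \<open>x\<close> is
  needed, as the quotient of the sections by this submodule is supported at \<open>x\<close>. At a smooth
  point, where \<open>\<O>(D)\<close> is invertible, membership says that the hypersurface defined by the
  section has multiplicity at least \<open>\<mu>\<close> at \<open>x\<close>.
\<close>

primrec mult_sections ::
  "(real^'n) set set \<Rightarrow> (int^'n \<Rightarrow> int) \<Rightarrow> ('n, 'k::field) tpoint \<Rightarrow> nat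
     \<Rightarrow> ((int^'n) \<Rightarrow>\<^sub>0 'k) set" where
  "mult_sections \<Sigma> d x 0 = chart_sections \<Sigma> d (fst x)"
| "mult_sections \<Sigma> d x (Suc \<mu>) =
     module.span alg_scale {f * s | f s. f \<in> point_ideal x \<and> s \<in> mult_sections \<Sigma> d x \<mu>}"

definition linear_system ::
  "(real^'n) set set \<Rightarrow> (int^'n \<Rightarrow> int) \<Rightarrow> nat \<Rightarrow> (nat \<Rightarrow> ('n, 'k::field) tpoint) \<Rightarrow> (nat \<Rightarrow> nat)
     \<Rightarrow> ((int^'n) \<Rightarrow>\<^sub>0 'k) set" where
  "linear_system \<Sigma> d k p \<mu> =
     {s \<in> global_sections \<Sigma> d. \<forall>i<k. s \<in> mult_sections \<Sigma> d (p i) (\<mu> i)}"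

text \<open>The linear system itself is the projectivization of the above space of sections.\<close>

definition ls_dim ::
  "(real^'n) set set \<Rightarrow> (int^'n \<Rightarrow> int) \<Rightarrow> nat \<Rightarrow> (nat \<Rightarrow> ('n, 'k::field) tpoint) \<Rightarrow> (nat \<Rightarrow> nat)
     \<Rightarrow> int" where
  "ls_dim \<Sigma> d k p \<mu> = int (vector_space.dim alg_scale (linear_system \<Sigma> d k p \<mu>)) - 1"

text \<open>
  The multiplicity of a hypersurface is only considered at smooth points, so the tuples of points
  among which the minimal dimension is sought are tuples of smooth points: at a singular point
  the condition \<open>s \<in> mult_sections \<Sigma> d x \<mu>\<close> can be more restrictive than at a general one, and the
  minimum would not be attained on an open set. The first \<open>k\<close> values of \<open>p\<close> form the tuple.
\<close>

definition smooth_points :: "(real^'n) set set \<Rightarrow> ('n, 'k::field) tpoint set" where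
  "smooth_points \<Sigma> = {x \<in> toric_variety \<Sigma>. smooth_cone \<Sigma> (fst x)}"

definition min_locus ::
  "(real^'n) set set \<Rightarrow> (int^'n \<Rightarrow> int) \<Rightarrow> nat \<Rightarrow> (nat \<Rightarrow> nat)
     \<Rightarrow> (nat \<Rightarrow> ('n, 'k::field) tpoint) set" where
  "min_locus \<Sigma> d k \<mu> = {p. (\<forall>i<k. p i \<in> smooth_points \<Sigma>) \<and>
     (\<forall>q :: nat \<Rightarrow> ('n, 'k) tpoint. (\<forall>i<k. q i \<in> smooth_points \<Sigma>) \<longrightarrow> ls_dim \<Sigma> d k p \<mu> \<le> ls_dim \<Sigma> d k q \<mu>)}"

definition very_general ::
  "(real^'n) set set \<Rightarrow> nat \<Rightarrow> (nat \<Rightarrow> ('n, 'k::field) tpoint) \<Rightarrow> bool" where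
  "very_general \<Sigma> k p \<longleftrightarrow> (\<forall>d \<mu>. p \<in> min_locus \<Sigma> d k \<mu>)"

text \<open>
  The point of the torus with affine coordinates \<open>a\<close> in the chart of the cone spanned by
  \<open>- e\<^sub>1, \<dots>, - e\<^sub>n\<close>. The \<open>j\<close>-th coordinate, which cuts out the divisor of \<open>- e\<^sub>j\<close>, is the character
  of the negative of the \<open>j\<close>-th dual basis vector.
\<close>

definition torus_point :: "('n \<Rightarrow> int^'n) \<Rightarrow> 'k::field^'n \<Rightarrow> ('n, 'k) tpoint" where
  "torus_point e a = ({0}, \<lambda>m. \<Prod>j\<in>UNIV. (a $ j) powi (- pairing m (e j)))"


section \<open>The interpolation matrix\<close>

text \<open>Polynomials in variables indexed by \<open>'n\<close> are elements of \<open>('n \<Rightarrow>\<^sub>0 nat) \<Rightarrow>\<^sub>0 'k\<close>.\<close>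

definition var :: "'n \<Rightarrow> ('n \<Rightarrow>\<^sub>0 nat) \<Rightarrow>\<^sub>0 'k::field" where
  "var j = Poly_Mapping.single (Poly_Mapping.single j 1) 1"

definition eval_poly :: "(('n::finite \<Rightarrow>\<^sub>0 nat) \<Rightarrow>\<^sub>0 'k::field) \<Rightarrow> 'k^'n \<Rightarrow> 'k" where
  "eval_poly f a = (\<Sum>\<alpha>\<in>Poly_Mapping.keys f.
     Poly_Mapping.lookup f \<alpha> * (\<Prod>j\<in>UNIV. (a $ j) ^ Poly_Mapping.lookup \<alpha> j))"

definition partial_deriv ::
  "'n \<Rightarrow> (('n \<Rightarrow>\<^sub>0 nat) \<Rightarrow>\<^sub>0 'k::field) \<Rightarrow> (('n \<Rightarrow>\<^sub>0 nat) \<Rightarrow>\<^sub>0 'k)" where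
  "partial_deriv j f = (\<Sum>\<alpha>\<in>Poly_Mapping.keys f.
     Poly_Mapping.single (\<alpha> - Poly_Mapping.single j 1)
       (of_nat (Poly_Mapping.lookup \<alpha> j) * Poly_Mapping.lookup f \<alpha>))"

text \<open>The partial derivatives commute, so the fold does not depend on the order.\<close>

definition mixed_deriv ::
  "('n \<Rightarrow> int^'n) \<Rightarrow> int^'n \<Rightarrow> (('n::finite \<Rightarrow>\<^sub>0 nat) \<Rightarrow>\<^sub>0 'k::field) \<Rightarrow> (('n \<Rightarrow>\<^sub>0 nat) \<Rightarrow>\<^sub>0 'k)" where
  "mixed_deriv e u f =
     Finite_Set.fold (\<lambda>j. partial_deriv j ^^ nat (pairing u (e j))) f UNIV"

definition cox_subst :: "('n \<Rightarrow> int^'n) \<Rightarrow> int^'n \<Rightarrow> (('n::finite \<Rightarrow>\<^sub>0 nat) \<Rightarrow>\<^sub>0 'k::field)" where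
  "cox_subst e \<rho> = (if \<exists>j. \<rho> = - e j then var (THE j. \<rho> = - e j) else 1)"

definition y_monomial ::
  "(real^'n) set set \<Rightarrow> ('n \<Rightarrow> int^'n) \<Rightarrow> (int^'n \<Rightarrow> int) \<Rightarrow> int^'n
     \<Rightarrow> (('n::finite \<Rightarrow>\<^sub>0 nat) \<Rightarrow>\<^sub>0 'k::field)" where
  "y_monomial \<Sigma> e d m = (\<Prod>\<rho>\<in>rays \<Sigma>. cox_subst e \<rho> ^ nat (d \<rho> - pairing m \<rho>))"

text \<open>
  The orders of differentiation are at most \<open>\<mu> - 1\<close>: these are the derivatives
  whose vanishing means multiplicity at least \<open>\<mu>\<close>, and there are \<open>(n + \<mu> - 1) choose n\<close> of them.
\<close>

definition Delta :: "('n \<Rightarrow> int^'n) \<Rightarrow> nat \<Rightarrow> (int^'n) set" where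
  "Delta e \<mu> = {u. pairing u (\<Sum>j\<in>UNIV. e j) \<le> int \<mu> - 1 \<and> (\<forall>j. 0 \<le> pairing u (e j))}"

definition Delta_in ::
  "(real^'n) set set \<Rightarrow> ('n \<Rightarrow> int^'n) \<Rightarrow> (int^'n \<Rightarrow> int) \<Rightarrow> nat \<Rightarrow> (int^'n) set" where
  "Delta_in \<Sigma> e d \<mu> = Delta e \<mu> \<inter> polytope_points \<Sigma> d"

definition interp_entry ::
  "(real^'n) set set \<Rightarrow> ('n \<Rightarrow> int^'n) \<Rightarrow> (int^'n \<Rightarrow> int) \<Rightarrow> (nat \<Rightarrow> 'k::field^'n)
     \<Rightarrow> nat \<times> (int^'n) \<Rightarrow> int^'n \<Rightarrow> 'k" where
  "interp_entry \<Sigma> e d p = (\<lambda>(i, u) m. eval_poly (mixed_deriv e u (y_monomial \<Sigma> e d m)) (p i))"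

lemma vector_space_fun_scale: "vector_space (\<lambda>(c::'k::field) v x. c * v x)"
  by unfold_locales (auto simp: fun_eq_iff algebra_simps)

text \<open>The rank of the matrix \<open>A\<close> with rows indexed by \<open>R\<close> and columns by \<open>C\<close>; a row is a
  function supported on \<open>C\<close>.\<close>

definition matrix_rank :: "'r set \<Rightarrow> 'c set \<Rightarrow> ('r \<Rightarrow> 'c \<Rightarrow> 'k::field) \<Rightarrow> nat" where
  "matrix_rank R C A =
     vector_space.dim (\<lambda>c v x. c * v x) ((\<lambda>r x. if x \<in> C then A r x else 0) ` R)"

definition interp_rank ::
  "(real^'n) set set \<Rightarrow> ('n \<Rightarrow> int^'n) \<Rightarrow> (int^'n \<Rightarrow> int) \<Rightarrow> nat \<Rightarrow> (nat \<Rightarrow> 'k::field^'n)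
     \<Rightarrow> (nat \<Rightarrow> nat) \<Rightarrow> nat" where
  "interp_rank \<Sigma> e d k p \<mu> =
     matrix_rank (SIGMA i:{..<k}. Delta e (\<mu> i)) (polytope_points \<Sigma> d) (interp_entry \<Sigma> e d p)"


section \<open>Expected dimensions\<close>

definition class_dim :: "(real^'n) set set \<Rightarrow> (int^'n \<Rightarrow> int) \<Rightarrow> nat" where
  "class_dim \<Sigma> d = card (polytope_points \<Sigma> d)"

definition vdim :: "(real^'n) set set \<Rightarrow> (int^'n \<Rightarrow> int) \<Rightarrow> nat \<Rightarrow> (nat \<Rightarrow> nat) \<Rightarrow> int" where
  "vdim \<Sigma> d k \<mu> = int (class_dim \<Sigma> d)
     - (\<Sum>i<k. int ((CARD('n) + \<mu> i - 1) choose CARD('n))) - 1"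

definition edim :: "(real^'n) set set \<Rightarrow> (int^'n \<Rightarrow> int) \<Rightarrow> nat \<Rightarrow> (nat \<Rightarrow> nat) \<Rightarrow> int" where
  "edim \<Sigma> d k \<mu> = max (vdim \<Sigma> d k \<mu>) (-1)"

definition tvdim ::
  "(real^'n) set set \<Rightarrow> ('n \<Rightarrow> int^'n) \<Rightarrow> (int^'n \<Rightarrow> int) \<Rightarrow> nat \<Rightarrow> (nat \<Rightarrow> nat) \<Rightarrow> int" where
  "tvdim \<Sigma> e d k \<mu> = int (class_dim \<Sigma> d) - (\<Sum>i<k. int (card (Delta_in \<Sigma> e d (\<mu> i)))) - 1"

definition tedim ::
  "(real^'n) set set \<Rightarrow> ('n \<Rightarrow> int^'n) \<Rightarrow> (int^'n \<Rightarrow> int) \<Rightarrow> nat \<Rightarrow> (nat \<Rightarrow> nat) \<Rightarrow> int" where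
  "tedim \<Sigma> e d k \<mu> = max (tvdim \<Sigma> e d k \<mu>) (-1)"

end

theory Submission
  imports Defs
begin

text \<open>
  Sections of \<open>\<O>(D)\<close> are Laurent polynomials with exponents in \<open>- P(D)\<close>, and on the torus a section
  has multiplicity at least \<open>\<mu>\<close> at a point exactly when its derivatives of order less than \<open>\<mu>\<close>
  vanish there (by Euler's formula modulo powers of the maximal ideal). So the sections in question
  form the kernel of the interpolation matrix, whence the formula for the dimension.

  For the bound by \<open>tedim\<close> it suffices that \<open>P(D) \<inter> M\<close> is closed downwards in the first orthant:
  then the rows indexed by \<open>u \<notin> P(D)\<close> are zero. This closure holds because all rays other than the
  \<open>- e j\<close> lie in the cone spanned by the \<open>e j\<close>. To see it, let \<open>g\<close> be an automorphism moving the
  fixed point \<open>x0\<close> of the transitive cone to the unit \<open>y0\<close> of the torus, and let \<open>E = g(D j)\<close>, which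
  passes through \<open>y0\<close>. The coordinate ring of the torus is factorial, so \<open>E\<close> has an equation \<open>F\<close>
  there, and for an exponent \<open>m\<close> of \<open>F\<close> the function \<open>\<chi>\<^sup>m / F\<close> is regular outside \<open>E\<close> (\<open>E\<close> is linearly
  equivalent to an effective invariant divisor). Its pullback under \<open>g\<close> is regular outside \<open>D j\<close>, hence
  a Laurent polynomial with exponents nonnegative on all rays except \<open>- e j\<close>, and its inverse is
  regular at \<open>x0\<close> with value \<open>0\<close>. Comparing constant terms, one of the exponents is a positive multiple
  of the \<open>j\<close>-th dual basis vector.
\<close>

section \<open>Relative unique factorization\<close>

text \<open>The automorphism is known only through what it does to open sets and regular functions,
  so nothing about it can be computed. What can be transported is that a function is regular, or
  vanishes, somewhere. Hence the argument is a chain of local fractions, and two fractions are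
  compared by evaluating at all characters outside a hypersurface of the torus, which determines a
  Laurent polynomial. Factoriality is used twice: it extracts the prime \<open>F\<close> from a
  local equation of \<open>E\<close>, and it merges local fractions defined all over the torus into
  one Laurent polynomial. Why \<open>\<chi>\<^sup>m / F\<close> has poles on \<open>E\<close> only:
  near a point outside \<open>E\<close> there is a function \<open>f = F * Q\<close>, nonzero at the
  point. For a vector of the cone, the least weights of the exponents of \<open>F\<close> and
  \<open>Q\<close> add up to the weight of an exponent of \<open>f\<close>, which is nonnegative,
  and \<open>m\<close> weighs at least as much as the minimum over \<open>F\<close>. So
  \<open>\<chi>\<^sup>m * Q\<close> is regular there, and dividing it by \<open>f\<close> gives the
  function. The multiple of the dual basis vector found at the end is not determined, but only its
  sign matters. Characteristic zero enters again when Euler's formula is divided by the order of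
  vanishing.\<close>

definition subring_set :: "'a::comm_ring_1 set \<Rightarrow> bool" where
  "subring_set R \<longleftrightarrow> 1 \<in> R \<and> (\<forall>a\<in>R. \<forall>b\<in>R. a - b \<in> R \<and> a * b \<in> R)"

definition dvd_in :: "'a::comm_ring_1 set \<Rightarrow> 'a \<Rightarrow> 'a \<Rightarrow> bool" where
  "dvd_in R a b \<longleftrightarrow> (\<exists>q\<in>R. b = a * q)"

definition prime_in :: "'a::comm_ring_1 set \<Rightarrow> 'a \<Rightarrow> bool" where
  "prime_in R p \<longleftrightarrow> p \<in> R \<and> p \<noteq> 0 \<and> \<not> dvd_in R p 1 \<and>
     (\<forall>a\<in>R. \<forall>b\<in>R. dvd_in R p (a * b) \<longrightarrow> dvd_in R p a \<or> dvd_in R p b)"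

text \<open>Only existence is required: in a domain, a factorization into primes is automatically
  unique up to units. Rings are subsets of one ambient ring because the induction on the number of
  variables passes through a chain of subrings of the Laurent polynomials.\<close>

definition ufd_in :: "'a::comm_ring_1 set \<Rightarrow> bool" where
  "ufd_in R \<longleftrightarrow> (\<forall>a\<in>R. a \<noteq> 0 \<longrightarrow>
     (\<exists>u ps. u \<in> R \<and> dvd_in R u 1 \<and> (\<forall>p\<in>set ps. prime_in R p) \<and> a = u * prod_list ps))"

definition polys_over :: "'a::comm_ring_1 set \<Rightarrow> 'a poly set" where
  "polys_over R = {f. \<forall>i. coeff f i \<in> R}"

lemma subring_setD:
  assumes "subring_set R"
  shows "1 \<in> R" "0 \<in> R" "\<And>a b. a \<in> R \<Longrightarrow> b \<in> R \<Longrightarrow> a - b \<in> R"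
    "\<And>a b. a \<in> R \<Longrightarrow> b \<in> R \<Longrightarrow> a * b \<in> R" "\<And>a. a \<in> R \<Longrightarrow> - a \<in> R"
    "\<And>a b. a \<in> R \<Longrightarrow> b \<in> R \<Longrightarrow> a + b \<in> R"
proof -
  show 1: "1 \<in> R" and d: "\<And>a b. a \<in> R \<Longrightarrow> b \<in> R \<Longrightarrow> a - b \<in> R"
    and "\<And>a b. a \<in> R \<Longrightarrow> b \<in> R \<Longrightarrow> a * b \<in> R"
    using assms by (auto simp: subring_set_def)
  show z: "0 \<in> R" using d[OF 1 1] by simp
  show m: "\<And>a. a \<in> R \<Longrightarrow> - a \<in> R" using d[OF z] by simp
  show "\<And>a b. a \<in> R \<Longrightarrow> b \<in> R \<Longrightarrow> a + b \<in> R" using d[OF _ m] by simp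
qed

lemma subring_set_sum:
  assumes "subring_set R" "\<And>i. i \<in> I \<Longrightarrow> f i \<in> R"
  shows "sum f I \<in> R"
  using assms(2) by (induction I rule: infinite_finite_induct) (auto intro: subring_setD[OF assms(1)])

lemma subring_set_prod_list:
  assumes "subring_set R" "set ps \<subseteq> R"
  shows "prod_list ps \<in> R"
  using assms(2) by (induction ps) (auto intro: subring_setD[OF assms(1)])

lemma subring_set_power:
  assumes "subring_set R" "a \<in> R"
  shows "a ^ n \<in> R"
  by (induction n) (auto intro: subring_setD[OF assms(1)] assms(2))

lemma subring_polys_over:
  assumes "subring_set R"
  shows "subring_set (polys_over R)"
  unfolding subring_set_def polys_over_def
  by (auto simp: coeff_mult coeff_pCons one_pCons split: nat.splits
      intro!: subring_setD[OF assms] subring_set_sum[OF assms])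

lemma dvd_in_trans:
  assumes "subring_set R" "dvd_in R a b" "dvd_in R b c"
  shows "dvd_in R a c"
  using assms(2,3) unfolding dvd_in_def by (metis mult.assoc subring_setD(4)[OF assms(1)])

lemma dvd_in_mult:
  assumes "subring_set R" "dvd_in R a b" "c \<in> R"
  shows "dvd_in R a (b * c)"
  using assms(2,3) unfolding dvd_in_def by (metis mult.assoc subring_setD(4)[OF assms(1)])

lemma dvd_in_add:
  assumes "subring_set R" "dvd_in R a b" "dvd_in R a c"
  shows "dvd_in R a (b + c)"
  using assms(2,3) unfolding dvd_in_def by (metis distrib_left subring_setD(6)[OF assms(1)])

lemma dvd_in_diff:
  assumes "subring_set R" "dvd_in R a b" "dvd_in R a c"
  shows "dvd_in R a (b - c)"
  using assms(2,3) unfolding dvd_in_def by (metis right_diff_distrib subring_setD(3)[OF assms(1)])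

lemma dvd_in_sum:
  assumes "subring_set R" "\<And>i. i \<in> I \<Longrightarrow> dvd_in R a (f i)"
  shows "dvd_in R a (sum f I)"
proof -
  have "dvd_in R a 0"
    unfolding dvd_in_def using subring_setD(2)[OF assms(1)] by force
  then show ?thesis using assms(2)
    by (induction I rule: infinite_finite_induct) (auto intro: dvd_in_add[OF assms(1)])
qed

lemma dvd_in_unit_mult:
  assumes "subring_set R" "dvd_in R u 1" "dvd_in R v 1"
  shows "dvd_in R (u * v) 1"
proof -
  obtain u' v' where "u' \<in> R" "u * u' = 1" "v' \<in> R" "v * v' = 1"
    using assms(2,3) unfolding dvd_in_def by metis
  moreover have "(u * v) * (u' * v') = (u * u') * (v * v')" by (simp only: mult_ac)
  ultimately have "1 = (u * v) * (u' * v')" by simp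
  then show ?thesis unfolding dvd_in_def
    using subring_setD(4)[OF assms(1)] \<open>u' \<in> R\<close> \<open>v' \<in> R\<close> by blast
qed

lemma prime_in_mult:
  assumes "prime_in R p" "a \<in> R" "b \<in> R" "dvd_in R p (a * b)"
  shows "dvd_in R p a \<or> dvd_in R p b"
  using assms unfolding prime_in_def by blast

section \<open>Polynomials over a factorial ring\<close>

lemma pCons_polys_over:
  assumes "subring_set R"
  shows "pCons a p \<in> polys_over R \<longleftrightarrow> a \<in> R \<and> p \<in> polys_over R"
  unfolding polys_over_def by (auto simp: coeff_pCons split: nat.splits)

lemma const_polys_over: "subring_set R \<Longrightarrow> [:a:] \<in> polys_over R \<longleftrightarrow> a \<in> R"
  using pCons_polys_over[of R a 0] subring_setD(2)[OF subring_polys_over] by auto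

lemma smult_polys_over:
  "subring_set R \<Longrightarrow> a \<in> R \<Longrightarrow> p \<in> polys_over R \<Longrightarrow> smult a p \<in> polys_over R"
  by (auto simp: polys_over_def intro: subring_setD)

text \<open>The quotients are chosen coefficient by coefficient. For \<open>p \<noteq> 0\<close>
  they vanish beyond the degree of \<open>f\<close> and so form a polynomial; for
  \<open>p = 0\<close> they are arbitrary, but then \<open>f = 0\<close>.\<close>

lemma dvd_in_const:
  fixes R :: "'a::idom set"
  assumes "subring_set R"
  shows "dvd_in (polys_over R) [:p:] f \<longleftrightarrow> (\<forall>i. dvd_in R p (coeff f i))"
proof
  assume "dvd_in (polys_over R) [:p:] f"
  then show "\<forall>i. dvd_in R p (coeff f i)" unfolding dvd_in_def polys_over_def by auto
next
  assume *: "\<forall>i. dvd_in R p (coeff f i)"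
  show "dvd_in (polys_over R) [:p:] f"
  proof (cases "p = 0")
    case True
    then have "f = 0" using * by (auto simp: dvd_in_def poly_eq_iff)
    moreover have "0 \<in> polys_over R" using subring_setD(2)[OF subring_polys_over[OF assms]] .
    ultimately show ?thesis unfolding dvd_in_def by force
  next
    case False
    have "\<forall>i. \<exists>q. q \<in> R \<and> coeff f i = p * q" using * by (auto simp: dvd_in_def)
    then obtain q where q: "\<And>i. q i \<in> R" "\<And>i. coeff f i = p * q i" by metis
    define g where "g = Poly (map q [0..<Suc (degree f)])"
    have cg: "coeff g i = q i" for i
    proof (cases "i \<le> degree f")
      case True
      then show ?thesis by (simp add: g_def nth_default_def del: upt_Suc)
    next
      case False
      then have "q i = 0" using q(2)[of i] \<open>p \<noteq> 0\<close> by (simp add: coeff_eq_0)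
      then show ?thesis using False by (simp add: g_def nth_default_def del: upt_Suc)
    qed
    have "f = [:p:] * g" by (simp add: poly_eq_iff cg q(2))
    moreover have "g \<in> polys_over R" by (simp add: polys_over_def cg q(1))
    ultimately show ?thesis unfolding dvd_in_def by blast
  qed
qed

text \<open>Gauss's lemma. If neither factor is divisible by \<open>p\<close>, take the lowest
  coefficients \<open>i\<close> and \<open>j\<close> that are not; in the coefficient
  \<open>i + j\<close> of the product every other term is divisible by \<open>p\<close>.\<close>

lemma prime_in_const:
  fixes R :: "'a::idom set"
  assumes R: "subring_set R" and p: "prime_in R p"
  shows "prime_in (polys_over R) [:p:]"
proof -
  have "\<not> dvd_in (polys_over R) [:p:] 1"
    using p by (auto simp: dvd_in_const[OF R] prime_in_def dest!: spec[of _ 0])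
  moreover have "dvd_in (polys_over R) [:p:] f \<or> dvd_in (polys_over R) [:p:] g"
    if f: "f \<in> polys_over R" and g: "g \<in> polys_over R"
      and d: "dvd_in (polys_over R) [:p:] (f * g)" for f g
  proof (rule ccontr)
    assume "\<not> ?thesis"
    then have ex: "\<exists>i. \<not> dvd_in R p (coeff f i)" "\<exists>i. \<not> dvd_in R p (coeff g i)"
      by (auto simp: dvd_in_const[OF R])
    define i where "i = (LEAST i. \<not> dvd_in R p (coeff f i))"
    define j where "j = (LEAST i. \<not> dvd_in R p (coeff g i))"
    have i: "\<not> dvd_in R p (coeff f i)" "\<And>k. k < i \<Longrightarrow> dvd_in R p (coeff f k)"
      unfolding i_def using LeastI_ex[OF ex(1)] not_less_Least by blast+
    have j: "\<not> dvd_in R p (coeff g j)" "\<And>k. k < j \<Longrightarrow> dvd_in R p (coeff g k)"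
      unfolding j_def using LeastI_ex[OF ex(2)] not_less_Least by blast+
    have fR: "coeff f k \<in> R" and gR: "coeff g k \<in> R" for k
      using f g by (auto simp: polys_over_def)
    define T where "T = (\<Sum>k\<in>{..i+j} - {i}. coeff f k * coeff g (i + j - k))"
    have T: "dvd_in R p T" unfolding T_def
    proof (rule dvd_in_sum[OF R])
      fix k assume "k \<in> {..i+j} - {i}"
      then consider "k < i" | "i + j - k < j" by force
      then show "dvd_in R p (coeff f k * coeff g (i + j - k))"
      proof cases
        case 1
        then show ?thesis using dvd_in_mult[OF R i(2) gR] by simp
      next
        case 2
        then show ?thesis using dvd_in_mult[OF R j(2) fR] by (simp add: mult.commute)
      qed
    qed
    have fg: "dvd_in R p (coeff (f * g) (i + j))" using d by (simp only: dvd_in_const[OF R])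
    have "coeff (f * g) (i + j) = coeff f i * coeff g (i + j - i) + T"
      unfolding coeff_mult T_def by (rule sum.remove) auto
    then have "coeff (f * g) (i + j) - T = coeff f i * coeff g j" by simp
    then have "dvd_in R p (coeff f i * coeff g j)"
      using dvd_in_diff[OF R fg T] by simp
    then show False using p fR gR i(1) j(1) by (auto simp: prime_in_def)
  qed
  ultimately show ?thesis
    using p by (auto simp: prime_in_def const_polys_over[OF R])
qed

text \<open>For nonzero \<open>f\<close> over a factorial ring this is the usual condition that the
  content is a unit, put in terms of primes so that no gcd of coefficients is involved.\<close>

definition primitive_over :: "'a::idom set \<Rightarrow> 'a poly \<Rightarrow> bool" where
  "primitive_over R f \<longleftrightarrow> (\<forall>p. prime_in R p \<longrightarrow> \<not> dvd_in (polys_over R) [:p:] f)"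

lemma smult_commute: "smult a (smult b p) = smult b (smult a p)" for a :: "'a::comm_semiring_0"
  by (simp add: mult.commute)

lemma smult_cancel: "smult p f = smult p g \<Longrightarrow> p \<noteq> 0 \<Longrightarrow> f = g" for p :: "'a::idom"
  by (auto simp: poly_eq_iff)

text \<open>Divisibility by a primitive polynomial over the fraction field descends to
  \<open>R\<close>: the primes of the denominator \<open>c\<close> are removed one at a time, each
  of them dividing \<open>Q\<close> because it cannot divide \<open>F\<close>.\<close>

lemma primitive_cancel:
  fixes R :: "'a::idom set"
  assumes R: "subring_set R" and U: "ufd_in R" and F: "F \<in> polys_over R" "primitive_over R F"
    and c: "c \<in> R" "c \<noteq> 0" and G: "G \<in> polys_over R" and Q: "Q \<in> polys_over R"
    and eq: "smult c G = F * Q"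
  shows "dvd_in (polys_over R) F G"
proof -
  note P = subring_polys_over[OF R]
  obtain u ps where u: "u \<in> R" "dvd_in R u 1" and ps: "\<forall>p\<in>set ps. prime_in R p"
    and cc: "c = u * prod_list ps" using U c unfolding ufd_in_def by blast
  show ?thesis using ps eq Q unfolding cc
  proof (induction ps arbitrary: Q)
    case Nil
    obtain v where v: "v \<in> R" "1 = u * v" using u by (auto simp: dvd_in_def)
    have "G = smult v (smult u G)" using v(2) by (simp add: mult.commute)
    also have "\<dots> = F * smult v Q" using Nil by simp
    finally show ?case unfolding dvd_in_def using smult_polys_over[OF R v(1)] Nil by blast
  next
    case (Cons p ps)
    have p: "prime_in R p" using Cons by auto
    have "set ps \<subseteq> R" using Cons.prems(1) by (auto simp: prime_in_def)
    then have up: "u * prod_list ps \<in> R"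
      using u(1) subring_setD(4)[OF R] subring_set_prod_list[OF R] by blast
    have "F * Q = [:p:] * smult (u * prod_list ps) G"
    proof -
      have cp: "[:p:] * X = smult p X" for X by simp
      have "u * prod_list (p # ps) = p * (u * prod_list ps)" by (simp only: prod_list.Cons mult.left_commute)
      then have "smult (u * prod_list (p # ps)) G = [:p:] * smult (u * prod_list ps) G"
        by (simp only: cp smult_smult)
      then show ?thesis unfolding Cons.prems(2)[symmetric] .
    qed
    then have "dvd_in (polys_over R) [:p:] (F * Q)"
      unfolding dvd_in_def using smult_polys_over[OF R up G] by blast
    then have "dvd_in (polys_over R) [:p:] Q"
      using prime_in_mult[OF prime_in_const[OF R p] F(1) Cons.prems(3)] F(2) p
      unfolding primitive_over_def by blast
    then obtain Q' where Q': "Q' \<in> polys_over R" "Q = [:p:] * Q'" by (auto simp: dvd_in_def)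
    have "smult p (smult (u * prod_list ps) G) = smult p (F * Q')"
    proof -
      have "u * prod_list (p # ps) = p * (u * prod_list ps)" by (simp only: prod_list.Cons mult.left_commute)
      then have "smult p (smult (u * prod_list ps) G) = smult (u * prod_list (p # ps)) G"
        by (simp only: smult_smult)
      also have "\<dots> = smult p (F * Q')" unfolding Cons.prems(2) Q'(2) by simp
      finally show ?thesis .
    qed
    moreover have "p \<noteq> 0" using p by (simp add: prime_in_def)
    ultimately have "smult (u * prod_list ps) G = F * Q'" by (rule smult_cancel)
    then show ?case using Cons.IH[of Q'] Cons.prems(1) Q'(1) by simp
  qed
qed

text \<open>The prime \<open>p\<close> either is associated to the head \<open>q\<close>, which is
  then dropped, or divides the rest of the product, and \<open>q\<close> is kept. The bound on the
  length makes repeated stripping terminate.\<close>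

lemma prime_in_strip:
  fixes R :: "'a::idom set"
  assumes R: "subring_set R" and p: "prime_in R p" and "\<forall>q\<in>set ps. prime_in R q"
    "a \<in> R" "u \<in> R" "dvd_in R u 1" "p * a = u * prod_list ps"
  shows "\<exists>v qs. v \<in> R \<and> dvd_in R v 1 \<and> (\<forall>q\<in>set qs. prime_in R q) \<and>
    length qs < length ps \<and> a = v * prod_list qs"
  using assms(3-)
proof (induction ps arbitrary: a)
  case Nil
  then have "dvd_in R p u" by (auto simp: dvd_in_def)
  then have "dvd_in R p 1" using dvd_in_trans[OF R] Nil by blast
  then show ?case using p by (simp add: prime_in_def)
next
  case (Cons q ps)
  have qR: "q \<in> R" "q \<noteq> 0" and pR: "p \<in> R" "p \<noteq> 0" using Cons p by (auto simp: prime_in_def)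
  have "set ps \<subseteq> R" using Cons.prems(1) by (auto simp: prime_in_def)
  then have uR: "u * prod_list ps \<in> R"
    using Cons.prems(3) subring_setD(4)[OF R] subring_set_prod_list[OF R] by blast
  have "dvd_in R p (q * (u * prod_list ps))"
    unfolding dvd_in_def using Cons by (intro bexI[of _ a]) (auto simp: mult.left_commute)
  then consider "dvd_in R p q" | "dvd_in R p (u * prod_list ps)"
    using prime_in_mult[OF p qR(1) uR] by blast
  then show ?case
  proof cases
    case 1
    then obtain r where r: "r \<in> R" "q = p * r" by (auto simp: dvd_in_def)
    \<comment> \<open>If \<open>q\<close> divided \<open>r\<close>, then \<open>p\<close> would be a
      unit. So the prime \<open>q = p * r\<close> divides \<open>p\<close>, and \<open>r\<close> is
      a unit.\<close>
    have "\<not> dvd_in R q r"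
    proof
      assume "dvd_in R q r"
      then obtain s where s: "s \<in> R" "r = q * s" by (auto simp: dvd_in_def)
      then have "q * 1 = q * (p * s)" using r by (simp add: mult_ac)
      then have "1 = p * s" using qR(2) mult_left_cancel by blast
      then show False using p s by (auto simp: prime_in_def dvd_in_def)
    qed
    moreover have "dvd_in R q (p * r)" using r subring_setD(1)[OF R] by (auto simp: dvd_in_def)
    ultimately have "dvd_in R q p"
      using prime_in_mult[of R q p r] Cons.prems(1) pR(1) r(1) by auto
    then obtain v where v: "v \<in> R" "p = q * v" by (auto simp: dvd_in_def)
    have "p * 1 = p * (r * v)" using r(2) v(2) by (metis mult.assoc mult.commute mult_1_right)
    then have "1 = r * v" using pR(2) mult_left_cancel by blast
    then have r1: "dvd_in R r 1" using v by (auto simp: dvd_in_def)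
    have "p * a = p * (r * u * prod_list ps)" using Cons r by (simp add: mult_ac)
    then have "a = (r * u) * prod_list ps" using pR by simp
    moreover have "dvd_in R (r * u) 1" using dvd_in_unit_mult[OF R r1 Cons(5)] .
    moreover have "r * u \<in> R" using r Cons subring_setD(4)[OF R] by blast
    ultimately show ?thesis using Cons by fastforce
  next
    case 2
    then obtain b where b: "b \<in> R" "u * prod_list ps = p * b" by (auto simp: dvd_in_def)
    then obtain v qs where v: "v \<in> R" "dvd_in R v 1" "\<forall>q\<in>set qs. prime_in R q"
      "length qs < length ps" "b = v * prod_list qs"
      using Cons.IH[of b] Cons.prems by auto
    have "p * a = p * (v * prod_list (q # qs))"
      using Cons b v by (simp add: mult.assoc mult.left_commute[of _ q])
    then have "a = v * prod_list (q # qs)" using pR by simp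
    then show ?thesis using v Cons(2) by (intro exI[of _ v] exI[of _ "q # qs"]) auto
  qed
qed

text \<open>A prime constant dividing \<open>f\<close> divides its leading coefficient, so constants
  can be split off at most as often as that coefficient has prime factors.\<close>

lemma primitive_part:
  fixes R :: "'a::idom set"
  assumes R: "subring_set R" and U: "ufd_in R" and f: "f \<in> polys_over R" "f \<noteq> 0"
  shows "\<exists>t f0. t \<in> R \<and> t \<noteq> 0 \<and> f0 \<in> polys_over R \<and> primitive_over R f0 \<and> f = smult t f0"
proof -
  have "lead_coeff f \<in> R" "lead_coeff f \<noteq> 0" using f by (auto simp: polys_over_def)
  then obtain u ps where "u \<in> R" "dvd_in R u 1" "\<forall>p\<in>set ps. prime_in R p"
    "lead_coeff f = u * prod_list ps" using U unfolding ufd_in_def by blast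
  then show ?thesis using f
  proof (induction "length ps" arbitrary: f u ps rule: less_induct)
    case less
    show ?case
    proof (cases "primitive_over R f")
      case True
      then show ?thesis using less subring_setD(1)[OF R] by (intro exI[of _ 1] exI[of _ f]) auto
    next
      case False
      then obtain p where p: "prime_in R p" "dvd_in (polys_over R) [:p:] f"
        by (auto simp: primitive_over_def)
      then obtain g where g: "g \<in> polys_over R" "f = smult p g" by (auto simp: dvd_in_def)
      have "p * lead_coeff g = u * prod_list ps" using less g by simp
      moreover have "lead_coeff g \<in> R" using g by (auto simp: polys_over_def)
      ultimately obtain v qs where v: "v \<in> R" "dvd_in R v 1" "\<forall>q\<in>set qs. prime_in R q"
          "length qs < length ps" "lead_coeff g = v * prod_list qs"
        using prime_in_strip[OF R p(1)] less by metis
      have "g \<noteq> 0" using g less by auto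
      then obtain t g0 where t: "t \<in> R" "t \<noteq> 0" "g0 \<in> polys_over R" "primitive_over R g0"
        "g = smult t g0" using less(1)[OF v(4) v(1-3,5) g(1)] by blast
      have "f = smult (p * t) g0" "p * t \<in> R" "p * t \<noteq> 0"
        using g t p subring_setD(4)[OF R] by (auto simp: prime_in_def)
      then show ?thesis using t by blast
    qed
  qed
qed

text \<open>Leading coefficients need not be invertible in \<open>R\<close>, so each step multiplies
  \<open>f\<close> by the leading coefficient of \<open>D\<close> before the leading terms are
  cancelled; \<open>c\<close> collects these factors.\<close>

lemma pseudo_division_over:
  fixes R :: "'a::idom set"
  assumes R: "subring_set R" and D: "D \<in> polys_over R" "D \<noteq> 0" and f: "f \<in> polys_over R"
  shows "\<exists>c Q S. c \<in> R \<and> c \<noteq> 0 \<and> Q \<in> polys_over R \<and> S \<in> polys_over R \<and>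
    smult c f = D * Q + S \<and> (S = 0 \<or> degree S < degree D)"
  using f
proof (induction "degree f" arbitrary: f rule: less_induct)
  case less
  note P = subring_polys_over[OF R]
  show ?case
  proof (cases "f = 0 \<or> degree f < degree D")
    case True
    then show ?thesis using less subring_setD[OF R] subring_setD(2)[OF P]
      by (intro exI[of _ 1] exI[of _ 0] exI[of _ f]) auto
  next
    case False
    define a where "a = lead_coeff D"
    define M where "M = monom (lead_coeff f) (degree f - degree D)"
    define g where "g = smult a f - D * M"
    have a: "a \<in> R" "a \<noteq> 0" using D by (auto simp: a_def polys_over_def)
    have MR: "M \<in> polys_over R"
      using less subring_setD(2)[OF R] by (auto simp: M_def polys_over_def)
    have gR: "g \<in> polys_over R" unfolding g_def
      by (intro subring_setD[OF P] smult_polys_over[OF R] a D MR less)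
    have M0: "M \<noteq> 0" "degree M = degree f - degree D" using False D(2) by (auto simp: M_def degree_monom_eq monom_eq_0_iff)
    have dDM: "degree (D * M) = degree f" using D M0 False by (simp add: degree_mult_eq)
    have g: "g = 0 \<or> degree g < degree f"
    proof -
      have "lead_coeff (D * M) = lead_coeff D * lead_coeff f"
        by (simp only: lead_coeff_mult M_def lead_coeff_monom)
      then have "coeff g (degree f) = 0" unfolding g_def a_def using dDM by simp
      moreover have "degree g \<le> degree f" unfolding g_def using dDM
        by (intro degree_diff_le) auto
      ultimately show ?thesis by (metis eq_zero_or_degree_less)
    qed
    have "\<exists>c Q S. c \<in> R \<and> c \<noteq> 0 \<and> Q \<in> polys_over R \<and> S \<in> polys_over R \<and>
        smult c g = D * Q + S \<and> (S = 0 \<or> degree S < degree D)"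
    proof (cases "g = 0")
      case True
      then show ?thesis using subring_setD[OF R] subring_setD(2)[OF P]
        by (intro exI[of _ 1] exI[of _ 0]) auto
    next
      case False
      then show ?thesis using less(1)[OF _ gR] g by blast
    qed
    then obtain c Q S where c: "c \<in> R" "c \<noteq> 0" "Q \<in> polys_over R" "S \<in> polys_over R"
        "smult c g = D * Q + S" "S = 0 \<or> degree S < degree D" by blast
    have "smult (c * a) f = D * (Q + smult c M) + S"
    proof -
      have "smult (c * a) f = smult c g + smult c (D * M)" by (simp add: g_def smult_diff_right)
      then show ?thesis using c(5) by (simp add: algebra_simps)
    qed
    moreover have "Q + smult c M \<in> polys_over R"
      by (intro subring_setD[OF P] smult_polys_over[OF R] c MR)
    moreover have "c * a \<in> R" "c * a \<noteq> 0" using c a subring_setD(4)[OF R] by auto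
    ultimately show ?thesis using c by blast
  qed
qed

text \<open>Over the fraction field, \<open>F\<close> and \<open>G\<close> would have a gcd that is
  a combination of both. Its role is played by a nonzero \<open>D\<close> of least degree in the
  ideal generated by \<open>F\<close> and \<open>G\<close>: by pseudo-division it divides both up to
  constants, so its primitive part \<open>D0\<close> divides \<open>F\<close> itself. By
  irreducibility either \<open>D0\<close> is \<open>F\<close> up to a constant, and then
  \<open>F\<close> divides \<open>G\<close>, or \<open>D0\<close> is a constant, and then a constant
  multiple of \<open>H\<close> is a combination of \<open>F * H\<close> and \<open>G * H\<close>,
  hence a multiple of \<open>F\<close>.\<close>

lemma irreducible_primitive_prime:
  fixes R :: "'a::idom set"
  assumes R: "subring_set R" and U: "ufd_in R" and F: "F \<in> polys_over R" "primitive_over R F"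
    and deg: "degree F > 0"
    and irr: "\<And>D Q. D \<in> polys_over R \<Longrightarrow> Q \<in> polys_over R \<Longrightarrow> F = D * Q \<Longrightarrow> degree D = 0 \<or> degree Q = 0"
  shows "prime_in (polys_over R) F"
proof -
  note P = subring_polys_over[OF R]
  have F0: "F \<noteq> 0" using deg by auto
  have "\<not> dvd_in (polys_over R) F 1"
  proof
    assume "dvd_in (polys_over R) F 1"
    then obtain q where q: "1 = F * q" by (auto simp: dvd_in_def)
    then have "q \<noteq> 0" by auto
    then have "degree (F * q) > 0" using F0 deg by (simp add: degree_mult_eq)
    then show False using q by (metis degree_1 less_irrefl)
  qed
  moreover have "dvd_in (polys_over R) F G \<or> dvd_in (polys_over R) F H"
    if G: "G \<in> polys_over R" and H: "H \<in> polys_over R" and GH: "dvd_in (polys_over R) F (G * H)" for G H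
  proof -
    obtain W where W: "W \<in> polys_over R" "G * H = F * W" using GH by (auto simp: dvd_in_def)
    define I where "I = {a * F + b * G | a b. a \<in> polys_over R \<and> b \<in> polys_over R}"
    have IR: "I \<subseteq> polys_over R" unfolding I_def using F G by (auto intro!: subring_setD[OF P])
    have "1 * F + 0 * G \<in> I" unfolding I_def using subring_setD(1,2)[OF P] by blast
    then have FI: "F \<in> I" by simp
    have "0 * F + 1 * G \<in> I" unfolding I_def using subring_setD(1,2)[OF P] by blast
    then have GI: "G \<in> I" by simp
    have I_sub: "smult c f - D * Q \<in> I"
      if "f \<in> I" "D \<in> I" "c \<in> R" "Q \<in> polys_over R" for c f D Q
    proof -
      obtain a b a' b' where "f = a * F + b * G" "D = a' * F + b' * G"
        "a \<in> polys_over R" "b \<in> polys_over R" "a' \<in> polys_over R" "b' \<in> polys_over R"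
        using \<open>f \<in> I\<close> \<open>D \<in> I\<close> by (auto simp: I_def)
      moreover from this have "smult c f - D * Q
          = (smult c a - a' * Q) * F + (smult c b - b' * Q) * G" by (simp add: algebra_simps smult_add_right)
      moreover have "smult c a - a' * Q \<in> polys_over R" "smult c b - b' * Q \<in> polys_over R"
        using calculation that by (auto intro!: subring_setD[OF P] smult_polys_over[OF R])
      ultimately show ?thesis unfolding I_def by blast
    qed
    obtain D where D: "D \<in> I" "D \<noteq> 0" "\<And>E. E \<in> I \<Longrightarrow> E \<noteq> 0 \<Longrightarrow> degree D \<le> degree E"
      using FI F0 ex_has_least_nat[of "\<lambda>D. D \<in> I \<and> D \<noteq> 0" F degree] by auto
    have DR: "D \<in> polys_over R" using D IR by auto
    have mult: "\<exists>c Q. c \<in> R \<and> c \<noteq> 0 \<and> Q \<in> polys_over R \<and> smult c f = D * Q" if fI: "f \<in> I" for f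
    proof -
      obtain c Q S where c: "c \<in> R" "c \<noteq> 0" "Q \<in> polys_over R" "smult c f = D * Q + S"
        "S = 0 \<or> degree S < degree D"
        using pseudo_division_over[OF R DR D(2) subsetD[OF IR fI]] by blast
      have "S = smult c f - D * Q" using c by simp
      then have "S \<in> I" using I_sub[OF fI D(1) c(1,3)] by simp
      then have "S = 0" using D(3) c(5) by force
      then show ?thesis using c by auto
    qed
    obtain c Q where c: "c \<in> R" "c \<noteq> 0" "Q \<in> polys_over R" "smult c F = D * Q" using mult[OF FI] by blast
    obtain c' Q' where c': "c' \<in> R" "c' \<noteq> 0" "Q' \<in> polys_over R" "smult c' G = D * Q'" using mult[OF GI] by blast
    obtain t D0 where t: "t \<in> R" "t \<noteq> 0" "D0 \<in> polys_over R" "primitive_over R D0" "D = smult t D0"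
      using primitive_part[OF R U DR D(2)] by blast
    have "smult c F = D0 * smult t Q" using c t by simp
    then have "dvd_in (polys_over R) D0 F"
      using primitive_cancel[OF R U t(3,4) c(1,2) F(1) smult_polys_over[OF R t(1) c(3)]] by blast
    then obtain S where S: "S \<in> polys_over R" "F = D0 * S" by (auto simp: dvd_in_def)
    from irr[OF t(3) S] show ?thesis
    proof
      assume "degree S = 0"
      then obtain s where s: "S = [:s:]" by (rule degree_eq_zeroE)
      have sR: "s \<in> R" "s \<noteq> 0" using S F0 by (auto simp: s const_polys_over[OF R])
      have "smult (s * c') G = F * smult t Q'"
        using c'(4) t(5) S(2) s by (simp add: smult_smult[symmetric] smult_commute[of s t] del: smult_smult)
      then have "dvd_in (polys_over R) F G"
        using primitive_cancel[OF R U F subring_setD(4)[OF R sR(1) c'(1)] _ G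
            smult_polys_over[OF R t(1) c'(3)]] sR(2) c'(2) by simp
      then show ?thesis ..
    next
      assume "degree D0 = 0"
      then obtain s where s: "D0 = [:s:]" by (rule degree_eq_zeroE)
      have sR: "s \<in> R" "s \<noteq> 0" using t D(2) by (auto simp: s const_polys_over[OF R])
      obtain a b where ab: "a \<in> polys_over R" "b \<in> polys_over R" "D = a * F + b * G"
        using D by (auto simp: I_def)
      have "smult (t * s) H = D * H" using t s by simp
      also have "\<dots> = F * (a * H) + b * (G * H)" unfolding ab by (simp add: algebra_simps)
      also have "\<dots> = F * (a * H + b * W)" unfolding W by (simp add: algebra_simps)
      finally have "dvd_in (polys_over R) F H"
        using primitive_cancel[OF R U F _ _ H, of "t * s" "a * H + b * W"] t sR ab H W
          subring_setD(4)[OF R] subring_setD(4,6)[OF P] by auto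
      then show ?thesis ..
    qed
  qed
  ultimately show ?thesis using F F0 by (auto simp: prime_in_def)
qed

text \<open>Gauss's theorem. The content is factored in \<open>R\<close>; the primitive part is
  split by induction on the degree, its factors being primitive again, until only irreducible and
  hence prime factors remain.\<close>

lemma ufd_in_polys_over:
  fixes R :: "'a::idom set"
  assumes R: "subring_set R" and U: "ufd_in R"
  shows "ufd_in (polys_over R)"
proof -
  note P = subring_polys_over[OF R]
  define fac where "fac = (\<lambda>f. \<exists>u ps. u \<in> polys_over R \<and> dvd_in (polys_over R) u 1 \<and>
    (\<forall>p\<in>set ps. prime_in (polys_over R) p) \<and> f = u * prod_list ps)"
  have fac_mult: "fac (f * g)" if fg: "fac f" "fac g" for f g
  proof -
    obtain u ps where 1: "u \<in> polys_over R" "dvd_in (polys_over R) u 1"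
      "\<forall>p\<in>set ps. prime_in (polys_over R) p" "f = u * prod_list ps" using fg(1) unfolding fac_def by blast
    obtain v qs where 2: "v \<in> polys_over R" "dvd_in (polys_over R) v 1"
      "\<forall>p\<in>set qs. prime_in (polys_over R) p" "g = v * prod_list qs" using fg(2) unfolding fac_def by blast
    have "dvd_in (polys_over R) (u * v) 1" using dvd_in_unit_mult[OF P] 1 2 by blast
    then show ?thesis unfolding fac_def using 1 2 subring_setD(4)[OF P]
      by (intro exI[of _ "u * v"] exI[of _ "ps @ qs"]) (auto simp: mult_ac)
  qed
  have fac_const: "fac [:t:]" if t: "t \<in> R" "t \<noteq> 0" for t
  proof -
    obtain u ps where u: "u \<in> R" "dvd_in R u 1" and ps: "\<forall>p\<in>set ps. prime_in R p"
      and tu: "t = u * prod_list ps" using U t unfolding ufd_in_def by blast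
    obtain v where v: "v \<in> R" "1 = u * v" using u by (auto simp: dvd_in_def)
    have "1 = [:u:] * [:v:]" using v by (simp add: mult.commute one_pCons)
    then have "dvd_in (polys_over R) [:u:] 1"
      using v const_polys_over[OF R] unfolding dvd_in_def by blast
    have "[:prod_list ps:] = prod_list (map (\<lambda>p. [:p:]) ps)"
    proof (induction ps)
      case (Cons a ps)
      have "[:prod_list (a # ps):] = [:a:] * [:prod_list ps:]" by simp
      then show ?case using Cons by simp
    qed (simp add: one_pCons)
    moreover have "[:t:] = [:u:] * [:prod_list ps:]" using tu by simp
    ultimately have "[:t:] = [:u:] * prod_list (map (\<lambda>p. [:p:]) ps)" by simp
    with \<open>dvd_in (polys_over R) [:u:] 1\<close> show ?thesis unfolding fac_def
      using u ps prime_in_const[OF R] const_polys_over[OF R]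
      by (intro exI[of _ "[:u:]"] exI[of _ "map (\<lambda>p. [:p:]) ps"]) auto
  qed
  have prim: "fac f" if "f \<in> polys_over R" "f \<noteq> 0" "primitive_over R f" for f
    using that
  proof (induction "degree f" arbitrary: f rule: less_induct)
    case less
    show ?case
    proof (cases "degree f = 0")
      case True
      then obtain a where "f = [:a:]" by (rule degree_eq_zeroE)
      then show ?thesis using fac_const[of a] less const_polys_over[OF R] by auto
    next
      case False
      show ?thesis
      proof (cases "\<forall>D Q. D \<in> polys_over R \<longrightarrow> Q \<in> polys_over R \<longrightarrow> f = D * Q
          \<longrightarrow> degree D = 0 \<or> degree Q = 0")
        case True
        then have "prime_in (polys_over R) f"
          using irreducible_primitive_prime[OF R U less(2,4)] False by blast
        then show ?thesis unfolding fac_def using subring_setD(1)[OF P]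
          by (intro exI[of _ 1] exI[of _ "[f]"]) (auto simp: dvd_in_def)
      next
        case False
        then obtain D Q where DQ: "D \<in> polys_over R" "Q \<in> polys_over R" "f = D * Q"
          "degree D \<noteq> 0" "degree Q \<noteq> 0" by blast
        have nz: "D \<noteq> 0" "Q \<noteq> 0" using DQ less by auto
        then have d: "degree D < degree f" "degree Q < degree f"
          using DQ by (auto simp: degree_mult_eq)
        have "primitive_over R D" "primitive_over R Q"
          using less(4) dvd_in_mult[OF P] DQ unfolding primitive_over_def
          by (metis, metis mult.commute)
        then show ?thesis unfolding DQ(3) using less(1) d nz DQ(1,2) fac_mult by blast
      qed
    qed
  qed
  have "fac f" if f: "f \<in> polys_over R" "f \<noteq> 0" for f
  proof -
    obtain t f0 where t: "t \<in> R" "t \<noteq> 0" "f0 \<in> polys_over R" "primitive_over R f0" "f = smult t f0"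
      using primitive_part[OF R U f] by blast
    then have "f = [:t:] * f0" "f0 \<noteq> 0" using f by auto
    then show ?thesis using fac_mult fac_const prim t by metis
  qed
  then show ?thesis unfolding ufd_in_def fac_def by blast
qed

section \<open>Adjoining an invertible variable\<close>

lemma poly_mem_subring:
  assumes "subring_set R'" "R \<subseteq> R'" "x \<in> R'" "p \<in> polys_over R"
  shows "poly p x \<in> R'"
  unfolding poly_altdef using assms
  by (intro subring_set_sum subring_setD(4)[OF assms(1)] subring_set_power) (auto simp: polys_over_def)

text \<open>The hypotheses say that \<open>R'\<close> is the ring of Laurent polynomials in
  \<open>x\<close> over \<open>R\<close>. Up to a power of the unit \<open>x\<close>, each element
  is a polynomial in \<open>x\<close>, and the prime factors of that polynomial either stay prime in
  \<open>R'\<close> or become units, as the variable itself does.\<close>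

lemma ufd_in_laurent_extension:
  fixes R :: "'a::idom set"
  assumes R: "subring_set R" and U: "ufd_in R" and R': "subring_set R'" and sub: "R \<subseteq> R'"
    and x: "x \<in> R'" "x' \<in> R'" "x * x' = 1"
    and repr: "\<And>f. f \<in> R' \<Longrightarrow> \<exists>N p. p \<in> polys_over R \<and> f * x ^ N = poly p x"
    and transc: "\<And>p. p \<in> polys_over R \<Longrightarrow> poly p x = 0 \<Longrightarrow> p = 0"
  shows "ufd_in R'"
proof -
  note P = subring_polys_over[OF R]
  note UP = ufd_in_polys_over[OF R U]
  have x0: "x \<noteq> 0" using x by auto
  have xx: "x ^ N * x' ^ N = 1" for N using x(3) by (metis power_mult_distrib power_one)
  have ev: "poly p x \<in> R'" if "p \<in> polys_over R" for p
    using poly_mem_subring[OF R' sub x(1) that] .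
  have inj: "p = q" if "p \<in> polys_over R" "q \<in> polys_over R" "poly p x = poly q x" for p q
    using transc[of "p - q"] that subring_setD(3)[OF P] by auto
  have X: "monom 1 n \<in> polys_over R" for n
    using subring_setD(1,2)[OF R] by (auto simp: polys_over_def)
  have pX: "poly (monom 1 n) x = x ^ n" for n by (simp add: poly_monom)
  have prime: "dvd_in R' (poly p x) 1 \<or> prime_in R' (poly p x)" if p: "prime_in (polys_over R) p" for p
  proof (cases "dvd_in R' (poly p x) 1")
    case False
    have pR: "p \<in> polys_over R" "p \<noteq> 0" using p by (auto simp: prime_in_def)
    then have "poly p x \<noteq> 0" using transc by blast
    moreover have "dvd_in R' (poly p x) a \<or> dvd_in R' (poly p x) b"
      if ab: "a \<in> R'" "b \<in> R'" "dvd_in R' (poly p x) (a * b)" for a b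
    proof -
      obtain c where c: "c \<in> R'" "a * b = poly p x * c" using ab by (auto simp: dvd_in_def)
      obtain i A where A: "A \<in> polys_over R" "a * x ^ i = poly A x" using repr[OF ab(1)] by blast
      obtain j B where B: "B \<in> polys_over R" "b * x ^ j = poly B x" using repr[OF ab(2)] by blast
      obtain l C where C: "C \<in> polys_over R" "c * x ^ l = poly C x" using repr[OF c(1)] by blast
      \<comment> \<open>A power of \<open>x\<close> clears the denominators of \<open>a\<close>,
        \<open>b\<close> and \<open>c\<close>. Since \<open>x\<close> is transcendental, the
        relation lifts to polynomials, where \<open>p\<close> is prime.\<close>
      have "poly (monom 1 l * (A * B)) x = x ^ l * ((a * x ^ i) * (b * x ^ j))" using A B by (simp add: pX)
      also have "\<dots> = x ^ (l + i + j) * (a * b)" by (simp add: power_add mult_ac)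
      also have "\<dots> = poly p x * ((c * x ^ l) * x ^ (i + j))" unfolding c by (simp add: power_add mult_ac)
      also have "\<dots> = poly (p * (C * monom 1 (i + j))) x" unfolding C by (simp add: pX)
      finally have "monom 1 l * (A * B) = p * (C * monom 1 (i + j))"
        using inj subring_setD(4)[OF P] A B C X pR by metis
      then have "dvd_in (polys_over R) p (monom 1 l * (A * B))"
        unfolding dvd_in_def using subring_setD(4)[OF P C(1) X] by blast
      then consider "dvd_in (polys_over R) p (monom 1 l)" | "dvd_in (polys_over R) p A"
        | "dvd_in (polys_over R) p B"
        using prime_in_mult[OF p] A(1) B(1) X subring_setD(4)[OF P] by blast
      then show ?thesis
      proof cases
        case 1
        then obtain S where S: "S \<in> polys_over R" "monom 1 l = p * S" by (auto simp: dvd_in_def)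
        then have "x ^ l = poly p x * poly S x" using pX[of l] by simp
        then have "1 = poly p x * (poly S x * x' ^ l)" using xx[of l] by (simp add: mult.assoc)
        then have "dvd_in R' (poly p x) 1" unfolding dvd_in_def
          using subring_setD(4)[OF R' ev[OF S(1)] subring_set_power[OF R' x(2)]] by blast
        then show ?thesis using False by simp
      next
        case 2
        then obtain S where S: "S \<in> polys_over R" "A = p * S" by (auto simp: dvd_in_def)
        have "a = a * x ^ i * x' ^ i" using xx[of i] by (simp add: mult.assoc)
        also have "\<dots> = poly p x * (poly S x * x' ^ i)" unfolding A S by (simp add: mult_ac)
        finally show ?thesis unfolding dvd_in_def
          using subring_setD(4)[OF R' ev[OF S(1)] subring_set_power[OF R' x(2)]] by blast
      next
        case 3
        then obtain S where S: "S \<in> polys_over R" "B = p * S" by (auto simp: dvd_in_def)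
        have "b = b * x ^ j * x' ^ j" using xx[of j] by (simp add: mult.assoc)
        also have "\<dots> = poly p x * (poly S x * x' ^ j)" unfolding B S by (simp add: mult_ac)
        finally show ?thesis unfolding dvd_in_def
          using subring_setD(4)[OF R' ev[OF S(1)] subring_set_power[OF R' x(2)]] by blast
      qed
    qed
    ultimately show ?thesis using False ev[OF pR(1)] by (auto simp: prime_in_def)
  qed simp
  have unit_mult: "u * v \<in> R' \<and> dvd_in R' (u * v) 1"
    if "u \<in> R'" "dvd_in R' u 1" "v \<in> R'" "dvd_in R' v 1" for u v
    using that dvd_in_unit_mult[OF R'] subring_setD(4)[OF R'] by blast
  have list: "\<exists>u qs. u \<in> R' \<and> dvd_in R' u 1 \<and> (\<forall>p\<in>set qs. prime_in R' p) \<and>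
      poly (prod_list ps) x = u * prod_list qs" if "\<forall>p\<in>set ps. prime_in (polys_over R) p" for ps
    using that
  proof (induction ps)
    case Nil
    then show ?case using subring_setD(1)[OF R']
      by (intro exI[of _ 1] exI[of _ "[]"]) (auto simp: dvd_in_def)
  next
    case (Cons p ps)
    then obtain u qs where u: "u \<in> R'" "dvd_in R' u 1" "\<forall>p\<in>set qs. prime_in R' p"
      "poly (prod_list ps) x = u * prod_list qs" by auto
    have pR: "poly p x \<in> R'" using Cons ev by (auto simp: prime_in_def)
    consider "dvd_in R' (poly p x) 1" | "prime_in R' (poly p x)" using prime Cons by force
    then show ?case
    proof cases
      case 1
      have "poly (prod_list (p # ps)) x = (poly p x * u) * prod_list qs"
        by (simp add: u(4) mult.assoc)
      then show ?thesis using unit_mult[OF pR 1 u(1,2)] u(3) by blast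
    next
      case 2
      have "poly (prod_list (p # ps)) x = u * prod_list (poly p x # qs)"
        by (simp add: u(4) mult.left_commute)
      moreover have "\<forall>p\<in>set (poly p x # qs). prime_in R' p" using 2 u(3) by simp
      ultimately show ?thesis using u(1,2) by blast
    qed
  qed
  show ?thesis unfolding ufd_in_def
  proof (intro ballI impI)
    fix f assume f: "f \<in> R'" "f \<noteq> 0"
    obtain N p where p: "p \<in> polys_over R" "f * x ^ N = poly p x" using repr[OF f(1)] by blast
    have "p \<noteq> 0" using p f x0 by auto
    then obtain u ps where u: "u \<in> polys_over R" "dvd_in (polys_over R) u 1"
      and ps: "\<forall>q\<in>set ps. prime_in (polys_over R) q" and pe: "p = u * prod_list ps"
      using UP p unfolding ufd_in_def by blast
    obtain v qs where v: "v \<in> R'" "dvd_in R' v 1" "\<forall>q\<in>set qs. prime_in R' q"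
      "poly (prod_list ps) x = v * prod_list qs" using list[OF ps] by blast
    obtain u' where u': "u' \<in> polys_over R" "1 = u * u'" using u by (auto simp: dvd_in_def)
    have "1 = poly u x * poly u' x" unfolding poly_mult[symmetric] u'(2)[symmetric] by simp
    then have uu: "dvd_in R' (poly u x) 1" unfolding dvd_in_def using ev[OF u'(1)] by blast
    have xx': "x' ^ N \<in> R'" "dvd_in R' (x' ^ N) 1"
      using subring_set_power[OF R' x(2)] subring_set_power[OF R' x(1)] xx[of N]
      unfolding dvd_in_def by (blast, metis mult.commute)
    have "f = f * x ^ N * x' ^ N" using xx[of N] by (simp add: mult.assoc)
    also have "\<dots> = (x' ^ N * (poly u x * v)) * prod_list qs"
      unfolding p pe poly_mult v(4) by (simp only: mult_ac)
    finally show "\<exists>u ps. u \<in> R' \<and> dvd_in R' u 1 \<and> (\<forall>p\<in>set ps. prime_in R' p) \<and> f = u * prod_list ps"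
      using v(3) unit_mult[OF xx'] unit_mult[OF ev[OF u(1)] uu v(1,2)] by blast
  qed
qed

section \<open>Finitely supported functions and their evaluation\<close>

text \<open>The function \<open>\<gamma>\<close> on exponents is arbitrary: characters give points
  of the torus, characters extended by zero give points of other orbits, and characters times
  falling factorials give derivatives.\<close>

definition ev :: "('m \<Rightarrow> 'k) \<Rightarrow> ('m \<Rightarrow>\<^sub>0 'k::comm_ring_1) \<Rightarrow> 'k" where
  "ev \<gamma> f = (\<Sum>m\<in>Poly_Mapping.keys f. Poly_Mapping.lookup f m * \<gamma> m)"

lemma poly_mapping_expand:
  fixes f :: "'m \<Rightarrow>\<^sub>0 'k::comm_monoid_add"
  assumes "finite A" "Poly_Mapping.keys f \<subseteq> A"
  shows "f = (\<Sum>m\<in>A. Poly_Mapping.single m (Poly_Mapping.lookup f m))"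
proof (rule poly_mapping_eqI)
  fix k
  have "(\<Sum>m\<in>A. Poly_Mapping.lookup (Poly_Mapping.single m (Poly_Mapping.lookup f m)) k)
      = (\<Sum>m\<in>A. if m = k then Poly_Mapping.lookup f k else 0)"
    by (intro sum.cong) (auto simp: lookup_single when_def)
  also have "\<dots> = Poly_Mapping.lookup f k"
    using assms by (auto simp: in_keys_iff)
  finally show "Poly_Mapping.lookup f k
      = Poly_Mapping.lookup (\<Sum>m\<in>A. Poly_Mapping.single m (Poly_Mapping.lookup f m)) k"
    by (simp add: lookup_sum)
qed

lemma ev_superset:
  assumes "finite A" "Poly_Mapping.keys f \<subseteq> A"
  shows "ev \<gamma> f = (\<Sum>m\<in>A. Poly_Mapping.lookup f m * \<gamma> m)"
  unfolding ev_def using assms by (intro sum.mono_neutral_left) (auto simp: in_keys_iff)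

lemma ev_0 [simp]: "ev \<gamma> 0 = 0"
  by (simp add: ev_def)

lemma ev_add: "ev \<gamma> (f + g) = ev \<gamma> f + ev \<gamma> g"
proof -
  let ?A = "Poly_Mapping.keys f \<union> Poly_Mapping.keys g"
  have "ev \<gamma> (f + g) = (\<Sum>m\<in>?A. Poly_Mapping.lookup (f + g) m * \<gamma> m)"
    using keys_add[of f g] by (intro ev_superset) auto
  moreover have "ev \<gamma> f = (\<Sum>m\<in>?A. Poly_Mapping.lookup f m * \<gamma> m)" by (intro ev_superset) auto
  moreover have "ev \<gamma> g = (\<Sum>m\<in>?A. Poly_Mapping.lookup g m * \<gamma> m)" by (intro ev_superset) auto
  ultimately show ?thesis by (simp add: lookup_add distrib_right sum.distrib)
qed

lemma ev_sum: "ev \<gamma> (sum f A) = (\<Sum>x\<in>A. ev \<gamma> (f x))"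
  by (induction A rule: infinite_finite_induct) (auto simp: ev_add)

lemma ev_single [simp]: "ev \<gamma> (Poly_Mapping.single m c) = c * \<gamma> m"
  by (cases "c = 0") (auto simp: ev_def)

lemma ev_uminus: "ev \<gamma> (- f) = - ev \<gamma> f"
  using ev_add[of \<gamma> f "- f"] by (simp add: eq_neg_iff_add_eq_0 add.commute)

lemma ev_diff: "ev \<gamma> (f - g) = ev \<gamma> f - ev \<gamma> g"
  using ev_add[of \<gamma> f "- g"] by (simp add: ev_uminus)

lemma times_expand:
  fixes f g :: "'m::monoid_add \<Rightarrow>\<^sub>0 'k::semiring_0"
  shows "f * g = (\<Sum>m\<in>Poly_Mapping.keys f. \<Sum>m'\<in>Poly_Mapping.keys g.
      Poly_Mapping.single (m + m') (Poly_Mapping.lookup f m * Poly_Mapping.lookup g m'))"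
proof -
  have "f * g = (\<Sum>m\<in>Poly_Mapping.keys f. Poly_Mapping.single m (Poly_Mapping.lookup f m))
      * (\<Sum>m\<in>Poly_Mapping.keys g. Poly_Mapping.single m (Poly_Mapping.lookup g m))"
    using poly_mapping_expand[of "Poly_Mapping.keys f" f] poly_mapping_expand[of "Poly_Mapping.keys g" g]
    by simp
  then show ?thesis by (simp add: sum_product mult_single)
qed

text \<open>Multiplicativity is demanded only on the exponents that occur, because a point outside
  the torus is multiplicative only on the semigroup of a chart containing it.\<close>

lemma ev_mult:
  assumes "\<And>m m'. m \<in> Poly_Mapping.keys f \<Longrightarrow> m' \<in> Poly_Mapping.keys g \<Longrightarrow> \<gamma> (m + m') = \<gamma> m * \<gamma> m'"
  shows "ev \<gamma> (f * g) = ev \<gamma> f * ev \<gamma> g"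
proof -
  have "ev \<gamma> (f * g) = (\<Sum>m\<in>Poly_Mapping.keys f. \<Sum>m'\<in>Poly_Mapping.keys g.
      Poly_Mapping.lookup f m * Poly_Mapping.lookup g m' * (\<gamma> m * \<gamma> m'))"
    unfolding times_expand ev_sum ev_single using assms by (intro sum.cong) auto
  also have "\<dots> = ev \<gamma> f * ev \<gamma> g"
    unfolding ev_def sum_product by (simp add: mult_ac)
  finally show ?thesis .
qed

lemma lookup_times_single:
  fixes f :: "'m::ab_group_add \<Rightarrow>\<^sub>0 'k::semiring_0"
  shows "Poly_Mapping.lookup (f * Poly_Mapping.single k c) m = Poly_Mapping.lookup f (m - k) * c"
proof -
  have "f * Poly_Mapping.single k c = (\<Sum>m'\<in>Poly_Mapping.keys f.
      Poly_Mapping.single (m' + k) (Poly_Mapping.lookup f m' * c))"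
    by (subst poly_mapping_expand[of "Poly_Mapping.keys f" f])
      (simp_all add: sum_distrib_right mult_single)
  then have "Poly_Mapping.lookup (f * Poly_Mapping.single k c) m
      = (\<Sum>m'\<in>Poly_Mapping.keys f. if m' = m - k then Poly_Mapping.lookup f (m - k) * c else 0)"
    by (auto simp: lookup_sum lookup_single when_def eq_diff_eq intro!: sum.cong)
  also have "\<dots> = Poly_Mapping.lookup f (m - k) * c"
    by (subst sum.delta) (auto simp: in_keys_iff)
  finally show ?thesis .
qed

text \<open>It serves as initial form when \<open>A\<close> is a level set of a weight, and as
  restriction to an orbit when \<open>A\<close> consists of the exponents perpendicular to a
  cone.\<close>

definition restr :: "'m set \<Rightarrow> ('m \<Rightarrow>\<^sub>0 'k::comm_monoid_add) \<Rightarrow> 'm \<Rightarrow>\<^sub>0 'k" where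
  "restr A f = (\<Sum>m\<in>Poly_Mapping.keys f \<inter> A. Poly_Mapping.single m (Poly_Mapping.lookup f m))"

lemma lookup_restr: "Poly_Mapping.lookup (restr A f) m = (if m \<in> A then Poly_Mapping.lookup f m else 0)"
proof -
  have "Poly_Mapping.lookup (restr A f) m
      = (\<Sum>k\<in>Poly_Mapping.keys f \<inter> A. if k = m then Poly_Mapping.lookup f m else 0)"
    unfolding restr_def lookup_sum by (intro sum.cong) (auto simp: lookup_single when_def)
  also have "\<dots> = (if m \<in> A then Poly_Mapping.lookup f m else 0)" by (auto simp: in_keys_iff)
  finally show ?thesis .
qed

lemma keys_restr: "Poly_Mapping.keys (restr A f) = Poly_Mapping.keys f \<inter> A"
  by (auto simp: in_keys_iff lookup_restr split: if_splits)

lemma restr_split: "f = restr A f + restr (- A) f"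
  by (rule poly_mapping_eqI) (simp add: lookup_restr lookup_add)

section \<open>Characters and the ring of Laurent polynomials\<close>

definition character :: "('m::monoid_add \<Rightarrow> 'k::monoid_mult) \<Rightarrow> bool" where
  "character \<gamma> \<longleftrightarrow> \<gamma> 0 = 1 \<and> (\<forall>m m'. \<gamma> (m + m') = \<gamma> m * \<gamma> m')"

lemma characterD:
  "character \<gamma> \<Longrightarrow> \<gamma> 0 = 1" "character \<gamma> \<Longrightarrow> \<gamma> (m + m') = \<gamma> m * \<gamma> m'"
  by (auto simp: character_def)

lemma character_nonzero:
  fixes \<gamma> :: "'m::ab_group_add \<Rightarrow> 'k::field"
  shows "character \<gamma> \<Longrightarrow> \<gamma> m \<noteq> 0"
  using characterD(2)[of \<gamma> m "- m"] characterD(1)[of \<gamma>] by auto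

lemma ev_mult_char: "character \<gamma> \<Longrightarrow> ev \<gamma> (f * g) = ev \<gamma> f * ev \<gamma> g"
  by (rule ev_mult) (rule characterD)

lemma ev_one_char: "character \<gamma> \<Longrightarrow> ev \<gamma> 1 = 1"
  using ev_single[of \<gamma> 0 1] by (simp add: characterD)

lemma pairing_add_left: "pairing (m + m') v = pairing m v + pairing m' v"
  by (simp add: pairing_def distrib_right sum.distrib)

lemma pairing_uminus_left: "pairing (- m) v = - pairing m v"
  by (simp add: pairing_def sum_negf)

lemma pairing_diff_left: "pairing (m - m') v = pairing m v - pairing m' v"
  by (simp add: pairing_def left_diff_distrib sum_subtractf)

lemma pairing_zero_left [simp]: "pairing 0 v = 0"
  by (simp add: pairing_def)

lemma pairing_add_right: "pairing m (v + v') = pairing m v + pairing m v'"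
  by (simp add: pairing_def distrib_left sum.distrib)

lemma pairing_uminus_right: "pairing m (- v) = - pairing m v"
  by (simp add: pairing_def sum_negf)

lemma pairing_zero_right [simp]: "pairing m 0 = 0"
  by (simp add: pairing_def)

lemma pairing_sum_right: "pairing m (sum f A) = (\<Sum>x\<in>A. pairing m (f x))"
  by (induction A rule: infinite_finite_induct) (auto simp: pairing_add_right)

lemma pairing_sum_left: "pairing (sum f A) v = (\<Sum>x\<in>A. pairing (f x) v)"
  by (induction A rule: infinite_finite_induct) (auto simp: pairing_add_left)

section \<open>One-parameter subgroups of generic weight\<close>

text \<open>For the weight with entries \<open>z ^ idx j\<close>, the pairing with \<open>m\<close>
  is the value at \<open>z\<close> of a polynomial whose coefficients are the entries of
  \<open>m\<close>. An integer \<open>z\<close> that avoids the finitely many roots of these nonzero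
  polynomials works.\<close>

lemma exists_generic_weight:
  fixes A :: "(int^'n) set"
  assumes "finite A" "0 \<notin> A"
  shows "\<exists>w :: int^'n. \<forall>m\<in>A. pairing m w \<noteq> 0"
proof -
  obtain idx :: "'n \<Rightarrow> nat" where idx: "inj idx"
    using finite_imp_inj_to_nat_seg[of "UNIV :: 'n set"] by auto
  define q where "q = (\<lambda>m :: int^'n. \<Sum>j\<in>UNIV. monom (m $ j) (idx j))"
  have "q m \<noteq> 0" if "m \<in> A" for m
  proof -
    have "m \<noteq> 0" using that assms by auto
    then obtain j where j: "m $ j \<noteq> 0" by (auto simp: vec_eq_iff)
    have "coeff (q m) (idx j) = (\<Sum>i\<in>UNIV. if i = j then m $ j else 0)"
      unfolding q_def coeff_sum using idx by (intro sum.cong) (auto simp: inj_eq)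
    then show ?thesis using j by auto
  qed
  then have "finite (\<Union>m\<in>A. {x. poly (q m) x = 0})"
    using assms(1) by (intro finite_UN_I poly_roots_finite)
  then obtain z where z: "z \<notin> (\<Union>m\<in>A. {x. poly (q m) x = 0})"
    using ex_new_if_finite[OF infinite_UNIV_int] by blast
  have "pairing m (\<chi> j. z ^ idx j) = poly (q m) z" for m
    by (simp add: pairing_def q_def poly_sum poly_monom)
  moreover have "\<forall>m\<in>A. poly (q m) z \<noteq> 0" using z by auto
  ultimately have "\<forall>m\<in>A. pairing m (\<chi> j. z ^ idx j) \<noteq> 0" by simp
  then show ?thesis by blast
qed

lemma exists_injective_weight:
  fixes A :: "(int^'n) set"
  assumes "finite A"
  shows "\<exists>w. inj_on (\<lambda>m. pairing m w :: int) A"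
proof -
  have "finite ((\<lambda>(m, m'). m - m') ` (A \<times> A) - {0})" using assms by simp
  then obtain w :: "int^'n" where w: "\<forall>m\<in>(\<lambda>(m, m'). m - m') ` (A \<times> A) - {0}. pairing m w \<noteq> 0"
    using exists_generic_weight[of "(\<lambda>(m, m'). m - m') ` (A \<times> A) - {0}"] by auto
  show ?thesis
  proof (intro exI[of _ w] inj_onI)
    fix m m' assume "m \<in> A" "m' \<in> A" and eq: "pairing m w = (pairing m' w :: int)"
    then have "m - m' \<in> (\<lambda>(m, m'). m - m') ` (A \<times> A)" by force
    moreover have "pairing (m - m') w = 0" using eq by (simp add: pairing_diff_left)
    ultimately have "m - m' = 0" using w by blast
    then show "m = m'" by simp
  qed
qed

lemma character_one_param:
  fixes s :: "'k::field"
  assumes "s \<noteq> 0"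
  shows "character (\<lambda>m :: int^'n. s powi pairing m w)"
  using assms by (auto simp: character_def pairing_add_left power_int_add)

text \<open>Restricting a Laurent polynomial to a one-parameter subgroup with generic weight \<open>w\<close> keeps
  its monomials apart.\<close>

lemma one_param_poly:
  fixes f :: "(int^'n) \<Rightarrow>\<^sub>0 'k::field"
  assumes "inj_on (\<lambda>m. pairing m w :: int) (Poly_Mapping.keys f)"
    and N: "\<And>m. m \<in> Poly_Mapping.keys f \<Longrightarrow> - N \<le> pairing m w"
  obtains q :: "'k poly" where
    "\<And>m. m \<in> Poly_Mapping.keys f \<Longrightarrow> coeff q (nat (pairing m w + N)) = Poly_Mapping.lookup f m"
    "\<And>s. s \<noteq> 0 \<Longrightarrow> poly q s = s powi N * ev (\<lambda>m. s powi pairing m w) f"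
proof
  define q where "q = (\<Sum>m\<in>Poly_Mapping.keys f. monom (Poly_Mapping.lookup f m) (nat (pairing m w + N)))"
  show "coeff q (nat (pairing m w + N)) = Poly_Mapping.lookup f m" if "m \<in> Poly_Mapping.keys f" for m
  proof -
    have "coeff q (nat (pairing m w + N))
        = (\<Sum>k\<in>Poly_Mapping.keys f. if k = m then Poly_Mapping.lookup f m else 0)"
      unfolding q_def coeff_sum
    proof (intro sum.cong refl)
      fix k assume k: "k \<in> Poly_Mapping.keys f"
      then have "nat (pairing k w + N) = nat (pairing m w + N) \<longleftrightarrow> k = m"
        using N[OF that] N[OF k] assms(1) that by (auto simp: inj_on_def)
      then show "coeff (monom (Poly_Mapping.lookup f k) (nat (pairing k w + N))) (nat (pairing m w + N))
          = (if k = m then Poly_Mapping.lookup f m else 0)" by auto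
    qed
    then show ?thesis using that by simp
  qed
  show "poly q s = s powi N * ev (\<lambda>m. s powi pairing m w) f" if "s \<noteq> 0" for s
  proof -
    have "poly q s = (\<Sum>m\<in>Poly_Mapping.keys f. Poly_Mapping.lookup f m * s powi (pairing m w + N))"
      unfolding q_def poly_sum poly_monom using N
      by (intro sum.cong refl arg_cong2[of _ _ _ _ "(*)"]) (force simp: power_int_def)
    then show ?thesis using that
      by (simp add: ev_def sum_distrib_left power_int_add mult_ac)
  qed
qed

lemma finite_int_set_lower_bound:
  assumes "finite A"
  shows "\<exists>N. \<forall>m\<in>A. - N \<le> (g m :: int)"
proof (cases "A = {}")
  case False
  have "- (- Min (g ` A)) \<le> g m" if "m \<in> A" for m using that assms by simp
  then show ?thesis by blast
qed auto

text \<open>Two hypersurfaces do not cover the torus. One weight separates the exponents of both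
  Laurent polynomials, so on its one-parameter subgroup they become nonzero polynomials in
  \<open>s\<close>, up to powers of \<open>s\<close>; the field being infinite, some
  \<open>s \<noteq> 0\<close> is a root of neither.\<close>

lemma ev_pair_nonzero:
  fixes f g :: "(int^'n) \<Rightarrow>\<^sub>0 'k::field_char_0"
  assumes "f \<noteq> 0" "g \<noteq> 0"
  shows "\<exists>\<gamma>. character \<gamma> \<and> ev \<gamma> f \<noteq> 0 \<and> ev \<gamma> g \<noteq> 0"
proof -
  obtain w :: "int^'n" where w: "inj_on (\<lambda>m. pairing m w :: int) (Poly_Mapping.keys f \<union> Poly_Mapping.keys g)"
    using exists_injective_weight[of "Poly_Mapping.keys f \<union> Poly_Mapping.keys g"] by auto
  have nz: "\<exists>q N. q \<noteq> 0 \<and> (\<forall>s. s \<noteq> 0 \<longrightarrow> poly q s = s powi N * ev (\<lambda>m. s powi pairing m w) h)"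
    if h: "h = f \<or> h = g" for h
  proof -
    obtain N where N: "\<And>m. m \<in> Poly_Mapping.keys h \<Longrightarrow> - N \<le> pairing m w"
      using finite_int_set_lower_bound[OF finite_keys[of h], of "\<lambda>m. pairing m w"] by blast
    have "inj_on (\<lambda>m. pairing m w :: int) (Poly_Mapping.keys h)" using inj_on_subset[OF w] h by blast
    then obtain q where q: "\<And>m. m \<in> Poly_Mapping.keys h \<Longrightarrow> coeff q (nat (pairing m w + N)) = Poly_Mapping.lookup h m"
      "\<And>s. s \<noteq> 0 \<Longrightarrow> poly q s = s powi N * ev (\<lambda>m. s powi pairing m w) h"
      using one_param_poly[OF _ N] by blast
    have "Poly_Mapping.keys h \<noteq> {}" using h assms by auto
    then obtain m where "m \<in> Poly_Mapping.keys h" by blast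
    then have "q \<noteq> 0" using q(1)[of m] by (auto simp: in_keys_iff)
    then show ?thesis using q(2) by blast
  qed
  obtain q N where q: "q \<noteq> 0" "\<And>s. s \<noteq> 0 \<Longrightarrow> poly q s = s powi N * ev (\<lambda>m. s powi pairing m w) f"
    using nz[of f] by blast
  obtain r M where r: "r \<noteq> 0" "\<And>s. s \<noteq> 0 \<Longrightarrow> poly r s = s powi M * ev (\<lambda>m. s powi pairing m w) g"
    using nz[of g] by blast
  have "finite ({0} \<union> {s. poly q s = 0} \<union> {s. poly r s = 0})"
    using poly_roots_finite[OF q(1)] poly_roots_finite[OF r(1)] by simp
  then have "\<exists>s. s \<notin> {0} \<union> {s. poly q s = 0} \<union> {s. poly r s = 0}"
    by (rule ex_new_if_finite[OF infinite_UNIV_char_0])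
  then obtain s where s: "s \<noteq> 0" "poly q s \<noteq> 0" "poly r s \<noteq> 0" by auto
  have "ev (\<lambda>m. s powi pairing m w) f \<noteq> 0" using q(2)[OF s(1)] s(2) by force
  moreover have "ev (\<lambda>m. s powi pairing m w) g \<noteq> 0" using r(2)[OF s(1)] s(3) by force
  ultimately show ?thesis using character_one_param[OF s(1), of w] by blast
qed

lemma laurent_no_zero_divisors:
  fixes f g :: "(int^'n) \<Rightarrow>\<^sub>0 'k::field_char_0"
  shows "f * g = 0 \<longleftrightarrow> f = 0 \<or> g = 0"
proof
  assume "f * g = 0"
  show "f = 0 \<or> g = 0"
  proof (rule ccontr)
    assume "\<not> ?thesis"
    then obtain \<gamma> where "character \<gamma>" "ev \<gamma> f \<noteq> 0" "ev \<gamma> g \<noteq> 0" using ev_pair_nonzero by blast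
    then show False using ev_mult_char[of \<gamma> f g] \<open>f * g = 0\<close> by simp
  qed
qed auto

lemma laurent_mult_left_cancel:
  fixes f g h :: "(int^'n) \<Rightarrow>\<^sub>0 'k::field_char_0"
  assumes "f \<noteq> 0"
  shows "f * g = f * h \<longleftrightarrow> g = h"
  using laurent_no_zero_divisors[of f "g - h"] assms by (auto simp: right_diff_distrib)

text \<open>On a one-parameter subgroup that separates the exponents, \<open>f\<close> becomes a
  polynomial \<open>q\<close> without roots. Over an algebraically closed field \<open>q\<close> is
  then constant, so only one exponent occurs.\<close>

lemma no_zero_imp_monomial:
  fixes f :: "(int^'n) \<Rightarrow>\<^sub>0 'k::{alg_closed_field, field_char_0}"
  assumes "\<And>\<gamma>. character \<gamma> \<Longrightarrow> ev \<gamma> f \<noteq> 0"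
  shows "\<exists>m c. c \<noteq> 0 \<and> f = Poly_Mapping.single m c"
proof -
  have "\<exists>\<gamma> :: int^'n \<Rightarrow> 'k. character \<gamma>" using character_one_param[of 1 0] by auto
  then have f0: "Poly_Mapping.keys f \<noteq> {}" using assms by auto
  obtain w :: "int^'n" where w: "inj_on (\<lambda>m. pairing m w :: int) (Poly_Mapping.keys f)"
    using exists_injective_weight[of "Poly_Mapping.keys f"] by auto
  \<comment> \<open>The shift puts the least weight at 0. So the constant coefficient of
    \<open>q\<close> is nonzero, and a root of \<open>q\<close> would be a nonzero \<open>s\<close>,
    that is, a point of the subgroup.\<close>
  define N where "N = - Min ((\<lambda>m. pairing m w) ` Poly_Mapping.keys f)"
  have "- N \<in> (\<lambda>m. pairing m w) ` Poly_Mapping.keys f"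
    unfolding N_def minus_minus using f0 by (intro Min_in) auto
  then obtain m0 where m0: "m0 \<in> Poly_Mapping.keys f" "pairing m0 w = - N" by auto
  have N: "- N \<le> pairing m w" if "m \<in> Poly_Mapping.keys f" for m
    using that by (auto simp: N_def)
  obtain q where q: "\<And>m. m \<in> Poly_Mapping.keys f \<Longrightarrow> coeff q (nat (pairing m w + N)) = Poly_Mapping.lookup f m"
      "\<And>s. s \<noteq> 0 \<Longrightarrow> poly q s = s powi N * ev (\<lambda>m. s powi pairing m w) f"
    using one_param_poly[OF w N] by blast
  have "coeff q 0 \<noteq> 0" using q(1)[OF m0(1)] m0 by (auto simp: in_keys_iff)
  have "degree q = 0"
  proof (rule ccontr)
    assume "degree q \<noteq> 0"
    then obtain s where s: "poly q s = 0" using alg_closed_imp_poly_has_root by blast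
    then have "s \<noteq> 0" using \<open>coeff q 0 \<noteq> 0\<close> by (auto simp: poly_0_coeff_0)
    then show False using q(2)[of s] s assms[OF character_one_param[of s w]] by auto
  qed
  have "Poly_Mapping.keys f \<subseteq> {m0}"
  proof
    fix m assume m: "m \<in> Poly_Mapping.keys f"
    then have "coeff q (nat (pairing m w + N)) \<noteq> 0" using q(1) by (auto simp: in_keys_iff)
    then have "nat (pairing m w + N) = 0" using \<open>degree q = 0\<close> le_degree by fastforce
    then have "pairing m w = pairing m0 w" using N[OF m] m0 by simp
    then show "m \<in> {m0}" using w m m0(1) by (auto simp: inj_on_def)
  qed
  then have "f = Poly_Mapping.single m0 (Poly_Mapping.lookup f m0)"
    using poly_mapping_expand[of "{m0}" f] by simp
  then show ?thesis using m0(1) by (auto simp: in_keys_iff)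
qed

text \<open>The parts of \<open>F\<close> and \<open>Q\<close> of least weight have a nonzero
  product, and no other pair of exponents reaches its weight, so nothing can cancel it. The weight
  is real because it will be the pairing with a vector of a cone.\<close>

lemma initial_exponents:
  fixes F Q :: "(int^'n) \<Rightarrow>\<^sub>0 'k::field_char_0" and l :: "int^'n \<Rightarrow> real"
  assumes "F \<noteq> 0" "Q \<noteq> 0" and l: "\<And>m m'. l (m + m') = l m + l m'"
  obtains m q k where "m \<in> Poly_Mapping.keys F" "q \<in> Poly_Mapping.keys Q" "k \<in> Poly_Mapping.keys (F * Q)"
    "l k = l m + l q" "\<And>m'. m' \<in> Poly_Mapping.keys F \<Longrightarrow> l m \<le> l m'"
    "\<And>q'. q' \<in> Poly_Mapping.keys Q \<Longrightarrow> l q \<le> l q'"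
proof -
  have min: "\<exists>m\<in>Poly_Mapping.keys h. \<forall>m'\<in>Poly_Mapping.keys h. l m \<le> l m'"
    if "h \<noteq> 0" for h :: "(int^'n) \<Rightarrow>\<^sub>0 'k"
  proof -
    have "Min (l ` Poly_Mapping.keys h) \<in> l ` Poly_Mapping.keys h"
      using that by (intro Min_in) auto
    then obtain m where "m \<in> Poly_Mapping.keys h" "l m = Min (l ` Poly_Mapping.keys h)" by auto
    then show ?thesis by (intro bexI[of _ m]) auto
  qed
  obtain m where m: "m \<in> Poly_Mapping.keys F" "\<And>m'. m' \<in> Poly_Mapping.keys F \<Longrightarrow> l m \<le> l m'"
    using min[OF assms(1)] by blast
  obtain q where q: "q \<in> Poly_Mapping.keys Q" "\<And>q'. q' \<in> Poly_Mapping.keys Q \<Longrightarrow> l q \<le> l q'"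
    using min[OF assms(2)] by blast
  define A B where "A = {m'. l m' = l m}" and "B = {q'. l q' = l q}"
  have "restr A F \<noteq> 0" "restr B Q \<noteq> 0" using m(1) q(1) keys_restr[of A F] keys_restr[of B Q]
    by (auto simp: A_def B_def)
  then have "restr A F * restr B Q \<noteq> 0" by (simp add: laurent_no_zero_divisors)
  then obtain k where k: "k \<in> Poly_Mapping.keys (restr A F * restr B Q)" by (metis ex_in_conv keys_eq_empty)
  then have lk: "l k = l m + l q"
    using keys_mult[of "restr A F" "restr B Q"] by (auto simp: keys_restr A_def B_def l)
  have other: "k \<notin> Poly_Mapping.keys (restr X F * restr Y Q)" if XY: "(X = - A \<or> Y = - B)" for X Y
  proof
    assume "k \<in> Poly_Mapping.keys (restr X F * restr Y Q)"
    then obtain m' q' where mq: "k = m' + q'" "m' \<in> Poly_Mapping.keys F \<inter> X" "q' \<in> Poly_Mapping.keys Q \<inter> Y"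
      using keys_mult[of "restr X F" "restr Y Q"] by (auto simp: keys_restr)
    then have "l m \<le> l m'" "l q \<le> l q'" "l m' \<noteq> l m \<or> l q' \<noteq> l q" using m q XY by (auto simp: A_def B_def)
    moreover have "l m' = l m" "l q' = l q"
      using calculation(1,2) lk l[of m' q', folded mq(1)] by linarith+
    ultimately show False by simp
  qed
  have "F * Q = (restr A F + restr (- A) F) * (restr B Q + restr (- B) Q)"
    using restr_split[of F A] restr_split[of Q B] by simp
  then have "F * Q = restr A F * restr B Q + restr A F * restr (- B) Q
      + restr (- A) F * restr B Q + restr (- A) F * restr (- B) Q" by (simp add: algebra_simps)
  then have "Poly_Mapping.lookup (F * Q) k = Poly_Mapping.lookup (restr A F * restr B Q) k"
    using other[of A "- B"] other[of "- A" B] other[of "- A" "- B"] by (simp add: lookup_add in_keys_iff)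
  then have "k \<in> Poly_Mapping.keys (F * Q)" using k by (simp add: in_keys_iff)
  then show ?thesis using that m q lk by blast
qed

text \<open>A copy of the ring of Laurent polynomials that can be an instance of \<open>idom\<close>, since
  the class of exponents prevents that for \<open>(int^'n) \<Rightarrow>\<^sub>0 'k\<close> itself.\<close>

typedef (overloaded) ('n, 'k) laurent = "UNIV :: ((int^'n) \<Rightarrow>\<^sub>0 'k::field_char_0) set" ..

setup_lifting type_definition_laurent

instantiation laurent :: (finite, field_char_0) idom
begin

lift_definition zero_laurent :: "('a, 'b) laurent" is 0 .
lift_definition one_laurent :: "('a, 'b) laurent" is 1 .
lift_definition plus_laurent :: "('a, 'b) laurent \<Rightarrow> ('a, 'b) laurent \<Rightarrow> ('a, 'b) laurent" is "(+)" .
lift_definition minus_laurent :: "('a, 'b) laurent \<Rightarrow> ('a, 'b) laurent \<Rightarrow> ('a, 'b) laurent" is "(-)" .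
lift_definition uminus_laurent :: "('a, 'b) laurent \<Rightarrow> ('a, 'b) laurent" is uminus .
lift_definition times_laurent :: "('a, 'b) laurent \<Rightarrow> ('a, 'b) laurent \<Rightarrow> ('a, 'b) laurent" is "(*)" .

instance
  by standard (transfer; simp add: algebra_simps laurent_no_zero_divisors)+

end

section \<open>Factoriality of the ring of Laurent polynomials\<close>

definition laurent_in :: "'n::finite set \<Rightarrow> ('n, 'k::field_char_0) laurent set" where
  "laurent_in S = {f. \<forall>m\<in>Poly_Mapping.keys (Rep_laurent f). \<forall>j. j \<notin> S \<longrightarrow> m $ j = 0}"

lift_definition lmonom :: "int^'n::finite \<Rightarrow> 'k \<Rightarrow> ('n, 'k::field_char_0) laurent" is Poly_Mapping.single .

lemma lmonom_mult: "lmonom m c * lmonom m' c' = lmonom (m + m') (c * c')"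
  by transfer (simp add: mult_single)

lemma lmonom_one: "lmonom 0 1 = 1"
  by transfer simp

lemma axis_add: "axis j a + axis j b = axis j (a + b :: int)"
  by (simp add: axis_def vec_eq_iff)

lemma axis_0 [simp]: "axis j 0 = (0 :: int^'n)"
  by (simp add: axis_def vec_eq_iff)

lemma lmonom_axis_power: "lmonom (axis j 1) 1 ^ n = lmonom (axis j (int n)) 1"
  by (induction n) (simp_all add: lmonom_one lmonom_mult axis_add)

lemma laurent_in_mult_diff:
  assumes "a \<in> laurent_in S" "b \<in> laurent_in S"
  shows "a - b \<in> laurent_in S" "a * b \<in> laurent_in S"
  using assms keys_diff[of "Rep_laurent a" "Rep_laurent b"]
    keys_mult[of "Rep_laurent a" "Rep_laurent b"]
  unfolding laurent_in_def
  by (fastforce simp: minus_laurent.rep_eq times_laurent.rep_eq)+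

lemma subring_laurent_in: "subring_set (laurent_in S)"
proof -
  have "1 \<in> laurent_in S" by (simp add: laurent_in_def one_laurent.rep_eq)
  then show ?thesis unfolding subring_set_def using laurent_in_mult_diff by blast
qed

lemma lmonom_in: "(\<And>j. j \<notin> S \<Longrightarrow> m $ j = 0) \<Longrightarrow> lmonom m c \<in> laurent_in S"
  by (cases "c = 0") (auto simp: laurent_in_def lmonom.rep_eq)

lemma Rep_laurent_sum: "Rep_laurent (sum f A) = (\<Sum>x\<in>A. Rep_laurent (f x))"
  by (induction A rule: infinite_finite_induct) (auto simp: plus_laurent.rep_eq zero_laurent.rep_eq)

lemma laurent_expand:
  "f = (\<Sum>m\<in>Poly_Mapping.keys (Rep_laurent f). lmonom m (Poly_Mapping.lookup (Rep_laurent f) m))"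
  by (subst Rep_laurent_inject[symmetric])
    (simp add: Rep_laurent_sum lmonom.rep_eq flip: poly_mapping_expand[OF finite_keys subset_refl])

text \<open>Induction on the set of variables. Without variables every nonzero element is an
  invertible constant; a new variable adjoins the unit \<open>x\<close> and its inverse.\<close>

lemma ufd_laurent_in:
  assumes "finite S"
  shows "ufd_in (laurent_in S :: ('n::finite, 'k::field_char_0) laurent set)"
  using assms
proof (induction S)
  case empty
  show ?case unfolding ufd_in_def
  proof (intro ballI impI)
    fix a :: "('n, 'k) laurent" assume a: "a \<in> laurent_in {}" "a \<noteq> 0"
    then have "Poly_Mapping.keys (Rep_laurent a) \<subseteq> {0}" by (auto simp: laurent_in_def vec_eq_iff)
    then have "Rep_laurent a = Poly_Mapping.single 0 (Poly_Mapping.lookup (Rep_laurent a) 0)"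
      using poly_mapping_expand[of "{0}" "Rep_laurent a"] by simp
    then obtain c where c: "a = lmonom 0 c" by (metis Rep_laurent_inverse lmonom.abs_eq)
    have "c \<noteq> 0"
    proof
      assume "c = 0"
      then have "a = 0" unfolding c by transfer simp
      then show False using a by simp
    qed
    then have "1 = a * lmonom 0 (inverse c)" by (simp add: c lmonom_mult lmonom_one)
    moreover have "lmonom 0 (inverse c) \<in> laurent_in {}" by (rule lmonom_in) simp
    ultimately have "dvd_in (laurent_in {}) a 1" unfolding dvd_in_def by blast
    then show "\<exists>u ps. u \<in> laurent_in {} \<and> dvd_in (laurent_in {}) u 1 \<and>
        (\<forall>p\<in>set ps. prime_in (laurent_in {}) p) \<and> a = u * prod_list ps"
      using a(1) by (intro exI[of _ a] exI[of _ "[]"]) simp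
  qed
next
  case (insert j S)
  let ?R = "laurent_in S :: ('n, 'k) laurent set" and ?R' = "laurent_in (insert j S) :: ('n, 'k) laurent set"
  define x x' :: "('n, 'k) laurent" where "x = lmonom (axis j 1) 1" and "x' = lmonom (axis j (- 1)) 1"
  note P = subring_polys_over[OF subring_laurent_in[of S]]
  have xn: "x ^ n = lmonom (axis j (int n)) 1" for n by (simp add: x_def lmonom_axis_power)

  \<comment> \<open>\<open>E\<close> is closed under addition, so it is enough to treat monomials,
    where a negative power of the variable \<open>j\<close> is cleared by a power of
    \<open>x\<close>.\<close>
  define E where "E = {f :: ('n, 'k) laurent. \<exists>N p. p \<in> polys_over ?R \<and> f * x ^ N = poly p x}"
  have E_add: "f + g \<in> E" if fg: "f \<in> E" "g \<in> E" for f g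
  proof -
    obtain N p where p: "p \<in> polys_over ?R" "f * x ^ N = poly p x" using fg by (auto simp: E_def)
    obtain M q where q: "q \<in> polys_over ?R" "g * x ^ M = poly q x" using fg by (auto simp: E_def)
    have X: "monom 1 n \<in> polys_over ?R" for n
      using subring_setD(1,2)[OF subring_laurent_in[of S]] by (auto simp: polys_over_def)
    have "(f + g) * x ^ (N + M) = (f * x ^ N) * x ^ M + (g * x ^ M) * x ^ N"
      by (simp add: power_add algebra_simps)
    also have "\<dots> = poly (p * monom 1 M + q * monom 1 N) x"
      unfolding p q by (simp add: poly_monom)
    finally have "(f + g) * x ^ (N + M) = poly (p * monom 1 M + q * monom 1 N) x" .
    moreover have "p * monom 1 M + q * monom 1 N \<in> polys_over ?R"
      by (intro subring_setD[OF P] p q X)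
    ultimately show ?thesis unfolding E_def by blast
  qed
  have E_0: "0 \<in> E" unfolding E_def
    using subring_setD(2)[OF P] by (auto intro!: exI[of _ 0])
  have E_single: "lmonom m c \<in> E" if m: "\<And>i. i \<notin> insert j S \<Longrightarrow> m $ i = 0" for m c
  proof -
    define m' where "m' = m + axis j (- (m $ j))"
    have "lmonom m' c \<in> ?R"
      by (rule lmonom_in) (use m in \<open>auto simp: m'_def axis_def\<close>)
    then have p: "monom (lmonom m' c) (nat (m $ j)) \<in> polys_over ?R"
      using subring_setD(2)[OF subring_laurent_in[of S]] by (auto simp: polys_over_def)
    have "m + axis j (int (nat (- (m $ j)))) = m' + axis j (int (nat (m $ j)))"
      by (simp add: m'_def axis_def vec_eq_iff)
    then have "lmonom m c * x ^ nat (- (m $ j)) = poly (monom (lmonom m' c) (nat (m $ j))) x"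
      by (simp add: poly_monom xn lmonom_mult)
    then show ?thesis unfolding E_def using p by blast
  qed
  show ?case
  proof (rule ufd_in_laurent_extension[OF subring_laurent_in insert.IH subring_laurent_in])
    show "?R \<subseteq> ?R'" by (auto simp: laurent_in_def)
    show "x \<in> ?R'" "x' \<in> ?R'"
      unfolding x_def x'_def by (auto intro!: lmonom_in simp: axis_def split: if_splits)
    show "x * x' = 1" by (simp add: x_def x'_def lmonom_mult axis_add lmonom_one)
    show "\<exists>N p. p \<in> polys_over ?R \<and> f * x ^ N = poly p x" if f: "f \<in> ?R'" for f
    proof -
      have "(\<Sum>m\<in>A. lmonom m (Poly_Mapping.lookup (Rep_laurent f) m)) \<in> E"
        if "A \<subseteq> Poly_Mapping.keys (Rep_laurent f)" for A
        using finite_subset[OF that finite_keys] that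
      proof (induction A)
        case (insert m A)
        then have "lmonom m (Poly_Mapping.lookup (Rep_laurent f) m) \<in> E"
          using f by (intro E_single) (auto simp: laurent_in_def)
        then show ?case using insert by (simp add: E_add)
      qed (simp add: E_0)
      from this[OF subset_refl] have "f \<in> E" using laurent_expand[of f] by simp
      then show ?thesis by (simp add: E_def)
    qed
    show "p = 0" if p: "p \<in> polys_over ?R" and p0: "poly p x = 0" for p
    proof -
      have "Poly_Mapping.lookup (Rep_laurent (coeff p i)) m = 0" for i m
      proof (cases "m $ j = 0")
        case False
        have "coeff p i \<in> ?R" using p by (auto simp: polys_over_def)
        then show ?thesis using False insert.hyps by (auto simp: laurent_in_def in_keys_iff)
      next
        case True
        \<comment> \<open>The coefficients of \<open>p\<close> do not involve the variable
          \<open>j\<close>, so at the exponent \<open>m'\<close> only the term of degree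
          \<open>i\<close> contributes to \<open>poly p x\<close>.\<close>
        define m' where "m' = m + axis j (int i)"
        have ck: "Poly_Mapping.lookup (Rep_laurent (coeff p k * x ^ k)) m'
            = (if k = i then Poly_Mapping.lookup (Rep_laurent (coeff p i)) m else 0)" for k
        proof -
          have "Poly_Mapping.lookup (Rep_laurent (coeff p k * x ^ k)) m'
              = Poly_Mapping.lookup (Rep_laurent (coeff p k)) (m' - axis j (int k))"
            by (simp add: xn times_laurent.rep_eq lmonom.rep_eq lookup_times_single)
          moreover have "Poly_Mapping.lookup (Rep_laurent (coeff p k)) (m' - axis j (int k)) = 0" if "k \<noteq> i"
          proof -
            have "coeff p k \<in> ?R" using p by (auto simp: polys_over_def)
            moreover have "(m' - axis j (int k)) $ j \<noteq> 0" using True that by (simp add: m'_def)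
            ultimately have "m' - axis j (int k) \<notin> Poly_Mapping.keys (Rep_laurent (coeff p k))"
              using insert.hyps(2) unfolding laurent_in_def by fast
            then show ?thesis by (simp only: in_keys_iff not_not)
          qed
          ultimately show ?thesis by (auto simp: m'_def)
        qed
        have "0 = Poly_Mapping.lookup (Rep_laurent (poly p x)) m'"
          by (simp add: p0 zero_laurent.rep_eq)
        also have "\<dots> = (\<Sum>k\<le>degree p. if k = i then Poly_Mapping.lookup (Rep_laurent (coeff p i)) m else 0)"
          by (simp add: poly_altdef Rep_laurent_sum lookup_sum ck)
        also have "\<dots> = Poly_Mapping.lookup (Rep_laurent (coeff p i)) m"
          by (auto simp: coeff_eq_0 zero_laurent.rep_eq)
        finally show ?thesis by simp
      qed
      then have "coeff p i = 0" for i
        by (subst Rep_laurent_inject[symmetric]) (auto intro!: poly_mapping_eqI simp: zero_laurent.rep_eq)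
      then show ?thesis by (simp add: poly_eq_iff)
    qed
  qed
qed

text \<open>Carries the factorization from the copy back to the original type, where primes and
  divisibility are the standard \<open>prime_elem\<close> and \<open>dvd\<close>.\<close>

lemma laurent_prime_factorization:
  fixes f :: "(int^'n) \<Rightarrow>\<^sub>0 'k::field_char_0"
  assumes "f \<noteq> 0"
  shows "\<exists>u ps. u dvd 1 \<and> (\<forall>p\<in>set ps. prime_elem p) \<and> f = u * prod_list ps"
proof -
  have U: "laurent_in UNIV = (UNIV :: ('n, 'k) laurent set)" by (auto simp: laurent_in_def)
  have d: "dvd_in UNIV a b \<longleftrightarrow> Rep_laurent a dvd Rep_laurent b" for a b :: "('n, 'k) laurent"
    unfolding dvd_in_def dvd_def
    by (metis Rep_laurent_inject Rep_laurent_inverse Abs_laurent_inverse UNIV_I times_laurent.rep_eq)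
  have pr: "prime_elem (Rep_laurent p)" if "prime_in UNIV p" for p :: "('n, 'k) laurent"
    unfolding prime_elem_def
  proof (intro conjI allI impI)
    show "Rep_laurent p \<noteq> 0" using that by (auto simp: prime_in_def simp flip: zero_laurent.rep_eq simp: Rep_laurent_inject)
    show "\<not> Rep_laurent p dvd 1" using that by (auto simp: prime_in_def d one_laurent.rep_eq)
    fix a b assume "Rep_laurent p dvd a * b"
    then have "dvd_in UNIV p (Abs_laurent a * Abs_laurent b)"
      by (simp add: d times_laurent.rep_eq Abs_laurent_inverse)
    then have "dvd_in UNIV p (Abs_laurent a) \<or> dvd_in UNIV p (Abs_laurent b)"
      using that by (auto simp: prime_in_def)
    then show "Rep_laurent p dvd a \<or> Rep_laurent p dvd b" by (simp add: d Abs_laurent_inverse)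
  qed
  have "ufd_in (UNIV :: ('n, 'k) laurent set)"
    unfolding U[symmetric] by (rule ufd_laurent_in) simp
  moreover have "Abs_laurent f \<noteq> 0"
    using assms by (metis Abs_laurent_inverse UNIV_I zero_laurent.rep_eq)
  ultimately obtain u ps where u: "dvd_in UNIV u 1" "\<forall>p\<in>set ps. prime_in UNIV p"
      "Abs_laurent f = u * prod_list ps"
    unfolding ufd_in_def by blast
  have "Rep_laurent (prod_list ps) = prod_list (map Rep_laurent ps)"
    by (induction ps) (auto simp: one_laurent.rep_eq times_laurent.rep_eq)
  then have "f = Rep_laurent u * prod_list (map Rep_laurent ps)"
    using arg_cong[OF u(3), of Rep_laurent] by (simp add: Abs_laurent_inverse times_laurent.rep_eq)
  moreover have "Rep_laurent u dvd 1" using u(1) by (simp add: d one_laurent.rep_eq)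
  ultimately show ?thesis using u(2) pr by (intro exI[of _ "Rep_laurent u"] exI[of _ "map Rep_laurent ps"]) auto
qed

lemma ev_prod_list: "character \<gamma> \<Longrightarrow> ev \<gamma> (prod_list ps) = prod_list (map (ev \<gamma>) ps)"
  by (induction ps) (auto simp: ev_mult_char ev_one_char)

text \<open>A unit has no zero, so one of the prime factors vanishes at
  \<open>\<gamma>\<close>.\<close>

lemma prime_factor_at_zero:
  fixes A :: "(int^'n) \<Rightarrow>\<^sub>0 'k::field_char_0"
  assumes "A \<noteq> 0" "character \<gamma>" "ev \<gamma> A = 0"
  obtains F where "prime_elem F" "F dvd A" "ev \<gamma> F = 0"
proof -
  obtain u ps where u: "u dvd 1" "\<forall>p\<in>set ps. prime_elem p" "A = u * prod_list ps"
    using laurent_prime_factorization[OF assms(1)] by blast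
  obtain v where "1 = u * v" using u(1) by (auto simp: dvd_def)
  then have "ev \<gamma> u \<noteq> 0" using ev_mult_char[OF assms(2), of u v] ev_one_char[OF assms(2)] by auto
  then have "prod_list (map (ev \<gamma>) ps) = 0"
    using assms(2,3) u(3) by (simp add: ev_mult_char ev_prod_list)
  then obtain p where p: "p \<in> set ps" "ev \<gamma> p = 0" by (auto simp: prod_list_zero_iff)
  then have "p dvd A" using u(3) by (simp add: dvd_mult prod_list_dvd)
  then show ?thesis using that p u(2) by blast
qed

text \<open>The fractions \<open>N i / Q i\<close> are local expressions of one rational function, some \<open>Q i\<close> being nonzero at
  each point of the torus. The primes of a denominator cancel, since each of them has a zero.\<close>

lemma regular_everywhere_imp_laurent:
  fixes N Q :: "'i \<Rightarrow> (int^'n) \<Rightarrow>\<^sub>0 'k::{alg_closed_field, field_char_0}"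
  assumes cross: "\<And>i j. i \<in> I \<Longrightarrow> j \<in> I \<Longrightarrow> N i * Q j = N j * Q i"
    and defined: "\<And>\<gamma>. character \<gamma> \<Longrightarrow> \<exists>i\<in>I. ev \<gamma> (Q i) \<noteq> 0"
  shows "\<exists>f. \<forall>i\<in>I. N i = f * Q i"
proof -
  have "\<exists>\<gamma> :: int^'n \<Rightarrow> 'k. character \<gamma>" using character_one_param[of 1 0] by auto
  then obtain i0 where i0: "i0 \<in> I" "Q i0 \<noteq> 0" using defined ev_0 by metis
  obtain u ps where u: "u dvd 1" "\<forall>p\<in>set ps. prime_elem p" "Q i0 = u * prod_list ps"
    using laurent_prime_factorization[OF i0(2)] by blast
  \<comment> \<open>\<open>n / (u * prod_list ps)\<close> is another expression of the same
    function. Cancelling a prime replaces \<open>n\<close> by a quotient of it, until the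
    denominator is the unit \<open>u\<close>.\<close>
  have "\<exists>f. \<forall>i\<in>I. N i = f * Q i"
    if "\<forall>p\<in>set ps. prime_elem p" "\<forall>i\<in>I. n * Q i = N i * (u * prod_list ps)" for n ps
    using that
  proof (induction ps arbitrary: n)
    case Nil
    obtain v where v: "1 = u * v" using u(1) by (auto simp: dvd_def)
    have "N i = n * v * Q i" if "i \<in> I" for i
    proof -
      have "n * v * Q i = v * (n * Q i)" by (simp add: mult_ac)
      also have "\<dots> = N i * (u * v)" using Nil that by (simp add: mult_ac)
      finally show ?thesis using v by simp
    qed
    then show ?case by blast
  next
    case (Cons p ps)
    have p: "prime_elem p" using Cons by simp
    then have "\<not> (\<forall>\<gamma>. character \<gamma> \<longrightarrow> ev \<gamma> p \<noteq> 0)"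
    proof (intro notI)
      assume "\<forall>\<gamma>. character \<gamma> \<longrightarrow> ev \<gamma> p \<noteq> 0"
      then obtain m c where "c \<noteq> 0" "p = Poly_Mapping.single m c" using no_zero_imp_monomial[of p] by blast
      then have "1 = p * Poly_Mapping.single (- m) (inverse c)" by (simp add: mult_single)
      then have "p dvd 1" by (rule dvdI)
      then show False using p by (simp add: prime_elem_def)
    qed
    then obtain \<gamma> where \<gamma>: "character \<gamma>" "ev \<gamma> p = 0" by blast
    obtain i where i: "i \<in> I" "ev \<gamma> (Q i) \<noteq> 0" using defined[OF \<gamma>(1)] by blast
    have "\<not> p dvd Q i"
    proof
      assume "p dvd Q i"
      then obtain q where "Q i = p * q" by (auto simp: dvd_def)
      then show False using i \<gamma> ev_mult_char[OF \<gamma>(1), of p q] by simp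
    qed
    have "n * Q i = p * (N i * (u * prod_list ps))" using Cons i by (simp add: mult_ac)
    then have "p dvd n * Q i" by simp
    then have "p dvd n" using prime_elem_dvd_multD[OF p] \<open>\<not> p dvd Q i\<close> by blast
    then obtain n' where n': "n = p * n'" by (rule dvdE)
    have "n' * Q j = N j * (u * prod_list ps)" if "j \<in> I" for j
    proof -
      have "p * (n' * Q j) = n * Q j" by (simp add: n' mult_ac)
      also have "\<dots> = N j * (u * prod_list (p # ps))" using Cons that by blast
      also have "\<dots> = p * (N j * (u * prod_list ps))" by (simp add: mult_ac)
      finally show ?thesis using laurent_mult_left_cancel[of p] p by (auto simp: prime_elem_def)
    qed
    then have "\<forall>j\<in>I. n' * Q j = N j * (u * prod_list ps)" by blast
    then show ?case using Cons.IH[of n'] Cons.prems(1) by simp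
  qed
  moreover have "\<forall>i\<in>I. N i0 * Q i = N i * (u * prod_list ps)" using cross i0 u(3) by metis
  ultimately show ?thesis using u(2) by blast
qed

section \<open>Cones and fans\<close>

lemma pairing_smult_left: "pairing (a *s m) v = a * pairing m v"
  by (simp add: pairing_def sum_distrib_left mult.assoc)

lemma pairing_smult_right: "pairing m (a *s v) = of_int a * pairing m v"
  by (simp add: pairing_def sum_distrib_left mult_ac)

lemma pairing_axis_right: "pairing m (axis l 1) = m $ l"
  by (simp add: pairing_def axis_def if_distrib[of of_int] if_distrib[of "(*) _"] cong: if_cong)

lemma rvec_inner: "rvec m \<bullet> rvec v = real_of_int (pairing m v)"
  by (simp add: rvec_def pairing_def inner_vec_def)

lemma rvec_add: "rvec (a + b) = rvec a + rvec b"
  by (simp add: rvec_def vec_eq_iff)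

lemma rvec_0 [simp]: "rvec 0 = 0"
  by (simp add: rvec_def vec_eq_iff)

lemma rvec_smult: "rvec (a *s m) = real_of_int a *\<^sub>R rvec m"
  by (simp add: rvec_def vec_eq_iff)

lemma rvec_inject: "rvec a = rvec b \<longleftrightarrow> a = b"
  by (simp add: rvec_def vec_eq_iff)

lemma rvec_eq_0: "rvec a = 0 \<longleftrightarrow> a = 0"
  by (simp add: rvec_def vec_eq_iff)

section \<open>Finitely generated cones\<close>

lemma convex_cone_hull_image_finite:
  assumes "finite S"
  shows "convex_cone hull (f ` S) = {v. \<exists>c. (\<forall>s\<in>S. 0 \<le> c s) \<and> v = (\<Sum>s\<in>S. c s *\<^sub>R f s)}" (is "_ = ?C")
proof
  show "convex_cone hull (f ` S) \<subseteq> ?C"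
  proof (rule hull_minimal)
    show "f ` S \<subseteq> ?C"
    proof
      fix x assume "x \<in> f ` S"
      then obtain s where s: "s \<in> S" "x = f s" by blast
      moreover have "(\<Sum>t\<in>S. (if t = s then 1 else 0) *\<^sub>R f t) = (\<Sum>t\<in>S. if t = s then f s else 0)"
        by (intro sum.cong) auto
      ultimately show "x \<in> ?C" using assms
        by (intro CollectI exI[of _ "\<lambda>t. if t = s then 1 else 0"]) auto
    qed
    show "convex_cone ?C" unfolding convex_cone_iff
    proof (intro conjI ballI allI impI)
      show "0 \<in> ?C" by (intro CollectI exI[of _ "\<lambda>_. 0"]) auto
      fix x assume "x \<in> ?C"
      then obtain c where c: "\<forall>s\<in>S. 0 \<le> c s" "x = (\<Sum>s\<in>S. c s *\<^sub>R f s)" by blast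
      show "a *\<^sub>R x \<in> ?C" if "0 \<le> a" for a
        using c that by (intro CollectI exI[of _ "\<lambda>s. a * c s"]) (auto simp: scaleR_sum_right)
      fix y assume "y \<in> ?C"
      then obtain d where d: "\<forall>s\<in>S. 0 \<le> d s" "y = (\<Sum>s\<in>S. d s *\<^sub>R f s)" by blast
      show "x + y \<in> ?C"
        using c d by (intro CollectI exI[of _ "\<lambda>s. c s + d s"]) (auto simp: scaleR_add_left sum.distrib)
    qed
  qed
  show "?C \<subseteq> convex_cone hull (f ` S)"
  proof
    fix v assume "v \<in> ?C"
    then obtain c where c: "\<forall>s\<in>S. 0 \<le> c s" "v = (\<Sum>s\<in>S. c s *\<^sub>R f s)" by blast
    have "(\<Sum>s\<in>T. c s *\<^sub>R f s) \<in> convex_cone hull (f ` S)" if "T \<subseteq> S" for T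
      using finite_subset[OF that assms] that
    proof (induction T)
      case (insert s T)
      then have "c s *\<^sub>R f s \<in> convex_cone hull (f ` S)" using c(1)
        by (intro convex_cone_hull_mul hull_inc) auto
      then show ?case using insert by (simp add: convex_cone_hull_add)
    qed (auto intro: convex_cone_hull_contains_0)
    then show "v \<in> convex_cone hull (f ` S)" using c(2) by simp
  qed
qed

lemma convex_cone_hull_finite:
  assumes "finite S"
  shows "convex_cone hull S = {v. \<exists>c. (\<forall>s\<in>S. 0 \<le> c s) \<and> v = (\<Sum>s\<in>S. c s *\<^sub>R s)}"
  using convex_cone_hull_image_finite[OF assms, of "\<lambda>x. x"] by simp

lemma convex_cone_hull_singleton: "convex_cone hull {x} = {c *\<^sub>R x | c. 0 \<le> c}"
  by (auto simp: convex_cone_hull_finite intro: exI[of _ "\<lambda>_. c" for c])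

section \<open>Integral functionals that expose faces\<close>

lemma rat_common_denominator:
  assumes "finite X"
  shows "\<exists>D::nat. D > 0 \<and> (\<forall>q\<in>X. \<exists>z. of_nat D * (q::rat) = of_int z)"
  using assms
proof (induction X)
  case (insert q X)
  then obtain D :: nat where D: "D > 0" "\<forall>q\<in>X. \<exists>z. of_nat D * q = of_int z" by blast
  obtain a b where ab: "q = of_int a / of_int b" "b > 0"
    using quotient_of_div[of q] quotient_of_denom_pos[of q] by (metis prod.exhaust_sel)
  have "\<exists>z. of_nat (D * nat b) * r = of_int z" if r: "r \<in> insert q X" for r
  proof (cases "r = q")
    case True
    have "of_nat (D * nat b) * q = of_int (int D * a)" using ab by (simp add: of_nat_nat)
    then show ?thesis using True by blast
  next
    case False
    then obtain z where "of_nat D * r = of_int z" using D r by blast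
    then have "of_nat (D * nat b) * r = of_int (b * z)" using ab by (simp add: mult_ac of_nat_nat)
    then show ?thesis by blast
  qed
  then show ?case using D(1) ab(2) by (intro exI[of _ "D * nat b"]) auto
qed (auto intro: exI[of _ 1])

text \<open>Approximates all the given reals by rationals with the one common denominator
  \<open>n\<close>.\<close>

lemma floor_multiple_tendsto: "(\<lambda>n. real_of_int \<lfloor>real n * w\<rfloor> / real n) \<longlonglongrightarrow> w"
proof (rule tendsto_sandwich)
  have "\<forall>\<^sub>F n in sequentially. (real n * w - 1) / real n \<le> real_of_int \<lfloor>real n * w\<rfloor> / real n"
    by (intro always_eventually allI divide_right_mono) (linarith, simp)
  moreover have "\<forall>\<^sub>F n in sequentially. (real n * w - 1) / real n = w - 1 / real n"
    using eventually_gt_at_top[of 0] by eventually_elim (simp add: field_simps)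
  ultimately show "\<forall>\<^sub>F n in sequentially. w - 1 / real n \<le> real_of_int \<lfloor>real n * w\<rfloor> / real n"
    by eventually_elim simp
  have "(\<lambda>n. w - 1 / real n) \<longlonglongrightarrow> w - 0"
    by (intro tendsto_diff tendsto_const lim_1_over_n)
  then show "(\<lambda>n. w - 1 / real n) \<longlonglongrightarrow> w" by simp
  show "\<forall>\<^sub>F n in sequentially. real_of_int \<lfloor>real n * w\<rfloor> / real n \<le> w"
    using eventually_gt_at_top[of 0]
  proof eventually_elim
    case (elim n)
    have "real_of_int \<lfloor>real n * w\<rfloor> \<le> real n * w" by linarith
    then show ?case using elim by (simp add: field_simps)
  qed
qed simp

text \<open>The coordinates of \<open>a\<close> are rational combinations of rationally independent reals \<open>W\<close>.
  The equations hold for every value of the elements of \<open>W\<close>, and the inequalities for all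
  values close to the given ones.\<close>

lemma integer_functional:
  fixes A B :: "(int^'n) set" and a :: "real^'n"
  assumes fin: "finite B"
    and A: "\<And>s. s \<in> A \<Longrightarrow> a \<bullet> rvec s = 0" and B: "\<And>s. s \<in> B \<Longrightarrow> a \<bullet> rvec s > 0"
  obtains m :: "int^'n" where "\<And>s. s \<in> A \<Longrightarrow> pairing m s = (0::int)" "\<And>s. s \<in> B \<Longrightarrow> pairing m s > (0::int)"
proof -
  interpret Q: vector_space "\<lambda>(q::rat) (r::real). of_rat q * r"
    by unfold_locales (auto simp: of_rat_add of_rat_mult algebra_simps)
  obtain W where W: "W \<subseteq> range (\<lambda>j. a $ j)" "Q.independent W" "range (\<lambda>j. a $ j) \<subseteq> Q.span W"
    using Q.maximal_independent_subset[of "range (\<lambda>j. a $ j)"] by blast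
  have finW: "finite W" using W(1) finite_subset by fastforce
  have "\<forall>j. \<exists>u. a $ j = (\<Sum>w\<in>W. of_rat (u w) * w)"
    using W(3) Q.span_finite[OF finW] by (auto simp: image_def subset_iff)
  then obtain q where q: "\<And>j. a $ j = (\<Sum>w\<in>W. of_rat (q j w) * w)" by metis
  define C where "C = (\<lambda>s w. \<Sum>j\<in>UNIV. q j w * of_int (s $ j))"
  have as: "a \<bullet> rvec s = (\<Sum>w\<in>W. of_rat (C s w) * w)" for s
  proof -
    have "a \<bullet> rvec s = (\<Sum>j\<in>UNIV. (\<Sum>w\<in>W. of_rat (q j w) * w) * of_int (s $ j))"
      by (simp add: inner_vec_def rvec_def q[symmetric])
    also have "\<dots> = (\<Sum>w\<in>W. \<Sum>j\<in>UNIV. of_rat (q j w) * w * of_int (s $ j))"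
      unfolding sum_distrib_right by (rule sum.swap)
    also have "\<dots> = (\<Sum>w\<in>W. of_rat (C s w) * w)"
      by (intro sum.cong refl)
        (simp add: C_def of_rat_sum of_rat_mult sum_distrib_right sum_distrib_left mult_ac)
    finally show ?thesis .
  qed
  have CA: "C s w = 0" if "s \<in> A" "w \<in> W" for s w
    using Q.independentD[OF W(2) finW subset_refl _ that(2), of "C s"] as[of s] A[OF that(1)] by simp
  have "\<forall>\<^sub>F n in sequentially. (\<Sum>w\<in>W. of_rat (C s w) * (real_of_int \<lfloor>real n * w\<rfloor> / real n)) > 0"
    if "s \<in> B" for s
  proof -
    have "(\<lambda>n. \<Sum>w\<in>W. of_rat (C s w) * (real_of_int \<lfloor>real n * w\<rfloor> / real n)) \<longlonglongrightarrow> a \<bullet> rvec s"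
      unfolding as by (intro tendsto_sum tendsto_mult tendsto_const floor_multiple_tendsto)
    then show ?thesis using B[OF that] order_tendstoD(1) by blast
  qed
  then have "\<forall>\<^sub>F n in sequentially. \<forall>s\<in>B. (\<Sum>w\<in>W. of_rat (C s w) * (real_of_int \<lfloor>real n * w\<rfloor> / real n)) > 0"
    using fin by (simp add: eventually_ball_finite)
  then have "\<forall>\<^sub>F n in sequentially. n > 0 \<and> (\<forall>s\<in>B. (\<Sum>w\<in>W. of_rat (C s w) * (real_of_int \<lfloor>real n * w\<rfloor> / real n)) > 0)"
    using eventually_gt_at_top[of 0] by eventually_elim simp
  then obtain n :: nat where n: "n > 0" "\<And>s. s \<in> B \<Longrightarrow> (\<Sum>w\<in>W. of_rat (C s w) * (real_of_int \<lfloor>real n * w\<rfloor> / real n)) > 0"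
    by (auto dest: eventually_happens)
  obtain D :: nat where D: "D > 0" "\<forall>r\<in>(\<lambda>(j, w). q j w) ` (UNIV \<times> W). \<exists>z. of_nat D * r = of_int z"
    using rat_common_denominator[of "(\<lambda>(j, w). q j w) ` (UNIV \<times> W)"] finW by auto
  then have "\<forall>j w. \<exists>z. w \<in> W \<longrightarrow> of_nat D * q j w = of_int z" by force
  then obtain z where z: "\<And>j w. w \<in> W \<Longrightarrow> of_nat D * q j w = of_int (z j w)" by metis
  \<comment> \<open>Each \<open>w\<close> is replaced by \<open>\<lfloor>n * w\<rfloor> / n\<close>;
    the factors \<open>n\<close> and \<open>D\<close> clear the denominators of these values and of
    the coefficients \<open>q j w\<close>.\<close>
  define m :: "int^'n" where "m = (\<chi> j. \<Sum>w\<in>W. z j w * \<lfloor>real n * w\<rfloor>)"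
  have pm: "of_int (pairing m s) = (\<Sum>w\<in>W. of_nat D * C s w * of_int \<lfloor>real n * w\<rfloor>)" for s
  proof -
    have "rat_of_int (pairing m s) = (\<Sum>j\<in>UNIV. (\<Sum>w\<in>W. of_int (z j w) * of_int \<lfloor>real n * w\<rfloor>) * of_int (s $ j))"
      by (simp add: pairing_def m_def)
    also have "\<dots> = (\<Sum>w\<in>W. \<Sum>j\<in>UNIV. of_int (z j w) * of_int \<lfloor>real n * w\<rfloor> * of_int (s $ j))"
      unfolding sum_distrib_right by (rule sum.swap)
    also have "\<dots> = (\<Sum>w\<in>W. of_nat D * C s w * of_int \<lfloor>real n * w\<rfloor>)"
      unfolding C_def sum_distrib_left sum_distrib_right
      by (intro sum.cong refl) (simp add: z[symmetric] mult_ac)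
    finally show ?thesis .
  qed
  show ?thesis
  proof (rule that[of m])
    fix s assume "s \<in> A"
    then have "rat_of_int (pairing m s) = 0" unfolding pm using CA by simp
    then show "pairing m s = (0::int)" by simp
  next
    fix s assume s: "s \<in> B"
    have "real_of_int (pairing m s) = of_rat (of_int (pairing m s))" by simp
    also have "\<dots> = real D * (\<Sum>w\<in>W. of_rat (C s w) * real_of_int \<lfloor>real n * w\<rfloor>)"
      unfolding pm by (simp add: of_rat_sum of_rat_mult sum_distrib_left mult_ac)
    also have "(\<Sum>w\<in>W. of_rat (C s w) * real_of_int \<lfloor>real n * w\<rfloor>)
        = real n * (\<Sum>w\<in>W. of_rat (C s w) * (real_of_int \<lfloor>real n * w\<rfloor> / real n))"
      using n(1) by (simp add: sum_distrib_left)
    finally have "real_of_int (pairing m s)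
        = real D * (real n * (\<Sum>w\<in>W. of_rat (C s w) * (real_of_int \<lfloor>real n * w\<rfloor> / real n)))" .
    then have "real_of_int (pairing m s) > 0"
      using n(1) n(2)[OF s] D(1) by (simp add: zero_less_mult_iff)
    then show "pairing m s > (0::int)" by simp
  qed
qed

lemma toric_cone_convex: "toric_cone \<sigma> \<Longrightarrow> convex_cone \<sigma>"
  unfolding toric_cone_def using convex_cone_convex_cone_hull by auto

lemma toric_cone_pointed: "toric_cone \<sigma> \<Longrightarrow> v \<in> \<sigma> \<Longrightarrow> - v \<in> \<sigma> \<Longrightarrow> v = 0"
  unfolding toric_cone_def by (metis IntI image_eqI minus_minus singletonD)

text \<open>If a positive combination of two vectors of the cone is 0, its two terms are opposite,
  hence 0 by pointedness.\<close>

lemma zero_face_of_toric_cone: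
  assumes "toric_cone \<sigma>"
  shows "{0} face_of \<sigma>"
  unfolding face_of_def
proof (intro conjI ballI impI)
  have c: "convex_cone \<sigma>" using toric_cone_convex[OF assms] .
  then show "{0} \<subseteq> \<sigma>" by (simp add: convex_cone_contains_0)
  fix a b x assume ab: "a \<in> \<sigma>" "b \<in> \<sigma>" and x: "x \<in> {0}" "x \<in> open_segment a b"
  then obtain u where u: "0 < u" "u < 1" "0 = (1 - u) *\<^sub>R a + u *\<^sub>R b" by (auto simp: in_segment)
  have s: "(1 - u) *\<^sub>R a \<in> \<sigma>" "u *\<^sub>R b \<in> \<sigma>" using c ab u by (auto simp: convex_cone_iff)
  have "u *\<^sub>R b = - ((1 - u) *\<^sub>R a)" using u(3) by (metis add.inverse_unique)
  then have "(1 - u) *\<^sub>R a = 0" using toric_cone_pointed[OF assms s(1)] s(2) by simp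
  moreover have "u *\<^sub>R b = 0" using u(3) calculation by simp
  ultimately show "a \<in> {0}" "b \<in> {0}" using u by auto
qed simp

text \<open>A face of a polyhedral cone is exposed by a real functional. It is replaced by an
  integral one that vanishes on the same generators and is positive on the others, which determines
  the zero set on the whole cone.\<close>

lemma face_exposed_by_integer:
  fixes \<sigma> :: "(real^'n) set"
  assumes \<sigma>: "toric_cone \<sigma>" and \<tau>: "\<tau> face_of \<sigma>" "\<tau> \<noteq> {}"
  obtains m where "m \<in> dual_lattice_points \<sigma>" "\<And>v. v \<in> \<sigma> \<Longrightarrow> rvec m \<bullet> v = 0 \<longleftrightarrow> v \<in> \<tau>"
proof -
  obtain S where S: "finite S" "\<sigma> = convex_cone hull (rvec ` S)" using \<sigma> by (auto simp: toric_cone_def)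
  have c: "convex_cone \<sigma>" using toric_cone_convex[OF \<sigma>] .
  have "polyhedron \<sigma>" unfolding S(2) using S(1) by (intro polyhedron_convex_cone_hull) auto
  then have "\<tau> exposed_face_of \<sigma>" using \<tau> exposed_face_of_polyhedron by blast
  then obtain a b where ab: "\<sigma> \<subseteq> {x. a \<bullet> x \<le> b}" "\<tau> = \<sigma> \<inter> {x. a \<bullet> x = b}"
    unfolding exposed_face_of_def by blast
  obtain x where x: "x \<in> \<sigma>" "a \<bullet> x = b" using ab \<tau>(2) by auto
  \<comment> \<open>The bound attained at \<open>x\<close> also holds at 0 and at twice
    \<open>x\<close>, so it is 0.\<close>
  have "0 \<in> \<sigma>" "2 *\<^sub>R x \<in> \<sigma>" using c x(1) by (auto simp: convex_cone_iff)
  then have "a \<bullet> 0 \<le> b" "a \<bullet> (2 *\<^sub>R x) \<le> b" using ab(1) by blast+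
  then have "0 \<le> b" "2 * b \<le> b" using x(2) by simp_all
  then have b: "b = 0" by simp
  have pos: "- a \<bullet> v \<ge> 0" if "v \<in> \<sigma>" for v using ab(1) that b by auto
  have gen: "rvec s \<in> \<sigma>" if "s \<in> S" for s unfolding S(2) using that by (auto intro: hull_inc)
  define A where "A = {s\<in>S. - a \<bullet> rvec s = 0}"
  obtain m :: "int^'n" where m: "\<And>s. s \<in> A \<Longrightarrow> pairing m s = (0::int)" "\<And>s. s \<in> S - A \<Longrightarrow> pairing m s > (0::int)"
  proof (rule integer_functional[of "S - A" A "- a"])
    show "finite (S - A)" using S by simp
    show "- a \<bullet> rvec s = 0" if "s \<in> A" for s using that by (simp add: A_def)
    show "- a \<bullet> rvec s > 0" if "s \<in> S - A" for s using that pos[OF gen[of s]] by (auto simp: A_def)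
  qed blast
  have nonneg: "pairing m s \<ge> (0::int)" if "s \<in> S" for s using m that by (cases "s \<in> A") force+
  show ?thesis
  proof (rule that[of m])
    have repr: "\<exists>c. (\<forall>s\<in>S. 0 \<le> c s) \<and> v = (\<Sum>s\<in>S. c s *\<^sub>R rvec s)" if "v \<in> \<sigma>" for v
      using that unfolding S(2) convex_cone_hull_image_finite[OF S(1)] by blast
    show "m \<in> dual_lattice_points \<sigma>" unfolding dual_lattice_points_def
    proof (intro CollectI ballI)
      fix v assume "v \<in> \<sigma>"
      then obtain c where "\<forall>s\<in>S. 0 \<le> c s" "v = (\<Sum>s\<in>S. c s *\<^sub>R rvec s)" using repr by blast
      then show "0 \<le> rvec m \<bullet> v"
        using nonneg by (auto simp: inner_sum_right rvec_inner intro!: sum_nonneg)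
    qed
    fix v assume v: "v \<in> \<sigma>"
    obtain c where c: "\<forall>s\<in>S. 0 \<le> c s" "v = (\<Sum>s\<in>S. c s *\<^sub>R rvec s)" using repr[OF v] by blast
    have "rvec m \<bullet> v = 0 \<longleftrightarrow> (\<forall>s\<in>S. c s * real_of_int (pairing m s) = 0)"
      using c nonneg S(1) by (simp add: inner_sum_right rvec_inner sum_nonneg_eq_0_iff)
    also have "\<dots> \<longleftrightarrow> (\<forall>s\<in>S. c s * (- a \<bullet> rvec s) = 0)"
    proof (intro ball_cong refl)
      fix s assume s: "s \<in> S"
      have "real_of_int (pairing m s) = 0 \<longleftrightarrow> - a \<bullet> rvec s = 0"
        using m[of s] s by (cases "s \<in> A") (auto simp: A_def)
      then show "c s * real_of_int (pairing m s) = 0 \<longleftrightarrow> c s * (- a \<bullet> rvec s) = 0"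
        by (simp only: mult_eq_0_iff)
    qed
    also have "\<dots> \<longleftrightarrow> - a \<bullet> v = 0"
    proof -
      have "- a \<bullet> v = (\<Sum>s\<in>S. c s * (- a \<bullet> rvec s))" unfolding c(2) by (simp add: inner_sum_right)
      moreover have "0 \<le> c s * (- a \<bullet> rvec s)" if "s \<in> S" for s
        using c(1) pos[OF gen[OF that]] that by (intro mult_nonneg_nonneg) auto
      ultimately show ?thesis using sum_nonneg_eq_0_iff[OF S(1), of "\<lambda>s. c s * (- a \<bullet> rvec s)"] by simp
    qed
    also have "\<dots> \<longleftrightarrow> v \<in> \<tau>" using ab(2) v b by simp
    finally show "rvec m \<bullet> v = 0 \<longleftrightarrow> v \<in> \<tau>" .
  qed
qed

section \<open>Rays of cones and of complete fans\<close>

text \<open>If \<open>a + b\<close> is a multiple of \<open>s\<close>, the other generators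
  contribute a multiple \<open>r\<close> of \<open>s\<close>. A positive multiple would make
  \<open>s\<close> redundant, so \<open>- r\<close> lies in the cone as well, and pointedness makes
  each single contribution 0.\<close>

lemma generator_ray_face:
  fixes S :: "('a::real_vector) set"
  assumes S: "finite S" and pointed: "\<And>v. v \<in> convex_cone hull S \<Longrightarrow> - v \<in> convex_cone hull S \<Longrightarrow> v = 0"
    and s: "s \<in> S" "s \<notin> convex_cone hull (S - {s})" and nz: "0 \<notin> S"
  shows "convex_cone hull {s} face_of convex_cone hull S"
  unfolding face_of_def
proof (intro conjI ballI impI)
  show "convex_cone hull {s} \<subseteq> convex_cone hull S" using s by (intro hull_mono) auto
  show "convex (convex_cone hull {s})" by (rule convex_convex_cone_hull)
  let ?T = "S - {s}"
  have key: "a \<in> convex_cone hull {s}"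
    if ab: "a \<in> convex_cone hull S" "b \<in> convex_cone hull S" "a + b = c *\<^sub>R s" for a b c
  proof -
    obtain \<alpha> where \<alpha>: "\<forall>t\<in>S. 0 \<le> \<alpha> t" "a = (\<Sum>t\<in>S. \<alpha> t *\<^sub>R t)"
      using ab(1) convex_cone_hull_finite[OF S] by auto
    obtain \<beta> where \<beta>: "\<forall>t\<in>S. 0 \<le> \<beta> t" "b = (\<Sum>t\<in>S. \<beta> t *\<^sub>R t)"
      using ab(2) convex_cone_hull_finite[OF S] by auto
    define r where "r = (\<Sum>t\<in>?T. (\<alpha> t + \<beta> t) *\<^sub>R t)"
    have "a + b = (\<alpha> s + \<beta> s) *\<^sub>R s + r"
      unfolding \<alpha> \<beta> r_def using S s(1)
      by (simp add: sum.remove[of S s] scaleR_add_left sum.distrib)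
    then have r: "r = (c - \<alpha> s - \<beta> s) *\<^sub>R s" using ab(3) by (simp add: algebra_simps)
    have rT: "r \<in> convex_cone hull ?T"
      unfolding r_def convex_cone_hull_finite[OF finite_Diff[OF S]] using \<alpha>(1) \<beta>(1)
      by (intro CollectI exI[of _ "\<lambda>t. \<alpha> t + \<beta> t"]) auto
    have "c - \<alpha> s - \<beta> s \<le> 0"
    proof (rule ccontr)
      assume pos: "\<not> c - \<alpha> s - \<beta> s \<le> 0"
      then have "s = (1 / (c - \<alpha> s - \<beta> s)) *\<^sub>R r" using r by simp
      moreover have "(1 / (c - \<alpha> s - \<beta> s)) *\<^sub>R r \<in> convex_cone hull ?T"
        using pos by (intro convex_cone_hull_mul[OF rT]) simp
      ultimately show False using s(2) by simp
    qed
    moreover have "- r = (\<alpha> s + \<beta> s - c) *\<^sub>R s" unfolding r by (simp add: algebra_simps)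
    ultimately have mr: "- r \<in> convex_cone hull S"
      using convex_cone_hull_mul[OF hull_inc[OF s(1)], of "\<alpha> s + \<beta> s - c"] by simp
    have "\<alpha> t = 0" if t: "t \<in> ?T" for t
    proof -
      let ?p = "(\<alpha> t + \<beta> t) *\<^sub>R t" and ?r = "\<Sum>u\<in>?T - {t}. (\<alpha> u + \<beta> u) *\<^sub>R u"
      have "?p \<in> convex_cone hull S"
        using t \<alpha>(1) \<beta>(1) by (intro convex_cone_hull_mul hull_inc) auto
      moreover have "- ?p \<in> convex_cone hull S"
      proof -
        have "?r \<in> convex_cone hull (?T - {t})"
          unfolding convex_cone_hull_finite[OF finite_Diff[OF finite_Diff[OF S]]] using \<alpha>(1) \<beta>(1)
          by (intro CollectI exI[of _ "\<lambda>t. \<alpha> t + \<beta> t"]) auto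
        then have "?r \<in> convex_cone hull S" using hull_mono[of "?T - {t}" S] by blast
        moreover have "r = ?p + ?r" unfolding r_def using t S by (intro sum.remove) auto
        then have "- ?p = ?r + - r" by simp
        ultimately show ?thesis using convex_cone_hull_add[OF _ mr] by simp
      qed
      ultimately have "?p = 0" by (rule pointed)
      moreover have "t \<noteq> 0" using t nz by auto
      ultimately show ?thesis using t \<alpha>(1) \<beta>(1) by (auto simp: add_nonneg_eq_0_iff)
    qed
    then have "a = \<alpha> s *\<^sub>R s" unfolding \<alpha>(2) using S s(1) by (simp add: sum.remove[of S s])
    then show ?thesis using \<alpha>(1) s(1) by (auto simp: convex_cone_hull_singleton)
  qed
  fix a b x assume ab: "a \<in> convex_cone hull S" "b \<in> convex_cone hull S"
    and x: "x \<in> convex_cone hull {s}" "x \<in> open_segment a b"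
  obtain u where u: "0 < u" "u < 1" "x = (1 - u) *\<^sub>R a + u *\<^sub>R b" using x by (auto simp: in_segment)
  obtain c where c: "x = c *\<^sub>R s" using x by (auto simp: convex_cone_hull_singleton)
  have in': "(1 - u) *\<^sub>R a \<in> convex_cone hull S" "u *\<^sub>R b \<in> convex_cone hull S"
    using ab u by (auto intro: convex_cone_hull_mul)
  have "(1 - u) *\<^sub>R a \<in> convex_cone hull {s}" using key[OF in', of c] u c by simp
  then have "(1 / (1 - u)) *\<^sub>R ((1 - u) *\<^sub>R a) \<in> convex_cone hull {s}"
    by (rule convex_cone_hull_mul) (use u(2) in simp)
  then show "a \<in> convex_cone hull {s}" using u by simp
  have "u *\<^sub>R b \<in> convex_cone hull {s}" using key[OF in'(2,1), of c] u c by (simp add: add.commute)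
  then have "(1 / u) *\<^sub>R (u *\<^sub>R b) \<in> convex_cone hull {s}"
    by (rule convex_cone_hull_mul) (use u(1) in simp)
  then show "b \<in> convex_cone hull {s}" using u by simp
qed

lemma scale_convex_cone_hull: "c > 0 \<Longrightarrow> convex_cone hull {c *\<^sub>R x} = convex_cone hull {x}"
proof (intro equalityI hull_minimal)
  assume c: "c > 0"
  have "c *\<^sub>R x \<in> convex_cone hull {x}" using c by (intro convex_cone_hull_mul hull_inc) auto
  then show "{c *\<^sub>R x} \<subseteq> convex_cone hull {x}" by simp
  have "(1 / c) *\<^sub>R (c *\<^sub>R x) \<in> convex_cone hull {c *\<^sub>R x}"
    using c by (intro convex_cone_hull_mul hull_inc) auto
  then show "{x} \<subseteq> convex_cone hull {c *\<^sub>R x}" using c by simp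
qed (rule convex_cone_convex_cone_hull)+

lemma primitive_multiple:
  assumes "v \<noteq> 0"
  obtains g \<rho> where "g > 0" "v = g *s \<rho>" "primitive \<rho>"
proof -
  define g where "g = Gcd (range (\<lambda>j. v $ j))"
  have "g \<noteq> 0" using assms by (auto simp: g_def Gcd_0_iff vec_eq_iff)
  moreover have "g \<ge> 0" unfolding g_def by (rule Gcd_int_greater_eq_0)
  ultimately have g: "g > 0" by simp
  have "\<forall>j. \<exists>r. v $ j = g * r" unfolding g_def by (metis Gcd_dvd dvdE rangeI)
  then obtain r where r: "\<And>j. v $ j = g * r j" by metis
  define \<rho> where "\<rho> = (\<chi> j. r j)"
  have v: "v = g *s \<rho>" by (simp add: vec_eq_iff \<rho>_def r)
  have "range (\<lambda>j. v $ j) = (*) g ` range (\<lambda>j. \<rho> $ j)" using v by auto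
  with g_def have "g = Gcd ((*) g ` range (\<lambda>j. \<rho> $ j))" by (rule subst[rotated])
  also have "\<dots> = \<bar>g * Gcd (range (\<lambda>j. \<rho> $ j))\<bar>" by (simp add: Gcd_mult)
  also have "\<dots> = g * Gcd (range (\<lambda>j. \<rho> $ j))" using g by (simp add: abs_mult)
  finally have "primitive \<rho>" using g by (simp add: primitive_def)
  then show ?thesis using that g v by blast
qed

lemma primitive_nonzero: "primitive \<rho> \<Longrightarrow> \<rho> \<noteq> 0"
  by (auto simp: primitive_def)

text \<open>The real ratio \<open>c\<close> is eliminated by cross-multiplying with a nonzero
  coordinate \<open>j\<close>. Comparing gcds gives equal absolute values there, and
  \<open>c \<ge> 0\<close> gives equal signs.\<close>

lemma primitive_ray_inject:
  assumes "primitive \<rho>" "primitive \<rho>'" "convex_cone hull {rvec \<rho>} = convex_cone hull {rvec \<rho>'}"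
  shows "\<rho> = \<rho>'"
proof -
  have "rvec \<rho>' \<in> convex_cone hull {rvec \<rho>}" unfolding assms(3) by (rule hull_inc) simp
  then obtain c where c: "c \<ge> 0" "rvec \<rho>' = c *\<^sub>R rvec \<rho>" by (auto simp: convex_cone_hull_singleton)
  then have cj: "real_of_int (\<rho>' $ j) = c * real_of_int (\<rho> $ j)" for j
    by (simp add: vec_eq_iff rvec_def)
  obtain j where j: "\<rho>' $ j \<noteq> 0" using primitive_nonzero[OF assms(2)] by (auto simp: vec_eq_iff)
  have "real_of_int (\<rho> $ j * \<rho>' $ i) = real_of_int (\<rho>' $ j * \<rho> $ i)" for i
    using cj[of i] cj[of j] by simp
  then have eq: "\<rho> $ j * \<rho>' $ i = \<rho>' $ j * \<rho> $ i" for i by (metis of_int_eq_iff)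
  have "\<bar>\<rho> $ j\<bar> = Gcd ((*) (\<rho> $ j) ` range (\<lambda>i. \<rho>' $ i))"
    using assms(2) by (simp add: Gcd_mult primitive_def)
  also have "(*) (\<rho> $ j) ` range (\<lambda>i. \<rho>' $ i) = (*) (\<rho>' $ j) ` range (\<lambda>i. \<rho> $ i)"
    by (simp add: image_image eq)
  also have "Gcd \<dots> = \<bar>\<rho>' $ j\<bar>" using assms(1) by (simp add: Gcd_mult primitive_def)
  finally have abs: "\<bar>\<rho> $ j\<bar> = \<bar>\<rho>' $ j\<bar>" .
  have "sgn (\<rho> $ j) = sgn (\<rho>' $ j)"
  proof (rule ccontr)
    assume "sgn (\<rho> $ j) \<noteq> sgn (\<rho>' $ j)"
    then have "\<rho>' $ j = - \<rho> $ j" using abs by (auto simp: abs_if sgn_if split: if_splits)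
    then have "(c + 1) * real_of_int (\<rho> $ j) = 0" using cj[of j] by (simp add: algebra_simps)
    then show False using c(1) j abs by auto
  qed
  then have "\<rho> $ j = \<rho>' $ j" using abs by (metis mult.commute mult_sgn_abs)
  then have "\<rho>' $ j * \<rho>' $ i = \<rho>' $ j * \<rho> $ i" for i using eq[of i] by metis
  then have "\<rho>' $ i = \<rho> $ i" for i using j mult_left_cancel by blast
  then show ?thesis by (simp add: vec_eq_iff)
qed

lemma finite_rays:
  assumes "complete_fan \<Sigma>"
  shows "finite (rays \<Sigma>)"
proof (rule inj_on_finite)
  show "inj_on (\<lambda>\<rho>. convex_cone hull {rvec \<rho>}) (rays \<Sigma>)"
    by (auto simp: inj_on_def rays_def intro: primitive_ray_inject)
  show "(\<lambda>\<rho>. convex_cone hull {rvec \<rho>}) ` rays \<Sigma> \<subseteq> \<Sigma>" by (auto simp: rays_def)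
  show "finite \<Sigma>" using assms by (simp add: complete_fan_def)
qed

lemma ray_of_generator:
  assumes fan: "complete_fan \<Sigma>" and \<sigma>: "\<sigma> \<in> \<Sigma>" "\<sigma> = convex_cone hull (rvec ` S)" and S: "finite S" "0 \<notin> S"
    and s: "s \<in> S" "rvec s \<notin> convex_cone hull (rvec ` S - {rvec s})"
  shows "convex_cone hull {rvec s} \<in> \<Sigma>"
proof -
  have "toric_cone \<sigma>" using fan \<sigma>(1) by (auto simp: complete_fan_def)
  then have pt: "v = 0" if "v \<in> convex_cone hull (rvec ` S)" "- v \<in> convex_cone hull (rvec ` S)" for v
    using toric_cone_pointed that unfolding \<sigma>(2) by blast
  have "0 \<notin> rvec ` S" using S(2) by (metis imageE rvec_eq_0)
  then have "convex_cone hull {rvec s} face_of \<sigma>"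
    unfolding \<sigma>(2) using generator_ray_face[OF finite_imageI[OF S(1)] pt imageI[OF s(1)] s(2)] by blast
  moreover have "convex_cone hull {rvec s} \<noteq> {}" by (rule convex_cone_hull_nonempty)
  ultimately show ?thesis using fan \<sigma>(1) unfolding complete_fan_def by blast
qed

text \<open>In a generating set of least size no generator is redundant, so each one spans a face,
  which belongs to the fan; its primitive vector is a ray.\<close>

lemma cone_generated_by_rays:
  assumes fan: "complete_fan \<Sigma>" and \<sigma>: "\<sigma> \<in> \<Sigma>"
  shows "\<sigma> \<subseteq> convex_cone hull (rvec ` rays \<Sigma>)"
proof -
  define P where "P = (\<lambda>S. finite S \<and> \<sigma> = convex_cone hull (rvec ` S))"
  have "\<exists>S. P S" using fan \<sigma> by (auto simp: complete_fan_def toric_cone_def P_def)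
  then obtain S where S: "P S" "\<And>T. P T \<Longrightarrow> card S \<le> card T"
    using ex_has_least_nat[of P _ card] by blast
  have fin: "finite S" and \<sigma>S: "\<sigma> = convex_cone hull (rvec ` S)" using S(1) by (auto simp: P_def)
  have nred: "rvec s \<notin> convex_cone hull (rvec ` S - {rvec s})" if s: "s \<in> S" for s
  proof
    assume "rvec s \<in> convex_cone hull (rvec ` S - {rvec s})"
    also have "rvec ` S - {rvec s} = rvec ` (S - {s})" by (auto simp: rvec_inject)
    finally have "convex_cone hull (rvec ` S) = convex_cone hull (rvec ` (S - {s}))"
      using s hull_redundant[of "rvec s" convex_cone "rvec ` (S - {s})"]
      by (metis image_insert insert_Diff)
    then have "P (S - {s})" using S(1) by (simp add: P_def)
    then show False using S(2) fin s by (meson card_Diff1_less leD)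
  qed
  have z: "0 \<notin> S" using nred[of 0] convex_cone_hull_contains_0 by auto
  have "rvec s \<in> convex_cone hull (rvec ` rays \<Sigma>)" if s: "s \<in> S" for s
  proof -
    have "s \<noteq> 0" using s z by auto
    then obtain g \<rho> where g: "g > 0" "s = g *s \<rho>" "primitive \<rho>" by (rule primitive_multiple)
    have "convex_cone hull {rvec s} = convex_cone hull {rvec \<rho>}"
      using g by (simp add: rvec_smult scale_convex_cone_hull)
    then have "\<rho> \<in> rays \<Sigma>"
      using ray_of_generator[OF fan \<sigma> \<sigma>S fin z s nred[OF s]] g(3) by (simp add: rays_def)
    then show ?thesis unfolding g(2) rvec_smult using g(1)
      by (intro convex_cone_hull_mul hull_inc) auto
  qed
  then show ?thesis unfolding \<sigma>S by (intro hull_minimal convex_cone_convex_cone_hull) auto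
qed

section \<open>Lattice points of the polytope\<close>

lemma pairing_qvec: "pairing (qvec m) v = of_int (pairing m v)"
  by (simp add: pairing_def qvec_def)

lemma polytope_points_iff:
  "m \<in> polytope_points \<Sigma> d \<longleftrightarrow> (\<forall>\<rho>\<in>rays \<Sigma>. pairing m \<rho> \<le> d \<rho>)"
  by (simp add: polytope_points_def polytope_of_def pairing_qvec)

text \<open>By completeness every \<open>v\<close> is a nonnegative combination of rays, so the
  pairing with \<open>v\<close> is bounded above on the polytope. Taking unit vectors and their
  negatives bounds every coordinate on both sides.\<close>

lemma finite_polytope_points:
  fixes \<Sigma> :: "(real^'n) set set"
  assumes fan: "complete_fan \<Sigma>"
  shows "finite (polytope_points \<Sigma> d)"
proof -
  have bound: "\<exists>C. \<forall>m\<in>polytope_points \<Sigma> d. real_of_int (pairing m v) \<le> C" for v :: "int^'n"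
  proof -
    have "rvec v \<in> \<Union>\<Sigma>" using fan by (simp add: complete_fan_def)
    then have "rvec v \<in> convex_cone hull (rvec ` rays \<Sigma>)" using cone_generated_by_rays[OF fan] by blast
    then obtain c where c: "\<forall>\<rho>\<in>rays \<Sigma>. 0 \<le> c \<rho>" "rvec v = (\<Sum>\<rho>\<in>rays \<Sigma>. c \<rho> *\<^sub>R rvec \<rho>)"
      unfolding convex_cone_hull_image_finite[OF finite_rays[OF fan]] by blast
    have "real_of_int (pairing m v) \<le> (\<Sum>\<rho>\<in>rays \<Sigma>. c \<rho> * real_of_int (d \<rho>))"
      if "m \<in> polytope_points \<Sigma> d" for m
    proof -
      have "real_of_int (pairing m v) = rvec m \<bullet> (\<Sum>\<rho>\<in>rays \<Sigma>. c \<rho> *\<^sub>R rvec \<rho>)"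
        unfolding c(2)[symmetric] by (rule rvec_inner[symmetric])
      also have "\<dots> = (\<Sum>\<rho>\<in>rays \<Sigma>. c \<rho> * real_of_int (pairing m \<rho>))"
        by (simp add: inner_sum_right rvec_inner)
      also have "\<dots> \<le> (\<Sum>\<rho>\<in>rays \<Sigma>. c \<rho> * real_of_int (d \<rho>))"
        using that c(1) by (intro sum_mono mult_left_mono) (auto simp: polytope_points_iff)
      finally show ?thesis .
    qed
    then show ?thesis by blast
  qed
  obtain C where C: "\<And>v m. m \<in> polytope_points \<Sigma> d \<Longrightarrow> real_of_int (pairing m v) \<le> C v"
    using bound by metis
  have sub: "polytope_points \<Sigma> d \<subseteq>
      vec_lambda ` (PiE UNIV (\<lambda>j. {- \<lfloor>C (- axis j 1)\<rfloor>..\<lfloor>C (axis j 1)\<rfloor>}))"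
  proof
    fix m assume m: "m \<in> polytope_points \<Sigma> d"
    have "m $ j \<in> {- \<lfloor>C (- axis j 1)\<rfloor>..\<lfloor>C (axis j 1)\<rfloor>}" for j
      using C[OF m, of "axis j 1"] C[OF m, of "- axis j 1"]
      by (simp add: pairing_axis_right pairing_uminus_right) linarith
    then have "vec_nth m \<in> PiE UNIV (\<lambda>j. {- \<lfloor>C (- axis j 1)\<rfloor>..\<lfloor>C (axis j 1)\<rfloor>})"
      by (intro PiE_I) simp_all
    then show "m \<in> vec_lambda ` (PiE UNIV (\<lambda>j. {- \<lfloor>C (- axis j 1)\<rfloor>..\<lfloor>C (axis j 1)\<rfloor>}))"
      by (rule rev_image_eqI) simp
  qed
  show ?thesis by (rule finite_subset[OF sub], rule finite_imageI, rule finite_PiE) simp_all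
qed

section \<open>Lattice bases\<close>

text \<open>Component \<open>l\<close> of \<open>dual_basis e i\<close> is the \<open>i\<close>-th
  coordinate of the \<open>l\<close>-th unit vector in the basis \<open>e\<close>; so pairing with
  \<open>dual_basis e i\<close> reads off the \<open>i\<close>-th coordinate of any vector.\<close>

definition dual_basis :: "('n \<Rightarrow> int^'n) \<Rightarrow> 'n \<Rightarrow> int^'n" where
  "dual_basis e = (\<lambda>i. \<chi> l. (THE c. axis l 1 = (\<Sum>j\<in>UNIV. c j *s e j)) i)"

lemma lattice_basis_expand:
  assumes "lattice_basis e"
  shows "v = (\<Sum>j\<in>UNIV. pairing (dual_basis e j) v *s e j)"
proof -
  have c: "axis l 1 = (\<Sum>j\<in>UNIV. dual_basis e j $ l *s e j)" for l
    using theI'[of "\<lambda>c. axis l 1 = (\<Sum>j\<in>UNIV. c j *s e j)"] assms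
    by (simp add: lattice_basis_def dual_basis_def)
  have "v = (\<Sum>l\<in>UNIV. v $ l *s axis l 1)"
    by (simp add: vec_eq_iff axis_def if_distrib[of "(*) _"] cong: if_cong)
  also have "\<dots> = (\<Sum>l\<in>UNIV. \<Sum>j\<in>UNIV. (v $ l * dual_basis e j $ l) *s e j)"
    by (subst c) (simp add: vec_eq_iff sum_distrib_left mult_ac)
  also have "\<dots> = (\<Sum>j\<in>UNIV. \<Sum>l\<in>UNIV. (v $ l * dual_basis e j $ l) *s e j)" by (rule sum.swap)
  also have "\<dots> = (\<Sum>j\<in>UNIV. pairing (dual_basis e j) v *s e j)"
    by (simp add: pairing_def vec_eq_iff sum_distrib_right sum_distrib_left mult_ac)
  finally show ?thesis .
qed

lemma lattice_basis_unique:
  assumes "lattice_basis e" "(\<Sum>j\<in>UNIV. c j *s e j) = (\<Sum>j\<in>UNIV. c' j *s e j)"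
  shows "c j = c' j"
  using assms unfolding lattice_basis_def by metis

lemma dual_basis_pairing:
  assumes "lattice_basis e"
  shows "pairing (dual_basis e i) (e j) = (if i = j then 1 else 0 :: int)"
proof -
  have "(\<Sum>i\<in>UNIV. (if i = j then 1 else 0) *s e i) = (\<Sum>i\<in>UNIV. if i = j then e j else 0)"
    by (intro sum.cong) auto
  then have "(\<Sum>i\<in>UNIV. pairing (dual_basis e i) (e j) *s e i) = (\<Sum>i\<in>UNIV. (if i = j then 1 else 0) *s e i)"
    using lattice_basis_expand[OF assms, of "e j"] by simp
  from lattice_basis_unique[OF assms this] show ?thesis .
qed

lemma pairing_expand:
  assumes "lattice_basis e"
  shows "pairing m v = (\<Sum>j\<in>UNIV. pairing m (e j) * of_int (pairing (dual_basis e j) v))"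
  by (subst lattice_basis_expand[OF assms, of v])
    (simp add: pairing_sum_right pairing_smult_right mult.commute)

lemma dual_basis_expand:
  assumes "lattice_basis e"
  shows "m = (\<Sum>j\<in>UNIV. pairing m (e j) *s dual_basis e j)"
proof -
  have "m $ l = (\<Sum>j\<in>UNIV. pairing m (e j) *s dual_basis e j) $ l" for l
    using pairing_expand[OF assms, of m "axis l 1"]
    by (simp add: pairing_axis_right)
  then show ?thesis by (simp add: vec_eq_iff)
qed

lemma lattice_point_eqI:
  assumes "lattice_basis e" "\<And>j. pairing m (e j) = (pairing m' (e j) :: int)"
  shows "m = m'"
  using dual_basis_expand[OF assms(1), of m] dual_basis_expand[OF assms(1), of m'] assms(2) by simp

lemma lattice_basis_inj:
  assumes "lattice_basis e"
  shows "inj e"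
  using dual_basis_pairing[OF assms] by (metis injI zero_neq_one)

text \<open>The gcd of the entries divides every integral pairing, in particular the pairing -1 with
  the dual basis vector.\<close>

lemma primitive_basis_vector:
  assumes "lattice_basis e"
  shows "primitive (- e j)"
proof -
  have "Gcd (range (\<lambda>i. (- e j) $ i)) dvd pairing (dual_basis e j) (- e j)"
    unfolding pairing_def of_int_eq_id id_apply by (intro dvd_sum dvd_mult Gcd_dvd rangeI)
  then have "Gcd (range (\<lambda>i. (- e j) $ i)) dvd 1"
    by (simp add: pairing_uminus_right dual_basis_pairing[OF assms])
  then show ?thesis unfolding primitive_def
    using Gcd_int_greater_eq_0[of "range (\<lambda>i. (- e j) $ i)"] by (simp only: zdvd1_eq)
qed

abbreviation basis_cone :: "('n \<Rightarrow> int^'n) \<Rightarrow> (real^'n) set" where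
  "basis_cone e \<equiv> convex_cone hull (range (\<lambda>j. rvec (- e j)))"

text \<open>The other generators lie in the hyperplane where the \<open>j\<close>-th dual basis
  vector vanishes, so \<open>- e j\<close> is not redundant.\<close>

lemma basis_vector_ray:
  assumes fan: "complete_fan \<Sigma>" and e: "lattice_basis e" and \<sigma>: "basis_cone e \<in> \<Sigma>"
  shows "- e j \<in> rays \<Sigma>"
proof -
  have inj: "- e i = - e j \<longleftrightarrow> i = j" for i using lattice_basis_inj[OF e] by (auto simp: inj_eq)
  let ?H = "{v. rvec (dual_basis e j) \<bullet> v = 0}"
  have "rvec (- e j) \<notin> convex_cone hull (rvec ` range (\<lambda>j. - e j) - {rvec (- e j)})"
  proof
    assume *: "rvec (- e j) \<in> convex_cone hull (rvec ` range (\<lambda>j. - e j) - {rvec (- e j)})"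
    have "convex_cone hull (rvec ` range (\<lambda>j. - e j) - {rvec (- e j)}) \<subseteq> ?H"
    proof (rule hull_minimal)
      show "rvec ` range (\<lambda>j. - e j) - {rvec (- e j)} \<subseteq> ?H"
        by (auto simp: rvec_inner pairing_uminus_right dual_basis_pairing[OF e])
      show "convex_cone ?H" by (auto simp: convex_cone_iff inner_add_right)
    qed
    then have "rvec (dual_basis e j) \<bullet> rvec (- e j) = 0" using * by blast
    then show False by (simp add: rvec_inner pairing_uminus_right dual_basis_pairing[OF e])
  qed
  moreover have "basis_cone e = convex_cone hull (rvec ` range (\<lambda>j. - e j))" by (simp add: image_image)
  moreover have "0 \<notin> range (\<lambda>j. - e j)" using primitive_nonzero[OF primitive_basis_vector[OF e]] by (metis rangeE)
  ultimately have "convex_cone hull {rvec (- e j)} \<in> \<Sigma>"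
    using ray_of_generator[OF fan \<sigma>, of "range (\<lambda>j. - e j)" "- e j"] by auto
  then show ?thesis using primitive_basis_vector[OF e] by (simp add: rays_def)
qed

section \<open>Points and regular functions\<close>

lemma eval_at_ev: "eval_at f x = ev (snd x) f"
  by (simp add: eval_at_def ev_def)

lemma toric_varietyD:
  assumes "x \<in> toric_variety \<Sigma>"
  shows "fst x \<in> \<Sigma>" "snd x m \<noteq> 0 \<longleftrightarrow> m \<in> perp_lattice_points (fst x)"
    "m \<in> perp_lattice_points (fst x) \<Longrightarrow> m' \<in> perp_lattice_points (fst x)
      \<Longrightarrow> snd x (m + m') = snd x m * snd x m'"
  using assms by (auto simp: toric_variety_def)

lemma snd_tpoint_0:
  assumes "x \<in> toric_variety \<Sigma>"
  shows "snd x 0 = 1"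
proof -
  have "0 \<in> perp_lattice_points (fst x)" by (simp add: perp_lattice_points_def)
  then show ?thesis using toric_varietyD(2,3)[OF assms, of 0] toric_varietyD(3)[OF assms, of 0 0] by auto
qed

text \<open>On the dual cone the pairings with vectors of \<open>fst x\<close> are nonnegative, so a
  sum is perpendicular to that cone only if both summands are. Hence extension by zero stays
  multiplicative there.\<close>

lemma snd_tpoint_add:
  assumes x: "x \<in> toric_variety \<Sigma>" and sub: "fst x \<subseteq> \<sigma>"
    and m: "m \<in> dual_lattice_points \<sigma>" "m' \<in> dual_lattice_points \<sigma>"
  shows "snd x (m + m') = snd x m * snd x m'"
proof (cases "m \<in> perp_lattice_points (fst x) \<and> m' \<in> perp_lattice_points (fst x)")
  case True
  then show ?thesis using toric_varietyD(3)[OF x] by blast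
next
  case False
  then obtain v where v: "v \<in> fst x" "rvec m \<bullet> v \<noteq> 0 \<or> rvec m' \<bullet> v \<noteq> 0"
    by (auto simp: perp_lattice_points_def)
  have "0 \<le> rvec m \<bullet> v" "0 \<le> rvec m' \<bullet> v" using m v(1) sub by (auto simp: dual_lattice_points_def)
  then have "rvec (m + m') \<bullet> v \<noteq> 0" using v(2) by (auto simp: rvec_add inner_add_left)
  then have "m + m' \<notin> perp_lattice_points (fst x)" using v(1) by (auto simp: perp_lattice_points_def)
  then have "snd x (m + m') = 0" using toric_varietyD(2)[OF x] by blast
  moreover have "snd x m = 0 \<or> snd x m' = 0" using False toric_varietyD(2)[OF x] by blast
  ultimately show ?thesis by auto
qed

lemma eval_at_mult:
  assumes "x \<in> toric_variety \<Sigma>" "fst x \<subseteq> \<sigma>" "f \<in> coord_ring \<sigma>" "f' \<in> coord_ring \<sigma>"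
  shows "eval_at (f * f') x = eval_at f x * eval_at f' x"
  unfolding eval_at_ev
  by (rule ev_mult) (use snd_tpoint_add[OF assms(1,2)] assms(3,4) in \<open>auto simp: coord_ring_def\<close>)

lemma dual_lattice_points_add:
  "m \<in> dual_lattice_points \<sigma> \<Longrightarrow> m' \<in> dual_lattice_points \<sigma> \<Longrightarrow> m + m' \<in> dual_lattice_points \<sigma>"
  by (auto simp: dual_lattice_points_def rvec_add inner_add_left)

lemma coord_ring_mult: "f \<in> coord_ring \<sigma> \<Longrightarrow> f' \<in> coord_ring \<sigma> \<Longrightarrow> f * f' \<in> coord_ring \<sigma>"
  using keys_mult[of f f'] dual_lattice_points_add unfolding coord_ring_def by fast

lemma coord_ring_antimono: "\<tau> \<subseteq> \<sigma> \<Longrightarrow> coord_ring \<sigma> \<subseteq> coord_ring \<tau>"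
  by (fastforce simp: coord_ring_def dual_lattice_points_def)

lemma coord_ring_single: "m \<in> dual_lattice_points \<sigma> \<Longrightarrow> Poly_Mapping.single m c \<in> coord_ring \<sigma>"
  by (auto simp: coord_ring_def)

lemma coord_ring_zero_cone: "coord_ring {0} = UNIV"
  by (auto simp: coord_ring_def dual_lattice_points_def)

lemma perp_zero_cone: "perp_lattice_points {0} = UNIV"
  by (auto simp: perp_lattice_points_def)

text \<open>The projection of the torus point \<open>\<gamma>\<close> to the orbit of
  \<open>\<tau>\<close>. A Laurent polynomial takes at it the value at \<open>\<gamma>\<close> of
  its part perpendicular to \<open>\<tau>\<close>, so generic characters yield generic points of the
  orbit.\<close>

definition orbit_point :: "(real^'n) set \<Rightarrow> (int^'n \<Rightarrow> 'k::field) \<Rightarrow> ('n, 'k) tpoint" where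
  "orbit_point \<tau> \<gamma> = (\<tau>, \<lambda>m. if m \<in> perp_lattice_points \<tau> then \<gamma> m else 0)"

lemma orbit_point_in:
  fixes \<gamma> :: "int^'n \<Rightarrow> 'k::field"
  assumes "\<tau> \<in> \<Sigma>" "character \<gamma>"
  shows "orbit_point \<tau> \<gamma> \<in> toric_variety \<Sigma>"
  using assms character_nonzero[OF assms(2)] characterD(2)[OF assms(2)]
  by (auto simp: orbit_point_def toric_variety_def perp_lattice_points_def rvec_add inner_add_left)

lemma eval_orbit_point:
  fixes f :: "(int^'n) \<Rightarrow>\<^sub>0 'k::field"
  shows "eval_at f (orbit_point \<tau> \<gamma>) = ev \<gamma> (restr (perp_lattice_points \<tau>) f)"
proof -
  have "eval_at f (orbit_point \<tau> \<gamma>) = (\<Sum>m\<in>Poly_Mapping.keys f \<inter> perp_lattice_points \<tau>.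
      Poly_Mapping.lookup f m * \<gamma> m)"
    unfolding eval_at_def orbit_point_def by (rule sum.mono_neutral_cong_right) auto
  also have "\<dots> = ev \<gamma> (restr (perp_lattice_points \<tau>) f)"
    unfolding ev_def keys_restr by (rule sum.cong) (auto simp: lookup_restr)
  finally show ?thesis .
qed

lemma mem_chart: "x \<in> chart \<Sigma> \<sigma> \<longleftrightarrow> x \<in> toric_variety \<Sigma> \<and> fst x face_of \<sigma>"
  by (simp add: chart_def)

lemma chart_subset: "x \<in> chart \<Sigma> \<sigma> \<Longrightarrow> fst x \<subseteq> \<sigma>"
  by (simp add: chart_def face_of_imp_subset)

lemma eval_at_mult_chart:
  assumes "x \<in> chart \<Sigma> \<sigma>" "f \<in> coord_ring \<sigma>" "f' \<in> coord_ring \<sigma>"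
  shows "eval_at (f * f') x = eval_at f x * eval_at f' x"
proof -
  have "x \<in> toric_variety \<Sigma>" using assms(1) by (simp add: mem_chart)
  then show ?thesis by (rule eval_at_mult[OF _ chart_subset[OF assms(1)] assms(2,3)])
qed

lemma eval_at_single: "eval_at (Poly_Mapping.single m c) x = c * snd x m"
  by (simp add: eval_at_ev)

lemma eval_at_one: "x \<in> toric_variety \<Sigma> \<Longrightarrow> eval_at 1 x = 1"
  using eval_at_single[of 0 1 x] snd_tpoint_0 by simp

section \<open>Open sets and regular functions\<close>

locale complete_fan_loc =
  fixes \<Sigma> :: "(real^'n) set set"
  assumes fan: "complete_fan \<Sigma>"
begin

lemma cone: "\<sigma> \<in> \<Sigma> \<Longrightarrow> toric_cone \<sigma>"
  using fan by (auto simp: complete_fan_def)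

lemma face_in: "\<sigma> \<in> \<Sigma> \<Longrightarrow> \<tau> face_of \<sigma> \<Longrightarrow> \<tau> \<noteq> {} \<Longrightarrow> \<tau> \<in> \<Sigma>"
  using fan by (auto simp: complete_fan_def)

lemma inter_face: "\<sigma> \<in> \<Sigma> \<Longrightarrow> \<tau> \<in> \<Sigma> \<Longrightarrow> (\<sigma> \<inter> \<tau>) face_of \<sigma>" "\<sigma> \<in> \<Sigma> \<Longrightarrow> \<tau> \<in> \<Sigma> \<Longrightarrow> (\<sigma> \<inter> \<tau>) face_of \<tau>"
  using fan by (auto simp: complete_fan_def)

lemma zero_in_cone: "\<sigma> \<in> \<Sigma> \<Longrightarrow> 0 \<in> \<sigma>"
  using toric_cone_convex[OF cone] convex_cone_contains_0 by blast

lemma subset_face: "\<tau> \<in> \<Sigma> \<Longrightarrow> \<sigma> \<in> \<Sigma> \<Longrightarrow> \<tau> \<subseteq> \<sigma> \<Longrightarrow> \<tau> face_of \<sigma>"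
  using inter_face(1)[of \<sigma> \<tau>] by (simp add: Int_absorb1)

lemma face_refl: "\<sigma> \<in> \<Sigma> \<Longrightarrow> \<sigma> face_of \<sigma>"
  using subset_face by blast

lemma zero_cone: "{0} \<in> \<Sigma>"
proof -
  have "\<Sigma> \<noteq> {}" using fan by (auto simp: complete_fan_def)
  then obtain \<sigma> where "\<sigma> \<in> \<Sigma>" by blast
  then show ?thesis using face_in[OF _ zero_face_of_toric_cone[OF cone]] by blast
qed

lemma zero_face: "\<sigma> \<in> \<Sigma> \<Longrightarrow> {0} face_of \<sigma>"
  using zero_face_of_toric_cone[OF cone] .

lemma torus_iff: "x \<in> torus \<Sigma> \<longleftrightarrow> fst x = {0} \<and> character (snd x)"
proof
  assume x: "x \<in> torus \<Sigma>"
  then have X: "x \<in> toric_variety \<Sigma>" and z: "fst x = {0}" by (auto simp: torus_def)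
  have "snd x (m + m') = snd x m * snd x m'" for m m'
    using toric_varietyD(3)[OF X] z by (simp add: perp_zero_cone)
  then show "fst x = {0} \<and> character (snd x)" using snd_tpoint_0[OF X] z by (simp add: character_def)
next
  assume x: "fst x = {0} \<and> character (snd x)"
  then have "x = orbit_point {0} (snd x)" by (simp add: orbit_point_def perp_zero_cone prod_eq_iff)
  then have "x \<in> toric_variety \<Sigma>" using orbit_point_in[OF zero_cone] x by metis
  then show "x \<in> torus \<Sigma>" using x by (simp add: torus_def)
qed

lemma torus_char: "character \<gamma> \<Longrightarrow> ({0}, \<gamma>) \<in> torus \<Sigma>"
  by (simp add: torus_iff)

lemma torus_subset_chart: "\<sigma> \<in> \<Sigma> \<Longrightarrow> torus \<Sigma> \<subseteq> chart \<Sigma> \<sigma>"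
  using zero_face by (auto simp: torus_def mem_chart)

lemma torus_eq_chart: "torus \<Sigma> = chart \<Sigma> {0}"
proof
  show "chart \<Sigma> {0} \<subseteq> torus \<Sigma>"
    using chart_subset zero_in_cone toric_varietyD(1) by (fastforce simp: torus_def mem_chart)
qed (rule torus_subset_chart[OF zero_cone])

lemma mem_own_chart: "x \<in> toric_variety \<Sigma> \<Longrightarrow> x \<in> chart \<Sigma> (fst x)"
  using face_refl[OF toric_varietyD(1)] by (simp add: mem_chart)

lemma openD:
  assumes "zariski_open \<Sigma> V"
  shows "V \<subseteq> toric_variety \<Sigma>"
    "\<sigma> \<in> \<Sigma> \<Longrightarrow> x \<in> V \<Longrightarrow> x \<in> chart \<Sigma> \<sigma> \<Longrightarrow>
      \<exists>f\<in>coord_ring \<sigma>. eval_at f x \<noteq> 0 \<and> {y \<in> chart \<Sigma> \<sigma>. eval_at f y \<noteq> 0} \<subseteq> V"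
proof -
  show "V \<subseteq> toric_variety \<Sigma>" using assms by (simp add: zariski_open_def)
  assume \<sigma>: "\<sigma> \<in> \<Sigma>" and x: "x \<in> V" "x \<in> chart \<Sigma> \<sigma>"
  obtain F where F: "F \<subseteq> coord_ring \<sigma>" "V \<inter> chart \<Sigma> \<sigma> = {x \<in> chart \<Sigma> \<sigma>. \<exists>f\<in>F. eval_at f x \<noteq> 0}"
    using assms \<sigma> unfolding zariski_open_def by meson
  have "x \<in> V \<inter> chart \<Sigma> \<sigma>" using x by simp
  then obtain f where f: "f \<in> F" "eval_at f x \<noteq> 0" unfolding F(2) by blast
  have "{y \<in> chart \<Sigma> \<sigma>. eval_at f y \<noteq> 0} \<subseteq> V \<inter> chart \<Sigma> \<sigma>" unfolding F(2) using f(1) by blast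
  then show "\<exists>f\<in>coord_ring \<sigma>. eval_at f x \<noteq> 0 \<and> {y \<in> chart \<Sigma> \<sigma>. eval_at f y \<noteq> 0} \<subseteq> V"
    using f F(1) by blast
qed

lemma openI:
  assumes "V \<subseteq> toric_variety \<Sigma>"
    and "\<And>\<sigma> x. \<sigma> \<in> \<Sigma> \<Longrightarrow> x \<in> V \<Longrightarrow> x \<in> chart \<Sigma> \<sigma> \<Longrightarrow>
      \<exists>f\<in>coord_ring \<sigma>. eval_at f x \<noteq> 0 \<and> {y \<in> chart \<Sigma> \<sigma>. eval_at f y \<noteq> 0} \<subseteq> V"
  shows "zariski_open \<Sigma> V"
  unfolding zariski_open_def
proof (intro conjI ballI assms(1))
  fix \<sigma> assume \<sigma>: "\<sigma> \<in> \<Sigma>"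
  let ?F = "{f \<in> coord_ring \<sigma>. {y \<in> chart \<Sigma> \<sigma>. eval_at f y \<noteq> 0} \<subseteq> V}"
  have "V \<inter> chart \<Sigma> \<sigma> = {x \<in> chart \<Sigma> \<sigma>. \<exists>f\<in>?F. eval_at f x \<noteq> 0}"
  proof (intro equalityI subsetI)
    fix x assume "x \<in> V \<inter> chart \<Sigma> \<sigma>"
    then have "\<exists>f\<in>coord_ring \<sigma>. eval_at f x \<noteq> 0 \<and> {y \<in> chart \<Sigma> \<sigma>. eval_at f y \<noteq> 0} \<subseteq> V"
      using assms(2)[OF \<sigma>] by simp
    then show "x \<in> {x \<in> chart \<Sigma> \<sigma>. \<exists>f\<in>?F. eval_at f x \<noteq> 0}" using \<open>x \<in> V \<inter> chart \<Sigma> \<sigma>\<close> by auto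
  qed auto
  then show "\<exists>F\<subseteq>coord_ring \<sigma>. V \<inter> chart \<Sigma> \<sigma> = {x \<in> chart \<Sigma> \<sigma>. \<exists>f\<in>F. eval_at f x \<noteq> 0}"
    by (intro exI[of _ ?F] conjI) auto
qed

lemma open_Int:
  assumes "zariski_open \<Sigma> V" "zariski_open \<Sigma> V'"
  shows "zariski_open \<Sigma> (V \<inter> V')"
proof (rule openI)
  show "V \<inter> V' \<subseteq> toric_variety \<Sigma>" using openD(1)[OF assms(1)] by blast
  fix \<sigma> x assume \<sigma>: "\<sigma> \<in> \<Sigma>" and x: "x \<in> V \<inter> V'" "x \<in> chart \<Sigma> \<sigma>"
  obtain f where f: "f \<in> coord_ring \<sigma>" "eval_at f x \<noteq> 0" "{y \<in> chart \<Sigma> \<sigma>. eval_at f y \<noteq> 0} \<subseteq> V"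
    using openD(2)[OF assms(1) \<sigma> _ x(2)] x(1) by blast
  obtain f' where f': "f' \<in> coord_ring \<sigma>" "eval_at f' x \<noteq> 0" "{y \<in> chart \<Sigma> \<sigma>. eval_at f' y \<noteq> 0} \<subseteq> V'"
    using openD(2)[OF assms(2) \<sigma> _ x(2)] x(1) by blast
  have "{y \<in> chart \<Sigma> \<sigma>. eval_at (f * f') y \<noteq> 0} \<subseteq> V \<inter> V'"
    using f(3) f'(3) eval_at_mult_chart[OF _ f(1) f'(1)] by fastforce
  moreover have "eval_at (f * f') x \<noteq> 0" using eval_at_mult_chart[OF x(2) f(1) f'(1)] f(2) f'(2) by simp
  ultimately show "\<exists>f\<in>coord_ring \<sigma>. eval_at f x \<noteq> 0 \<and> {y \<in> chart \<Sigma> \<sigma>. eval_at f y \<noteq> 0} \<subseteq> V \<inter> V'"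
    using coord_ring_mult[OF f(1) f'(1)] by blast
qed

lemma open_Union:
  assumes "\<And>V. V \<in> \<V> \<Longrightarrow> zariski_open \<Sigma> V"
  shows "zariski_open \<Sigma> (\<Union>\<V>)"
proof (rule openI)
  show "\<Union>\<V> \<subseteq> toric_variety \<Sigma>" using openD(1)[OF assms] by blast
  fix \<sigma> x assume \<sigma>: "\<sigma> \<in> \<Sigma>" and x: "x \<in> \<Union>\<V>" "x \<in> chart \<Sigma> \<sigma>"
  then obtain V where V: "V \<in> \<V>" "x \<in> V" by blast
  show "\<exists>f\<in>coord_ring \<sigma>. eval_at f x \<noteq> 0 \<and> {y \<in> chart \<Sigma> \<sigma>. eval_at f y \<noteq> 0} \<subseteq> \<Union>\<V>"
    using openD(2)[OF assms[OF V(1)] \<sigma> V(2) x(2)] V(1) by (meson Union_upper subset_trans)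
qed

text \<open>The locus has to be described in every other chart \<open>\<sigma>'\<close>. For an
  integral \<open>m\<close> that exposes the common face, the overlap is the part of that chart
  where \<open>\<chi>\<^sup>m\<close> is nonzero, and \<open>f\<close> times a high power of this
  character is regular on the chart of \<open>\<sigma>'\<close>.\<close>

lemma principal_open:
  fixes f :: "(int^'n) \<Rightarrow>\<^sub>0 'k::field"
  assumes \<sigma>: "\<sigma> \<in> \<Sigma>" and f: "f \<in> coord_ring \<sigma>"
  shows "zariski_open \<Sigma> {y \<in> chart \<Sigma> \<sigma>. eval_at f y \<noteq> 0}"
proof (rule openI)
  show "{y \<in> chart \<Sigma> \<sigma>. eval_at f y \<noteq> 0} \<subseteq> toric_variety \<Sigma>" by (auto simp: mem_chart)
  fix \<sigma>' and x :: "('n, 'k) tpoint"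
  assume \<sigma>': "\<sigma>' \<in> \<Sigma>" and x: "x \<in> {y \<in> chart \<Sigma> \<sigma>. eval_at f y \<noteq> 0}" "x \<in> chart \<Sigma> \<sigma>'"
  obtain m where m: "m \<in> dual_lattice_points \<sigma>'"
    "\<And>v. v \<in> \<sigma>' \<Longrightarrow> rvec m \<bullet> v = 0 \<longleftrightarrow> v \<in> \<sigma> \<inter> \<sigma>'"
    using face_exposed_by_integer[OF cone[OF \<sigma>'] inter_face(2)[OF \<sigma> \<sigma>']] zero_in_cone \<sigma> \<sigma>' by blast
  obtain S where S: "finite S" "\<sigma>' = convex_cone hull (rvec ` S)" using cone[OF \<sigma>'] by (auto simp: toric_cone_def)
  have gen: "rvec s \<in> \<sigma>'" if "s \<in> S" for s unfolding S(2) using that by (intro hull_inc) simp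
  have ms: "pairing m s > (0::int) \<or> rvec s \<in> \<sigma>" if "s \<in> S" for s
    using m(1) m(2)[OF gen[OF that]] gen[OF that] by (force simp: dual_lattice_points_def rvec_inner)
  have mpos: "pairing m s \<ge> (0::int)" if "s \<in> S" for s
    using m(1) gen[OF that] by (force simp: dual_lattice_points_def rvec_inner)
  have "\<exists>N. \<forall>a\<in>Poly_Mapping.keys f \<times> S. - N \<le> pairing (fst a) (snd a)"
    using S(1) by (intro finite_int_set_lower_bound) simp
  then obtain N0 where N0: "\<And>k s. k \<in> Poly_Mapping.keys f \<Longrightarrow> s \<in> S \<Longrightarrow> - N0 \<le> pairing k s" by auto
  \<comment> \<open>Generators of \<open>\<sigma>'\<close> outside \<open>\<sigma>\<close> pair with
    \<open>m\<close> to at least 1, so \<open>N\<close> copies of \<open>m\<close> outweigh the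
    pairings of the exponents of \<open>f\<close>, which are at least \<open>- N0\<close>. The
    maximum with 0 keeps \<open>M\<close> in the dual cone.\<close>
  define N where "N = max N0 0"
  define M where "M = N *s m"
  define f' where "f' = f * Poly_Mapping.single M 1"
  have Mdual: "M \<in> dual_lattice_points \<sigma>'"
    using m(1) by (auto simp: M_def N_def dual_lattice_points_def rvec_smult)
  have "k + M \<in> dual_lattice_points \<sigma>'" if k: "k \<in> Poly_Mapping.keys f" for k
  proof -
    have "pairing (k + M) s \<ge> (0::int)" if s: "s \<in> S" for s
    proof (cases "rvec s \<in> \<sigma>")
      case True
      then have "real_of_int (pairing k s) \<ge> 0"
        using f k by (fastforce simp: coord_ring_def dual_lattice_points_def simp flip: rvec_inner)
      then show ?thesis using mpos[OF s] by (simp add: pairing_add_left M_def pairing_smult_left N_def)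
    next
      case False
      then have "pairing m s \<ge> (1::int)" using ms[OF s] by simp
      then have "N * pairing m s \<ge> N * 1" by (intro mult_left_mono) (auto simp: N_def)
      then show ?thesis using N0[OF k s] by (simp add: pairing_add_left M_def pairing_smult_left N_def)
    qed
    then have "rvec ` S \<subseteq> {v. 0 \<le> rvec (k + M) \<bullet> v}" by (auto simp: rvec_inner)
    then have "\<sigma>' \<subseteq> {v. 0 \<le> rvec (k + M) \<bullet> v}" unfolding S(2)
      by (rule hull_minimal) (auto simp: convex_cone_iff inner_add_right)
    then show ?thesis by (auto simp: dual_lattice_points_def)
  qed
  then have f'R: "f' \<in> coord_ring \<sigma>'"
    using keys_mult[of f "Poly_Mapping.single M 1"] by (fastforce simp: f'_def coord_ring_def)
  have val: "eval_at f' y = eval_at f y * snd y M" if y: "y \<in> toric_variety \<Sigma>" "fst y \<subseteq> \<sigma> \<inter> \<sigma>'" for y :: "('n, 'k) tpoint"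
  proof -
    have "f \<in> coord_ring (\<sigma> \<inter> \<sigma>')" using f coord_ring_antimono[of "\<sigma> \<inter> \<sigma>'" \<sigma>] by blast
    moreover have "Poly_Mapping.single M (1::'k) \<in> coord_ring (\<sigma> \<inter> \<sigma>')"
      using coord_ring_single[OF Mdual] coord_ring_antimono[of "\<sigma> \<inter> \<sigma>'" \<sigma>'] by blast
    ultimately show ?thesis unfolding f'_def by (simp add: eval_at_mult[OF y] eval_at_single)
  qed
  have Mperp: "M \<in> perp_lattice_points \<tau>" if "\<tau> \<subseteq> \<sigma> \<inter> \<sigma>'" for \<tau>
    using m(2) that by (force simp: perp_lattice_points_def M_def rvec_smult)
  have xX: "x \<in> toric_variety \<Sigma>" using x(2) by (simp add: mem_chart)
  have xs: "fst x \<subseteq> \<sigma> \<inter> \<sigma>'" using chart_subset[OF x(2)] chart_subset[of x \<Sigma> \<sigma>] x(1) by blast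
  show "\<exists>f'\<in>coord_ring \<sigma>'. eval_at f' x \<noteq> 0 \<and> {y \<in> chart \<Sigma> \<sigma>'. eval_at f' y \<noteq> 0} \<subseteq> {y \<in> chart \<Sigma> \<sigma>. eval_at f y \<noteq> 0}"
  \<comment> \<open>The further factor \<open>\<chi>\<^sup>m\<close> makes the product vanish
    outside the overlap, also when \<open>N = 0\<close>.\<close>
  proof (intro bexI[of _ "f' * Poly_Mapping.single m 1"] conjI subsetI)
    have mR: "Poly_Mapping.single m (1::'k) \<in> coord_ring \<sigma>'" using coord_ring_single[OF m(1)] .
    show "f' * Poly_Mapping.single m 1 \<in> coord_ring \<sigma>'" by (rule coord_ring_mult[OF f'R mR])
    have ev': "eval_at (f' * Poly_Mapping.single m 1) y = eval_at f' y * snd y m" if "y \<in> chart \<Sigma> \<sigma>'" for y :: "('n, 'k) tpoint"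
      by (simp add: eval_at_mult_chart[OF that f'R mR] eval_at_single)
    have "m \<in> perp_lattice_points (fst x)"
      unfolding perp_lattice_points_def using m(2) xs by (intro CollectI ballI) (meson IntD2 subsetD)
    then show "eval_at (f' * Poly_Mapping.single m 1) x \<noteq> 0"
      using ev'[OF x(2)] val[OF xX xs] x(1) toric_varietyD(2)[OF xX] Mperp[OF xs] by simp
    fix y :: "('n, 'k) tpoint"
    assume "y \<in> {y \<in> chart \<Sigma> \<sigma>'. eval_at (f' * Poly_Mapping.single m 1) y \<noteq> 0}"
    then have y1: "y \<in> chart \<Sigma> \<sigma>'" "eval_at (f' * Poly_Mapping.single m 1) y \<noteq> 0" by simp_all
    then have y: "y \<in> chart \<Sigma> \<sigma>'" "eval_at f' y \<noteq> 0" "snd y m \<noteq> 0" using ev'[OF y1(1)] by simp_all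
    then have yX: "y \<in> toric_variety \<Sigma>" by (simp add: mem_chart)
    have "m \<in> perp_lattice_points (fst y)" using toric_varietyD(2)[OF yX] y(3) by blast
    then have sub: "fst y \<subseteq> \<sigma> \<inter> \<sigma>'" using m(2) chart_subset[OF y(1)] by (fastforce simp: perp_lattice_points_def)
    have "y \<in> toric_variety \<Sigma> \<and> fst y face_of \<sigma>" using sub yX by (intro conjI subset_face toric_varietyD(1)[OF yX] \<sigma>) simp_all
    moreover have "eval_at f y \<noteq> 0" using y(2) val[OF yX sub] by auto
    ultimately show "y \<in> {y \<in> chart \<Sigma> \<sigma>. eval_at f y \<noteq> 0}" using yX by (simp add: mem_chart)
  qed
qed

lemma chart_open: "\<sigma> \<in> \<Sigma> \<Longrightarrow> zariski_open \<Sigma> (chart \<Sigma> \<sigma> :: ('n, 'k::field) tpoint set)"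
proof -
  assume \<sigma>: "\<sigma> \<in> \<Sigma>"
  have "eval_at 1 x = 1" if "x \<in> chart \<Sigma> \<sigma>" for x :: "('n, 'k) tpoint"
    using that by (auto simp: mem_chart intro: eval_at_one)
  then have eq: "chart \<Sigma> \<sigma> = {y \<in> chart \<Sigma> \<sigma>. eval_at (1 :: (int^'n) \<Rightarrow>\<^sub>0 'k) y \<noteq> 0}" by auto
  have "(1 :: (int^'n) \<Rightarrow>\<^sub>0 'k) \<in> coord_ring \<sigma>" by (simp add: coord_ring_def dual_lattice_points_def)
  then show ?thesis by (subst eq) (rule principal_open[OF \<sigma>])
qed

lemma torus_open: "zariski_open \<Sigma> (torus \<Sigma> :: ('n, 'k::field) tpoint set)"
  unfolding torus_eq_chart by (rule chart_open[OF zero_cone])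

text \<open>Some \<open>f\<close> that is nonzero at \<open>x\<close> has its nonvanishing locus
  inside \<open>V\<close>; it is a nonzero Laurent polynomial, and the torus lies in every
  chart.\<close>

lemma open_dense:
  fixes V :: "('n, 'k::field) tpoint set"
  assumes V: "zariski_open \<Sigma> V" "x \<in> V"
  shows "\<exists>G. G \<noteq> 0 \<and> (\<forall>\<gamma>. character \<gamma> \<longrightarrow> ev \<gamma> G \<noteq> 0 \<longrightarrow> ({0}, \<gamma>) \<in> V)"
proof -
  have X: "x \<in> toric_variety \<Sigma>" using openD(1)[OF V(1)] V(2) by blast
  obtain f where f: "eval_at f x \<noteq> 0" "{y \<in> chart \<Sigma> (fst x). eval_at f y \<noteq> 0} \<subseteq> V"
    using openD(2)[OF V(1) toric_varietyD(1)[OF X] V(2) mem_own_chart[OF X]] by blast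
  have "f \<noteq> 0" using f(1) by (auto simp: eval_at_ev)
  moreover have "({0}, \<gamma>) \<in> V" if "character \<gamma>" "ev \<gamma> f \<noteq> 0" for \<gamma>
    using f(2) torus_subset_chart[OF toric_varietyD(1)[OF X]] torus_char[OF that(1)] that(2)
    by (auto simp: eval_at_ev)
  ultimately show ?thesis by blast
qed

text \<open>Lets identities between rational functions be checked only at characters where all the
  fractions involved are defined; \<open>G\<close> is the product of the exceptional
  equations.\<close>

lemma laurent_eq_generic:
  fixes f f' G :: "(int^'n) \<Rightarrow>\<^sub>0 'k::field_char_0"
  assumes "G \<noteq> 0" "\<And>\<gamma>. character \<gamma> \<Longrightarrow> ev \<gamma> G \<noteq> 0 \<Longrightarrow> ev \<gamma> f = ev \<gamma> f'"
  shows "f = f'"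
proof (rule ccontr)
  assume "f \<noteq> f'"
  then obtain \<gamma> where "character \<gamma>" "ev \<gamma> G \<noteq> 0" "ev \<gamma> (f - f') \<noteq> 0"
    using ev_pair_nonzero[OF assms(1), of "f - f'"] by auto
  then show False using assms(2) by (simp add: ev_diff)
qed

lemma regular_on_subset:
  assumes "regular_on \<Sigma> V \<phi>" "zariski_open \<Sigma> V'" "V' \<subseteq> V"
  shows "regular_on \<Sigma> V' \<phi>"
  unfolding regular_on_def
proof
  fix x assume x: "x \<in> V'"
  then obtain \<sigma> W f h where *: "\<sigma> \<in> \<Sigma>" "zariski_open \<Sigma> W" "x \<in> W" "W \<subseteq> V \<inter> chart \<Sigma> \<sigma>"
    "f \<in> coord_ring \<sigma>" "h \<in> coord_ring \<sigma>" "\<forall>y\<in>W. eval_at h y \<noteq> 0 \<and> \<phi> y = eval_at f y / eval_at h y"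
    using assms(1,3) unfolding regular_on_def by (meson subsetD)
  show "\<exists>\<sigma>\<in>\<Sigma>. \<exists>W. zariski_open \<Sigma> W \<and> x \<in> W \<and> W \<subseteq> V' \<inter> chart \<Sigma> \<sigma> \<and>
      (\<exists>f\<in>coord_ring \<sigma>. \<exists>h\<in>coord_ring \<sigma>. \<forall>y\<in>W. eval_at h y \<noteq> 0 \<and> \<phi> y = eval_at f y / eval_at h y)"
  proof (rule bexI[OF _ *(1)], intro exI conjI)
    show "zariski_open \<Sigma> (W \<inter> V')" by (rule open_Int[OF *(2) assms(2)])
    show "x \<in> W \<inter> V'" using x *(3) by simp
    show "W \<inter> V' \<subseteq> V' \<inter> chart \<Sigma> \<sigma>" using *(4) by blast
    show "\<exists>f\<in>coord_ring \<sigma>. \<exists>h\<in>coord_ring \<sigma>. \<forall>y\<in>W \<inter> V'. eval_at h y \<noteq> 0 \<and> \<phi> y = eval_at f y / eval_at h y"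
      using *(5-7) by blast
  qed
qed

lemma regular_quotient:
  assumes "zariski_open \<Sigma> V" "\<sigma> \<in> \<Sigma>" "V \<subseteq> chart \<Sigma> \<sigma>" "f \<in> coord_ring \<sigma>" "h \<in> coord_ring \<sigma>"
    "\<And>y. y \<in> V \<Longrightarrow> eval_at h y \<noteq> 0"
  shows "regular_on \<Sigma> V (\<lambda>y. eval_at f y / eval_at h y)"
  unfolding regular_on_def using assms by blast

lemma regular_eval:
  fixes V :: "('n, 'k::field) tpoint set"
  assumes "zariski_open \<Sigma> V" "\<sigma> \<in> \<Sigma>" "V \<subseteq> chart \<Sigma> \<sigma>" "f \<in> coord_ring \<sigma>"
  shows "regular_on \<Sigma> V (eval_at f)"
proof -
  have one: "eval_at 1 y = 1" if "y \<in> V" for y :: "('n, 'k) tpoint"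
    using eval_at_one openD(1)[OF assms(1)] that by blast
  have "(1 :: (int^'n) \<Rightarrow>\<^sub>0 'k) \<in> coord_ring \<sigma>" by (simp add: coord_ring_def dual_lattice_points_def)
  moreover have "\<forall>y\<in>V. eval_at 1 y \<noteq> 0 \<and> eval_at f y = eval_at f y / eval_at 1 y" using one by simp
  ultimately show ?thesis unfolding regular_on_def using assms by blast
qed

text \<open>Beside the value at \<open>x\<close>, the fraction is recorded at generic characters,
  where expressions that stem from different charts can be compared as Laurent polynomials.\<close>

lemma regular_germ:
  fixes V :: "('n, 'k::field) tpoint set"
  assumes "regular_on \<Sigma> V \<phi>" "x \<in> V"
  obtains \<sigma> A B G where "\<sigma> \<in> \<Sigma>" "x \<in> chart \<Sigma> \<sigma>" "A \<in> coord_ring \<sigma>" "B \<in> coord_ring \<sigma>"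
    "eval_at B x \<noteq> 0" "\<phi> x = eval_at A x / eval_at B x" "G \<noteq> 0"
    "\<forall>\<gamma>. character \<gamma> \<longrightarrow> ev \<gamma> G \<noteq> 0 \<longrightarrow>
      ({0}, \<gamma>) \<in> V \<and> ev \<gamma> B \<noteq> 0 \<and> \<phi> ({0}, \<gamma>) = ev \<gamma> A / ev \<gamma> B"
proof -
  obtain \<sigma> W f h where *: "\<sigma> \<in> \<Sigma>" "zariski_open \<Sigma> W" "x \<in> W" "W \<subseteq> V \<inter> chart \<Sigma> \<sigma>"
    "f \<in> coord_ring \<sigma>" "h \<in> coord_ring \<sigma>" "\<forall>y\<in>W. eval_at h y \<noteq> 0 \<and> \<phi> y = eval_at f y / eval_at h y"
    using assms unfolding regular_on_def by meson
  obtain G where G: "G \<noteq> 0" "\<And>\<gamma>. character \<gamma> \<Longrightarrow> ev \<gamma> G \<noteq> 0 \<Longrightarrow> ({0}, \<gamma>) \<in> W"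
    using open_dense[OF *(2,3)] by blast
  show ?thesis
  proof (rule that[OF *(1) _ *(5,6) _ _ G(1)]; (intro allI impI)?)
    show "x \<in> chart \<Sigma> \<sigma>" "eval_at h x \<noteq> 0" "\<phi> x = eval_at f x / eval_at h x" using *(3,4,7) by auto
    fix \<gamma> :: "int^'n \<Rightarrow> 'k" assume "character \<gamma>" "ev \<gamma> G \<noteq> 0"
    then have W: "({0}, \<gamma>) \<in> W" by (rule G(2))
    then show "({0}, \<gamma>) \<in> V \<and> ev \<gamma> h \<noteq> 0 \<and> \<phi> ({0}, \<gamma>) = ev \<gamma> f / ev \<gamma> h"
      using *(4) *(7) by (auto simp: eval_at_ev dest: bspec[OF _ W])
  qed
qed

end

lemma endoD:
  assumes "variety_endo \<Sigma> g"
  shows "x \<in> toric_variety \<Sigma> \<Longrightarrow> g x \<in> toric_variety \<Sigma>"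
    "zariski_open \<Sigma> V \<Longrightarrow> zariski_open \<Sigma> (g -` V \<inter> toric_variety \<Sigma>)"
    "zariski_open \<Sigma> V \<Longrightarrow> regular_on \<Sigma> V \<phi> \<Longrightarrow> regular_on \<Sigma> (g -` V \<inter> toric_variety \<Sigma>) (\<phi> \<circ> g)"
  using assms unfolding variety_endo_def by auto

section \<open>Rays of a fan with a transitive cone\<close>

lemma rvec_add_inner: "rvec (m + m') \<bullet> v = rvec m \<bullet> v + rvec m' \<bullet> v"
  by (simp add: rvec_add inner_add_left)

lemma dual_basis_cone:
  "m \<in> dual_lattice_points (basis_cone e) \<longleftrightarrow> (\<forall>j. pairing m (e j) \<le> (0::int))"
proof
  assume m: "m \<in> dual_lattice_points (basis_cone e)"
  have "rvec (- e j) \<in> basis_cone e" for j by (rule hull_inc) simp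
  then have "0 \<le> rvec m \<bullet> rvec (- e j)" for j using m unfolding dual_lattice_points_def by blast
  then show "\<forall>j. pairing m (e j) \<le> (0::int)" by (simp add: rvec_inner pairing_uminus_right)
next
  assume *: "\<forall>j. pairing m (e j) \<le> (0::int)"
  have "basis_cone e \<subseteq> {v. 0 \<le> rvec m \<bullet> v}"
    by (rule hull_minimal)
      (use * in \<open>auto simp: convex_cone_iff inner_add_right rvec_inner pairing_uminus_right\<close>)
  then show "m \<in> dual_lattice_points (basis_cone e)" by (auto simp: dual_lattice_points_def)
qed

text \<open>\<open>x0\<close> is the fixed point of the transitive cone, \<open>g\<close> an
  automorphism taking it to the unit of the torus, and \<open>h\<close> its inverse. The inverse
  laws are restricted to points of the variety because the maps are total on a larger type.\<close>

locale moved_fixed_point = complete_fan_loc \<Sigma> for \<Sigma> :: "(real^'n) set set" +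
  fixes e :: "'n \<Rightarrow> int^'n"
    and g h :: "('n, 'k::{alg_closed_field, field_char_0}) tpoint \<Rightarrow> ('n, 'k) tpoint"
    and x0 :: "('n, 'k) tpoint"
  assumes basis: "lattice_basis e"
    and x0: "x0 \<in> toric_variety \<Sigma>" "fst x0 = basis_cone e"
    and endo: "variety_endo \<Sigma> g" "variety_endo \<Sigma> h"
    and inverse: "\<And>x. x \<in> toric_variety \<Sigma> \<Longrightarrow> h (g x) = x" "\<And>x. x \<in> toric_variety \<Sigma> \<Longrightarrow> g (h x) = x"
    and moved: "g x0 = ({0}, \<lambda>_. 1)"
begin

abbreviation "\<sigma>0 \<equiv> basis_cone e"
abbreviation "X \<equiv> toric_variety \<Sigma> :: ('n, 'k) tpoint set"
abbreviation "T \<equiv> torus \<Sigma> :: ('n, 'k) tpoint set"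
abbreviation "y0 \<equiv> ({0}, \<lambda>_. 1) :: ('n, 'k) tpoint"
abbreviation "one_char \<equiv> (\<lambda>_. 1) :: int^'n \<Rightarrow> 'k"

lemma \<sigma>0: "\<sigma>0 \<in> \<Sigma>"
  using toric_varietyD(1)[OF x0(1)] x0(2) by simp

lemma one_char: "character one_char"
  by (simp add: character_def)

lemma y0: "y0 \<in> T" "y0 \<in> X"
  using torus_char[OF one_char] by (auto simp: torus_def)

lemma hy0: "h y0 = x0"
  using inverse(1)[OF x0(1)] moved by simp

lemma x0_chart: "x0 \<in> chart \<Sigma> \<sigma>0"
  using mem_own_chart[OF x0(1)] x0(2) by simp

text \<open>The cone of \<open>x0\<close> spans the space, so only \<open>m = 0\<close> is
  perpendicular to it. Evaluation at \<open>x0\<close> therefore reads off the constant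
  coefficient.\<close>

lemma snd_x0: "snd x0 m = (if m = 0 then 1 else 0)"
proof (cases "m = 0")
  case False
  have "m \<notin> perp_lattice_points \<sigma>0"
  proof
    assume m: "m \<in> perp_lattice_points \<sigma>0"
    have "rvec (- e j) \<in> \<sigma>0" for j by (rule hull_inc) simp
    then have "rvec m \<bullet> rvec (- e j) = 0" for j using m unfolding perp_lattice_points_def by blast
    then have "pairing m (e j) = (0::int)" for j by (simp add: rvec_inner pairing_uminus_right)
    then show False using lattice_point_eqI[OF basis, of m 0] False by simp
  qed
  then have "snd x0 m = 0" using toric_varietyD(2)[OF x0(1), of m] x0(2) by auto
  then show ?thesis using False by simp
qed (simp add: snd_tpoint_0[OF x0(1)])

lemma eval_x0: "eval_at f x0 = Poly_Mapping.lookup f 0"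
proof -
  have "eval_at f x0 = (\<Sum>m\<in>Poly_Mapping.keys f. if m = 0 then Poly_Mapping.lookup f 0 else 0)"
    unfolding eval_at_def snd_x0 by (rule sum.cong) auto
  then show ?thesis by (simp add: in_keys_iff)
qed

lemma torusE:
  assumes "x \<in> T"
  obtains \<gamma> where "x = ({0}, \<gamma>)" "character \<gamma>"
  using assms torus_iff[of x] by (cases x) auto

lemma eval_torus: "character \<gamma> \<Longrightarrow> eval_at f ({0}, \<gamma>) = ev \<gamma> f"
  by (simp add: eval_at_ev)

lemma T_subset: "T \<subseteq> X" by (auto simp: torus_def)

section \<open>The moved divisor in the torus\<close>

text \<open>The function that cuts out the divisor of \<open>- e j\<close> in the chart of
  \<open>\<sigma>0\<close>. The sign is there because this cone is spanned by the negatives of the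
  basis vectors.\<close>

definition coord :: "'n \<Rightarrow> (int^'n) \<Rightarrow>\<^sub>0 'k" where
  "coord j = Poly_Mapping.single (- dual_basis e j) 1"

lemma coord_in: "coord j \<in> coord_ring \<sigma>0"
  unfolding coord_def
  by (rule coord_ring_single) (simp add: dual_basis_cone pairing_uminus_left dual_basis_pairing[OF basis])

lemma coord_x0: "eval_at (coord j) x0 = 0"
proof -
  have "pairing (dual_basis e j) (e j) = (1::int)" using dual_basis_pairing[OF basis] by simp
  then have "dual_basis e j \<noteq> 0" by auto
  then show ?thesis by (simp add: eval_x0 coord_def lookup_single)
qed

text \<open>\<open>A / B\<close> is the pullback of the coordinate under \<open>h\<close> near
  \<open>y0\<close>. It vanishes at \<open>y0\<close>, which \<open>h\<close> takes to
  \<open>x0\<close>; it is not identically zero, because \<open>h\<close> takes generic characters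
  into the torus, where no coordinate vanishes.\<close>

lemma local_equation:
  obtains A B G :: "(int^'n) \<Rightarrow>\<^sub>0 'k" where "A \<noteq> 0" "G \<noteq> 0" "ev one_char A = 0" "ev one_char B \<noteq> 0"
    "\<And>\<gamma>. character \<gamma> \<Longrightarrow> ev \<gamma> G \<noteq> 0 \<Longrightarrow>
      ev \<gamma> B \<noteq> 0 \<and> eval_at (coord j) (h ({0}, \<gamma>)) = ev \<gamma> A / ev \<gamma> B"
proof -
  let ?V = "h -` chart \<Sigma> \<sigma>0 \<inter> X"
  have "regular_on \<Sigma> (chart \<Sigma> \<sigma>0) (eval_at (coord j))"
    by (rule regular_eval[OF chart_open[OF \<sigma>0] \<sigma>0 subset_refl coord_in])
  then have reg: "regular_on \<Sigma> ?V (eval_at (coord j) \<circ> h)" by (rule endoD(3)[OF endo(2) chart_open[OF \<sigma>0]])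
  have "y0 \<in> ?V" using y0 hy0 x0_chart by simp
  with reg obtain \<sigma> A B G where "\<sigma> \<in> \<Sigma>" "y0 \<in> chart \<Sigma> \<sigma>" "A \<in> coord_ring \<sigma>" "B \<in> coord_ring \<sigma>"
    and *: "eval_at B y0 \<noteq> 0"
    "(eval_at (coord j) \<circ> h) y0 = eval_at A y0 / eval_at B y0" "G \<noteq> 0"
    "\<forall>\<gamma>. character \<gamma> \<longrightarrow> ev \<gamma> G \<noteq> 0 \<longrightarrow>
      ({0}, \<gamma>) \<in> ?V \<and> ev \<gamma> B \<noteq> 0 \<and> (eval_at (coord j) \<circ> h) ({0}, \<gamma>) = ev \<gamma> A / ev \<gamma> B"
    by (rule regular_germ) (rule that, assumption+)
  have B: "ev one_char B \<noteq> 0" using *(1) by (simp add: eval_torus[OF one_char])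
  have A: "ev one_char A = 0"
    using *(2) B by (simp add: hy0 coord_x0 eval_torus[OF one_char])
  have "A \<noteq> 0"
  proof
    assume A0: "A = 0"
    \<comment> \<open>This point shows that the open set of points taken into the torus by
      \<open>h\<close> is nonempty, so it contains the generic characters.\<close>
    have "g y0 \<in> h -` T \<inter> X" using y0 inverse(1)[OF y0(2)] endoD(1)[OF endo(1)] by auto
    from open_dense[OF endoD(2)[OF endo(2) torus_open] this]
    obtain G2 where G2: "G2 \<noteq> 0" "\<And>\<gamma>. character \<gamma> \<Longrightarrow> ev \<gamma> G2 \<noteq> 0 \<Longrightarrow> ({0}, \<gamma>) \<in> h -` T \<inter> X" by blast
    obtain \<gamma> where \<gamma>: "character \<gamma>" "ev \<gamma> G \<noteq> 0" "ev \<gamma> G2 \<noteq> 0" using ev_pair_nonzero[OF *(3) G2(1)] by blast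
    have "h ({0}, \<gamma>) \<in> T" using G2(2)[OF \<gamma>(1,3)] by blast
    then obtain \<gamma>' where \<gamma>': "h ({0}, \<gamma>) = ({0}, \<gamma>')" "character \<gamma>'" by (rule torusE)
    have "eval_at (coord j) (h ({0}, \<gamma>)) = 0" using *(4)[rule_format, OF \<gamma>(1,2)] A0 by simp
    then have "\<gamma>' (- dual_basis e j) = 0" unfolding \<gamma>'(1) by (simp add: coord_def eval_at_single)
    then show False using character_nonzero[OF \<gamma>'(2)] by blast
  qed
  then show ?thesis using that[of A G B] A B *(3,4) by auto
qed

text \<open>\<open>vanishing j f\<close>: \<open>f\<close> is zero on the part in the torus of the image under \<open>g\<close> of the divisor
  of \<open>- e j\<close>.\<close>

definition vanishing :: "'n \<Rightarrow> ((int^'n) \<Rightarrow>\<^sub>0 'k) \<Rightarrow> bool" where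
  "vanishing j f \<longleftrightarrow> (\<forall>\<gamma>. character \<gamma> \<longrightarrow> rvec (- e j) \<in> fst (h ({0}, \<gamma>)) \<longrightarrow> ev \<gamma> f = 0)"

lemma ray_cone_in: "convex_cone hull {rvec (- e j)} \<in> \<Sigma>"
  using basis_vector_ray[OF fan basis \<sigma>0] by (simp add: rays_def)

lemma perp_ray: "m \<in> perp_lattice_points (convex_cone hull {rvec v}) \<longleftrightarrow> pairing m v = (0::int)"
proof
  assume m: "m \<in> perp_lattice_points (convex_cone hull {rvec v})"
  have "rvec v \<in> convex_cone hull {rvec v}" by (rule hull_inc) simp
  then have "rvec m \<bullet> rvec v = 0" using m unfolding perp_lattice_points_def by blast
  then show "pairing m v = (0::int)" by (simp add: rvec_inner)
qed (auto simp: perp_lattice_points_def convex_cone_hull_singleton rvec_inner)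

text \<open>If \<open>N\<close> vanishes on the divisor near \<open>x0\<close>, its part
  perpendicular to \<open>e j\<close> is zero: otherwise some point of the orbit of the ray lies in
  \<open>W\<close> and has a nonzero value of \<open>N\<close>. All exponents then pair with
  \<open>e j\<close> to at most -1, so one factor of the coordinate can be taken out.\<close>

lemma divisible_by_coord:
  assumes W: "zariski_open \<Sigma> W" "x0 \<in> W" and N: "N \<in> coord_ring \<sigma>0"
    and zero: "\<And>x. x \<in> W \<Longrightarrow> x \<in> chart \<Sigma> \<sigma>0 \<Longrightarrow> rvec (- e j) \<in> fst x \<Longrightarrow> eval_at N x = 0"
  obtains N1 where "N1 \<in> coord_ring \<sigma>0" "N = coord j * N1"
proof -
  define \<tau> where "\<tau> = convex_cone hull {rvec (- e j)}"
  have \<tau>: "\<tau> \<in> \<Sigma>" using ray_cone_in by (simp add: \<tau>_def)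
  have "\<tau> \<subseteq> \<sigma>0" unfolding \<tau>_def by (rule hull_mono) auto
  then have face: "\<tau> face_of \<sigma>0" by (rule subset_face[OF \<tau> \<sigma>0])
  have perp: "m \<in> perp_lattice_points \<tau> \<longleftrightarrow> pairing m (e j) = (0::int)" for m
    by (simp add: \<tau>_def perp_ray pairing_uminus_right)
  obtain f where f: "f \<in> coord_ring \<sigma>0" "eval_at f x0 \<noteq> 0" "{y \<in> chart \<Sigma> \<sigma>0. eval_at f y \<noteq> 0} \<subseteq> W"
    using openD(2)[OF W(1) \<sigma>0 W(2) x0_chart] by blast
  \<comment> \<open>The perpendicular part of \<open>f\<close> keeps the constant coefficient, which
    is the nonzero value of \<open>f\<close> at \<open>x0\<close>; so the neighbourhood of
    \<open>x0\<close> meets the orbit of the ray.\<close>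
  have f0: "restr (perp_lattice_points \<tau>) f \<noteq> 0"
  proof
    assume "restr (perp_lattice_points \<tau>) f = 0"
    then have "Poly_Mapping.lookup (restr (perp_lattice_points \<tau>) f) 0 = 0" by simp
    then show False using f(2) by (simp add: lookup_restr perp eval_x0)
  qed
  have N0: "restr (perp_lattice_points \<tau>) N = 0"
  proof (rule ccontr)
    assume "\<not> ?thesis"
    then obtain \<gamma> where \<gamma>: "character \<gamma>" "ev \<gamma> (restr (perp_lattice_points \<tau>) f) \<noteq> 0"
      "ev \<gamma> (restr (perp_lattice_points \<tau>) N) \<noteq> 0" using ev_pair_nonzero[OF f0] by blast
    let ?x = "orbit_point \<tau> \<gamma>"
    have c: "?x \<in> chart \<Sigma> \<sigma>0"
      using orbit_point_in[OF \<tau> \<gamma>(1)] face by (simp add: mem_chart orbit_point_def)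
    have "?x \<in> W" using f(3) c \<gamma>(2) by (auto simp: eval_orbit_point)
    moreover have "rvec (- e j) \<in> fst ?x" by (simp add: orbit_point_def \<tau>_def hull_inc)
    ultimately have "eval_at N ?x = 0" using zero c by blast
    then show False using \<gamma>(3) by (simp add: eval_orbit_point)
  qed
  define N1 where "N1 = N * Poly_Mapping.single (dual_basis e j) 1"
  have "m + dual_basis e j \<in> dual_lattice_points \<sigma>0" if m: "m \<in> Poly_Mapping.keys N" for m
  proof -
    have "m \<notin> Poly_Mapping.keys (restr (perp_lattice_points \<tau>) N)" using N0 by simp
    then have "pairing m (e j) \<noteq> (0::int)" using m by (simp add: keys_restr perp)
    moreover have le: "pairing m (e i) \<le> (0::int)" for i
      using N m dual_basis_cone[of m e] by (auto simp: coord_ring_def)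
    ultimately have "pairing m (e j) \<le> (-1::int)" using le[of j] by linarith
    then show ?thesis using le
      by (simp add: dual_basis_cone pairing_add_left dual_basis_pairing[OF basis])
  qed
  then have "N1 \<in> coord_ring \<sigma>0"
    using keys_mult[of N "Poly_Mapping.single (dual_basis e j) 1"]
    by (fastforce simp: N1_def coord_ring_def)
  moreover have "coord j * N1 = N * (Poly_Mapping.single (dual_basis e j) 1 * coord j)"
    by (simp add: N1_def mult_ac)
  then have "N = coord j * N1" by (simp add: coord_def mult_single)
  ultimately show ?thesis by (rule that)
qed

text \<open>Transport in both directions: the pullback of \<open>f\<close> under \<open>g\<close>
  vanishes on the divisor near \<open>x0\<close>, so there it is the coordinate times a regular
  function. Going back by \<open>h\<close> writes \<open>f\<close> near \<open>y0\<close> as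
  \<open>A / B\<close> times the fraction \<open>C / C'\<close>.\<close>

lemma vanishing_local:
  assumes f: "vanishing j f" and B: "ev one_char B \<noteq> 0" and G: "G \<noteq> 0"
    and loc: "\<And>\<gamma>. character \<gamma> \<Longrightarrow> ev \<gamma> G \<noteq> 0 \<Longrightarrow>
      ev \<gamma> B \<noteq> 0 \<and> eval_at (coord j) (h ({0}, \<gamma>)) = ev \<gamma> A / ev \<gamma> B"
  obtains C C' where "ev one_char C' \<noteq> 0" "f * (B * C') = A * C"
proof -
  let ?V = "(g -` T \<inter> X) \<inter> chart \<Sigma> \<sigma>0"
  have "regular_on \<Sigma> T (eval_at f)"
    using regular_eval[OF torus_open zero_cone] by (simp add: torus_eq_chart coord_ring_zero_cone)
  then have "regular_on \<Sigma> (g -` T \<inter> X) (eval_at f \<circ> g)" by (rule endoD(3)[OF endo(1) torus_open])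
  then have reg: "regular_on \<Sigma> ?V (eval_at f \<circ> g)"
    by (rule regular_on_subset)
      (use open_Int[OF endoD(2)[OF endo(1) torus_open] chart_open[OF \<sigma>0]] in auto)
  have "x0 \<in> ?V" using x0 x0_chart moved y0 by simp
  then obtain \<sigma> W N Q where W: "\<sigma> \<in> \<Sigma>" "zariski_open \<Sigma> W" "x0 \<in> W" "W \<subseteq> ?V \<inter> chart \<Sigma> \<sigma>"
    "N \<in> coord_ring \<sigma>" "Q \<in> coord_ring \<sigma>"
    "\<forall>y\<in>W. eval_at Q y \<noteq> 0 \<and> (eval_at f \<circ> g) y = eval_at N y / eval_at Q y"
    using reg unfolding regular_on_def by meson
  have "x0 \<in> chart \<Sigma> \<sigma>" using W(3,4) by blast
  then have "\<sigma>0 \<subseteq> \<sigma>" using chart_subset x0(2) by metis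
  then have NQ: "N \<in> coord_ring \<sigma>0" "Q \<in> coord_ring \<sigma>0"
    using W(5,6) coord_ring_antimono by blast+
  obtain N1 where N1: "N1 \<in> coord_ring \<sigma>0" "N = coord j * N1"
  proof (rule divisible_by_coord[OF W(2,3) NQ(1)])
    fix x assume x: "x \<in> W" "rvec (- e j) \<in> fst x"
    then have gx: "g x \<in> T" and xX: "x \<in> X" using W(4) by blast+
    obtain \<gamma> where \<gamma>: "g x = ({0}, \<gamma>)" "character \<gamma>" using gx by (rule torusE)
    have "h ({0}, \<gamma>) = x" using inverse(1)[OF xX] \<gamma>(1) by simp
    then have "ev \<gamma> f = 0" using f \<gamma>(2) x(2) unfolding vanishing_def by metis
    then have "(eval_at f \<circ> g) x = 0" using \<gamma> by (simp add: eval_torus)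
    then show "eval_at N x = 0" using bspec[OF W(7) x(1)] by auto
  qed blast
  have Wc: "W \<subseteq> chart \<Sigma> \<sigma>0" using W(4) by blast
  have "regular_on \<Sigma> W (\<lambda>y. eval_at N1 y / eval_at Q y)"
    by (rule regular_quotient[OF W(2) \<sigma>0 Wc N1(1) NQ(2)]) (use W(7) in blast)
  then have reg': "regular_on \<Sigma> (h -` W \<inter> X) ((\<lambda>y. eval_at N1 y / eval_at Q y) \<circ> h)"
    by (rule endoD(3)[OF endo(2) W(2)])
  have "y0 \<in> h -` W \<inter> X" using y0 hy0 W(3) by simp
  with reg' obtain \<sigma>' C C' G' where "\<sigma>' \<in> \<Sigma>" "y0 \<in> chart \<Sigma> \<sigma>'" "C \<in> coord_ring \<sigma>'" "C' \<in> coord_ring \<sigma>'"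
    and C: "eval_at C' y0 \<noteq> 0"
    and "((\<lambda>y. eval_at N1 y / eval_at Q y) \<circ> h) y0 = eval_at C y0 / eval_at C' y0"
    and C'': "G' \<noteq> 0"
    "\<forall>\<gamma>. character \<gamma> \<longrightarrow> ev \<gamma> G' \<noteq> 0 \<longrightarrow> ({0}, \<gamma>) \<in> h -` W \<inter> X \<and> ev \<gamma> C' \<noteq> 0 \<and>
      ((\<lambda>y. eval_at N1 y / eval_at Q y) \<circ> h) ({0}, \<gamma>) = ev \<gamma> C / ev \<gamma> C'" by (rule regular_germ) (rule that, assumption+)
  note C = C C''
  have "f * (B * C') = A * C"
  proof (rule laurent_eq_generic)
    show "G * G' \<noteq> 0" using G C(2) by (simp add: laurent_no_zero_divisors)
    fix \<gamma> assume \<gamma>: "character \<gamma>" "ev \<gamma> (G * G') \<noteq> 0"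
    then have nz: "ev \<gamma> G \<noteq> 0" "ev \<gamma> G' \<noteq> 0" by (auto simp: ev_mult_char)
    define x where "x = h ({0}, \<gamma>)"
    have xW: "x \<in> W" using C(3)[rule_format, OF \<gamma>(1) nz(2)] by (simp add: x_def)
    have "({0}, \<gamma>) \<in> X" using torus_char[OF \<gamma>(1)] T_subset by blast
    then have gx: "g x = ({0}, \<gamma>)" unfolding x_def by (rule inverse(2))
    have "ev \<gamma> f = eval_at N x / eval_at Q x"
      using bspec[OF W(7) xW] gx eval_torus[OF \<gamma>(1), of f] by simp
    also have "\<dots> = eval_at (coord j) x * (eval_at N1 x / eval_at Q x)"
      unfolding N1(2) using eval_at_mult_chart[OF subsetD[OF Wc xW] coord_in N1(1)] by simp
    also have "\<dots> = (ev \<gamma> A / ev \<gamma> B) * (ev \<gamma> C / ev \<gamma> C')"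
      using loc[OF \<gamma>(1) nz(1)] C(3)[rule_format, OF \<gamma>(1) nz(2)] by (simp add: x_def)
    finally have "ev \<gamma> f = (ev \<gamma> A / ev \<gamma> B) * (ev \<gamma> C / ev \<gamma> C')" .
    moreover have "ev \<gamma> B \<noteq> 0" "ev \<gamma> C' \<noteq> 0" using loc[OF \<gamma>(1) nz(1)] C(3)[rule_format, OF \<gamma>(1) nz(2)] by auto
    ultimately show "ev \<gamma> (f * (B * C')) = ev \<gamma> (A * C)"
      by (simp add: ev_mult_char[OF \<gamma>(1)])
  qed
  moreover have "ev one_char C' \<noteq> 0" using C(1) by (simp add: eval_torus[OF one_char])
  ultimately show ?thesis by (rule that[rotated])
qed

text \<open>The local equation \<open>A\<close> at \<open>y0\<close> of the moved divisor may have further components; a prime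
  factor through \<open>y0\<close> divides every function that vanishes on the divisor.\<close>

lemma divisor_equation:
  obtains F where "prime_elem F" "ev one_char F = 0" "\<And>f. vanishing j f \<Longrightarrow> F dvd f"
proof -
  obtain A B G :: "(int^'n) \<Rightarrow>\<^sub>0 'k" where *: "A \<noteq> 0" "G \<noteq> 0" "ev one_char A = 0" "ev one_char B \<noteq> 0"
    "\<forall>\<gamma>. character \<gamma> \<longrightarrow> ev \<gamma> G \<noteq> 0 \<longrightarrow>
      ev \<gamma> B \<noteq> 0 \<and> eval_at (coord j) (h ({0}, \<gamma>)) = ev \<gamma> A / ev \<gamma> B" by (rule local_equation) blast
  obtain F where F: "prime_elem F" "F dvd A" "ev one_char F = 0"
    using prime_factor_at_zero[OF *(1) one_char *(3)] by blast
  have "F dvd f" if f: "vanishing j f" for f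
  proof -
    obtain C C' where C: "ev one_char C' \<noteq> 0" "f * (B * C') = A * C"
      using vanishing_local[OF f *(4,2) *(5)[rule_format]] by blast
    have "F dvd f * (B * C')" unfolding C(2) using F(2) by simp
    moreover have "\<not> F dvd B * C'"
    proof
      assume "F dvd B * C'"
      then obtain q where "B * C' = F * q" by (rule dvdE)
      then have "ev one_char B * ev one_char C' = ev one_char F * ev one_char q"
        using ev_mult_char[OF one_char] by metis
      then show False using F(3) *(4) C(1) by simp
    qed
    ultimately show ?thesis using prime_elem_dvd_multD[OF F(1)] by blast
  qed
  then show ?thesis using that F by blast
qed

section \<open>The function with poles along the moved divisor\<close>

text \<open>Up to codimension two this is the complement of the divisor of \<open>- e j\<close>. It
  is large enough to control the exponents of a function at every ray other than
  \<open>- e j\<close>.\<close>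

definition codim1_part :: "'n \<Rightarrow> ('n, 'k) tpoint set" where
  "codim1_part j = \<Union> (chart \<Sigma> ` ({{0}} \<union> {convex_cone hull {rvec \<rho>} | \<rho>. \<rho> \<in> rays \<Sigma> \<and> \<rho> \<noteq> - e j}))"

lemma codim1_part_open: "zariski_open \<Sigma> (codim1_part j)"
  unfolding codim1_part_def by (rule open_Union) (auto simp: rays_def intro: chart_open zero_cone)

lemma codim1_part_avoids:
  assumes "x \<in> codim1_part j"
  shows "rvec (- e j) \<notin> fst x"
proof
  assume v: "rvec (- e j) \<in> fst x"
  have prim: "primitive (- e j)" by (rule primitive_basis_vector[OF basis])
  then have nz: "rvec (- e j) \<noteq> 0" using primitive_nonzero by (simp add: rvec_eq_0 del: neg_equal_0_iff_equal)
  consider "x \<in> chart \<Sigma> {0}" | \<rho> where "\<rho> \<in> rays \<Sigma>" "\<rho> \<noteq> - e j" "x \<in> chart \<Sigma> (convex_cone hull {rvec \<rho>})"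
    using assms unfolding codim1_part_def by blast
  then show False
  proof cases
    case 1
    then show ?thesis using chart_subset v nz by blast
  next
    case 2
    then have "rvec (- e j) \<in> convex_cone hull {rvec \<rho>}" using chart_subset v by blast
    then obtain c where c: "rvec (- e j) = c *\<^sub>R rvec \<rho>" "c \<ge> 0" by (auto simp: convex_cone_hull_singleton)
    then have "c > 0" using nz by (cases "c = 0") auto
    then have "convex_cone hull {rvec (- e j)} = convex_cone hull {rvec \<rho>}"
      unfolding c(1) by (rule scale_convex_cone_hull)
    then show ?thesis using primitive_ray_inject[OF prim, of \<rho>] 2(1,2) by (simp add: rays_def)
  qed
qed

lemma T_in_codim1: "T \<subseteq> codim1_part j"
  unfolding codim1_part_def torus_eq_chart by blast

lemma codim1_in_X: "codim1_part j \<subseteq> X"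
  using openD(1)[OF codim1_part_open] .

theorem other_rays_nonneg:
  assumes \<rho>: "\<rho> \<in> rays \<Sigma>" "\<rho> \<noteq> - e j"
  shows "pairing (dual_basis e j) \<rho> \<ge> (0::int)"
proof -
  obtain F where F: "prime_elem F" "ev one_char F = 0" "\<And>f. vanishing j f \<Longrightarrow> F dvd f"
    by (rule divisor_equation[of j]) blast
  have F0: "F \<noteq> 0" using F(1) by (auto simp: prime_elem_def)
  then have "Poly_Mapping.keys F \<noteq> {}" by simp
  \<comment> \<open>Any exponent does: along an invariant divisor the order of \<open>F\<close> is
    the least weight of its exponents, so \<open>mon / F\<close> has no pole there.\<close>
  then obtain m0 where m0: "m0 \<in> Poly_Mapping.keys F" by blast
  define mon where "mon = (Poly_Mapping.single m0 1 :: (int^'n) \<Rightarrow>\<^sub>0 'k)"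
  define V where "V = h -` codim1_part j \<inter> X"
  have V: "zariski_open \<Sigma> V" unfolding V_def by (rule endoD(2)[OF endo(2) codim1_part_open])
  \<comment> \<open>A good pair exhibits \<open>mon / F\<close> as regular at \<open>x\<close>,
    through the expression \<open>mon * Q / f\<close>.\<close>
  define good where "good = (\<lambda>x f Q. f \<in> coord_ring (fst x) \<and> eval_at f x \<noteq> 0 \<and> f = F * Q \<and>
    mon * Q \<in> coord_ring (fst (x :: ('n, 'k) tpoint)))"
  have good_ex: "\<exists>f Q. good x f Q \<and> {y \<in> chart \<Sigma> (fst x). eval_at f y \<noteq> 0} \<subseteq> V" if x: "x \<in> V" for x
  proof -
    have xX: "x \<in> X" using x by (simp add: V_def)
    obtain f where f: "f \<in> coord_ring (fst x)" "eval_at f x \<noteq> 0" "{y \<in> chart \<Sigma> (fst x). eval_at f y \<noteq> 0} \<subseteq> V"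
      using openD(2)[OF V toric_varietyD(1)[OF xX] x mem_own_chart[OF xX]] by blast
    \<comment> \<open>A character that \<open>h\<close> takes into the divisor lies outside
      \<open>V\<close>, and \<open>f\<close> vanishes on the part of its chart outside
      \<open>V\<close>.\<close>
    have "vanishing j f" unfolding vanishing_def
    proof (intro allI impI)
      fix \<gamma> assume \<gamma>: "character \<gamma>" "rvec (- e j) \<in> fst (h ({0}, \<gamma>))"
      then have "({0}, \<gamma>) \<notin> V" using codim1_part_avoids unfolding V_def by blast
      moreover have "({0}, \<gamma>) \<in> chart \<Sigma> (fst x)"
        using torus_subset_chart[OF toric_varietyD(1)[OF xX]] torus_char[OF \<gamma>(1)] by blast
      ultimately have "eval_at f ({0}, \<gamma>) = 0" using f(3) by blast
      then show "ev \<gamma> f = 0" by (simp add: eval_torus[OF \<gamma>(1)])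
    qed
    then obtain Q where Q: "f = F * Q" using F(3) by (blast elim: dvdE)
    have "f \<noteq> 0" using f(2) by (auto simp: eval_at_ev)
    then have Q0: "Q \<noteq> 0" using Q by auto
    have "m0 + q \<in> dual_lattice_points (fst x)" if q: "q \<in> Poly_Mapping.keys Q" for q
      unfolding dual_lattice_points_def
    proof (intro CollectI ballI)
      fix v assume v: "v \<in> fst x"
      \<comment> \<open>The least weights of \<open>F\<close> and \<open>Q\<close> at
        \<open>v\<close> add up to the weight of an exponent of \<open>f\<close>, which is
        nonnegative; \<open>m0\<close> and \<open>q\<close> weigh at least as much as these
        minima.\<close>
      obtain m q' k where *: "k \<in> Poly_Mapping.keys (F * Q)" "rvec k \<bullet> v = rvec m \<bullet> v + rvec q' \<bullet> v"
        "\<And>m'. m' \<in> Poly_Mapping.keys F \<Longrightarrow> rvec m \<bullet> v \<le> rvec m' \<bullet> v"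
        "\<And>m'. m' \<in> Poly_Mapping.keys Q \<Longrightarrow> rvec q' \<bullet> v \<le> rvec m' \<bullet> v"
        by (rule initial_exponents[where l = "\<lambda>m. rvec m \<bullet> v", OF F0 Q0 rvec_add_inner]) (rule that; blast)
      have "rvec k \<bullet> v \<ge> 0" using f(1) *(1) v unfolding Q coord_ring_def dual_lattice_points_def by blast
      then show "0 \<le> rvec (m0 + q) \<bullet> v" using *(2) *(3)[OF m0] *(4)[OF q] by (simp add: rvec_add inner_add_left)
    qed
    then have "mon * Q \<in> coord_ring (fst x)"
      using keys_mult[of mon Q] by (fastforce simp: mon_def coord_ring_def)
    then show ?thesis unfolding good_def using f Q by blast
  qed
  have ratio_unique: "eval_at (mon * Q) x / eval_at f x = eval_at (mon * Q') x / eval_at f' x"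
    if "x \<in> X" "good x f Q" "good x f' Q'" for x f Q f' Q'
  proof -
    have m: "eval_at (a * b) x = eval_at a x * eval_at b x"
      if "a \<in> coord_ring (fst x)" "b \<in> coord_ring (fst x)" for a b
      by (rule eval_at_mult[OF \<open>x \<in> X\<close> subset_refl that])
    have a: "f \<in> coord_ring (fst x)" "eval_at f x \<noteq> 0" "f = F * Q" "mon * Q \<in> coord_ring (fst x)"
      using that(2) unfolding good_def by blast+
    have b: "f' \<in> coord_ring (fst x)" "eval_at f' x \<noteq> 0" "f' = F * Q'" "mon * Q' \<in> coord_ring (fst x)"
      using that(3) unfolding good_def by blast+
    have "(mon * Q) * f' = (mon * Q') * f" unfolding a(3) b(3) by (simp only: mult_ac)
    then have "eval_at ((mon * Q) * f') x = eval_at ((mon * Q') * f) x" by (rule arg_cong)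
    then have "eval_at (mon * Q) x * eval_at f' x = eval_at (mon * Q') x * eval_at f x"
      by (simp only: m[OF a(4) b(1)] m[OF b(4) a(1)])
    then show ?thesis by (simp only: frac_eq_eq[OF a(2) b(2)])
  qed
  \<comment> \<open>By \<open>ratio_unique\<close> the choice of the good pair does not matter, so
    \<open>\<phi>\<close> is \<open>mon / F\<close> as a function on \<open>V\<close>.\<close>
  define \<phi> where "\<phi> = (\<lambda>x. SOME c. \<exists>f Q. good x f Q \<and> c = eval_at (mon * Q) x / eval_at f x)"
  have \<phi>: "\<phi> x = eval_at (mon * Q) x / eval_at f x" if "x \<in> X" "good x f Q" for x f Q
  proof -
    have "\<exists>f Q. good x f Q \<and> \<phi> x = eval_at (mon * Q) x / eval_at f x"
      unfolding \<phi>_def by (rule someI_ex) (use that(2) in blast)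
    then obtain f' Q' where "good x f' Q'" "\<phi> x = eval_at (mon * Q') x / eval_at f' x" by blast
    then show ?thesis using ratio_unique[OF that(1) _ that(2)] by simp
  qed
  have reg\<phi>: "regular_on \<Sigma> V \<phi>" unfolding regular_on_def
  proof
    fix x assume x: "x \<in> V"
    then have xX: "x \<in> X" by (simp add: V_def)
    obtain f Q where fQ: "good x f Q" "{y \<in> chart \<Sigma> (fst x). eval_at f y \<noteq> 0} \<subseteq> V" using good_ex[OF x] by blast
    have f: "f \<in> coord_ring (fst x)" "mon * Q \<in> coord_ring (fst x)" using fQ(1) by (auto simp: good_def)
    let ?W = "{y \<in> chart \<Sigma> (fst x). eval_at f y \<noteq> 0}"
    have "\<phi> y = eval_at (mon * Q) y / eval_at f y" if y: "y \<in> ?W" for y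
    proof (rule \<phi>)
      show "y \<in> X" using y by (simp add: mem_chart)
      have "fst y \<subseteq> fst x" using y chart_subset by blast
      then show "good y f Q" using fQ(1) y coord_ring_antimono unfolding good_def by blast
    qed
    moreover have "zariski_open \<Sigma> ?W" by (rule principal_open[OF toric_varietyD(1)[OF xX] f(1)])
    moreover have "eval_at f x \<noteq> 0" using fQ(1) unfolding good_def by blast
    then have "x \<in> ?W" using mem_own_chart[OF xX] by blast
    moreover note \<open>x \<in> ?W\<close>
    moreover have "?W \<subseteq> V \<inter> chart \<Sigma> (fst x)" using fQ(2) by blast
    moreover have "\<forall>y\<in>?W. eval_at f y \<noteq> 0 \<and> \<phi> y = eval_at (mon * Q) y / eval_at f y"
      using calculation(1) by blast
    ultimately show "\<exists>\<sigma>\<in>\<Sigma>. \<exists>W. zariski_open \<Sigma> W \<and> x \<in> W \<and> W \<subseteq> V \<inter> chart \<Sigma> \<sigma> \<and>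
        (\<exists>f\<in>coord_ring \<sigma>. \<exists>h\<in>coord_ring \<sigma>. \<forall>y\<in>W. eval_at h y \<noteq> 0 \<and> \<phi> y = eval_at f y / eval_at h y)"
      by (intro bexI[OF _ toric_varietyD(1)[OF xX]] exI[of _ ?W] conjI bexI[OF _ f(1)] bexI[OF _ f(2)])
  qed
  define \<psi> where "\<psi> = \<phi> \<circ> g"
  have O_sub: "codim1_part j \<subseteq> g -` V \<inter> X"
    using codim1_in_X inverse(1) endoD(1)[OF endo(1)] by (auto simp: V_def subset_iff)
  have reg\<psi>: "regular_on \<Sigma> (codim1_part j) \<psi>" unfolding \<psi>_def
    by (rule regular_on_subset[OF endoD(3)[OF endo(1) V reg\<phi>] codim1_part_open O_sub])
  \<comment> \<open>Bundles the data of a germ so that they can be chosen for all points at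
    once.\<close>
  define rep where "rep = (\<lambda>x \<sigma> N Q G. x \<in> chart \<Sigma> \<sigma> \<and> N \<in> coord_ring \<sigma> \<and> Q \<in> coord_ring \<sigma> \<and>
      eval_at Q x \<noteq> 0 \<and> G \<noteq> 0 \<and>
      (\<forall>\<gamma>. character \<gamma> \<longrightarrow> ev \<gamma> G \<noteq> 0 \<longrightarrow> ev \<gamma> Q \<noteq> 0 \<and> \<psi> ({0}, \<gamma>) = ev \<gamma> N / ev \<gamma> Q))"
  have "\<exists>\<sigma> N Q G. rep x \<sigma> N Q G" if x: "x \<in> codim1_part j" for x
    using reg\<psi> x
  proof (rule regular_germ)
    fix \<sigma> A B G
    assume "x \<in> chart \<Sigma> \<sigma>" "A \<in> coord_ring \<sigma>" "B \<in> coord_ring \<sigma>" "eval_at B x \<noteq> 0" "G \<noteq> 0"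
      "\<forall>\<gamma>. character \<gamma> \<longrightarrow> ev \<gamma> G \<noteq> 0 \<longrightarrow> ({0}, \<gamma>) \<in> codim1_part j \<and> ev \<gamma> B \<noteq> 0 \<and>
        \<psi> ({0}, \<gamma>) = ev \<gamma> A / ev \<gamma> B"
    then have "rep x \<sigma> A B G" unfolding rep_def by simp
    then show ?thesis by blast
  qed
  then have "\<forall>x. \<exists>\<sigma> N Q G. x \<in> codim1_part j \<longrightarrow> rep x \<sigma> N Q G" by blast
  then obtain \<sigma> N Q G where rep: "\<And>x. x \<in> codim1_part j \<Longrightarrow> rep x (\<sigma> x) (N x) (Q x) (G x)"
    by metis
  have NQ: "x \<in> chart \<Sigma> (\<sigma> x)" "N x \<in> coord_ring (\<sigma> x)" "Q x \<in> coord_ring (\<sigma> x)"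
    "eval_at (Q x) x \<noteq> 0" "G x \<noteq> 0"
    "\<And>\<gamma>. character \<gamma> \<Longrightarrow> ev \<gamma> (G x) \<noteq> 0 \<Longrightarrow>
      ev \<gamma> (Q x) \<noteq> 0 \<and> \<psi> ({0}, \<gamma>) = ev \<gamma> (N x) / ev \<gamma> (Q x)"
    if "x \<in> codim1_part j" for x
    using rep[OF that] unfolding rep_def by simp_all
  have "\<exists>\<Psi>. \<forall>x\<in>codim1_part j. N x = \<Psi> * Q x"
  proof (rule regular_everywhere_imp_laurent)
    fix x x' assume x: "x \<in> codim1_part j" "x' \<in> codim1_part j"
    show "N x * Q x' = N x' * Q x"
    proof (rule laurent_eq_generic)
      show "G x * G x' \<noteq> 0" using NQ(5) x by (simp add: laurent_no_zero_divisors)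
      fix \<gamma> assume \<gamma>: "character \<gamma>" "ev \<gamma> (G x * G x') \<noteq> 0"
      then have nz: "ev \<gamma> (G x) \<noteq> 0" "ev \<gamma> (G x') \<noteq> 0" by (auto simp: ev_mult_char)
      have 1: "ev \<gamma> (Q x) \<noteq> 0 \<and> \<psi> ({0}, \<gamma>) = ev \<gamma> (N x) / ev \<gamma> (Q x)" by (rule NQ(6)[OF x(1) \<gamma>(1) nz(1)])
      have 2: "ev \<gamma> (Q x') \<noteq> 0 \<and> \<psi> ({0}, \<gamma>) = ev \<gamma> (N x') / ev \<gamma> (Q x')" by (rule NQ(6)[OF x(2) \<gamma>(1) nz(2)])
      have "ev \<gamma> (N x) / ev \<gamma> (Q x) = ev \<gamma> (N x') / ev \<gamma> (Q x')" using 1 2 by simp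
      then show "ev \<gamma> (N x * Q x') = ev \<gamma> (N x' * Q x)"
        using 1 2 by (simp add: ev_mult_char[OF \<gamma>(1)] frac_eq_eq)
    qed
  next
    fix \<gamma> :: "int^'n \<Rightarrow> 'k" assume \<gamma>: "character \<gamma>"
    have "({0}, \<gamma>) \<in> codim1_part j" using torus_char[OF \<gamma>] T_in_codim1 by blast
    then show "\<exists>i\<in>codim1_part j. ev \<gamma> (Q i) \<noteq> 0" using NQ(4) by (force simp: eval_torus[OF \<gamma>])
  qed
  then obtain \<Psi> where \<Psi>: "\<And>x. x \<in> codim1_part j \<Longrightarrow> N x = \<Psi> * Q x" by blast
  \<comment> \<open>At a point of the orbit of \<open>\<rho>'\<close> the denominator is nonzero, so
    it has an exponent perpendicular to \<open>\<rho>'\<close> and its least weight is at most 0.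
    The least weights of \<open>\<Psi>\<close> and of the denominator add up to the weight of an
    exponent of the numerator, which is at least 0.\<close>
  have keys\<Psi>: "pairing m \<rho>' \<ge> (0::int)"
    if \<rho>': "\<rho>' \<in> rays \<Sigma>" "\<rho>' \<noteq> - e j" and m: "m \<in> Poly_Mapping.keys \<Psi>" for \<rho>' m
  proof -
    let ?\<tau> = "convex_cone hull {rvec \<rho>'}"
    let ?x = "orbit_point ?\<tau> one_char"
    have \<tau>: "?\<tau> \<in> \<Sigma>" using \<rho>'(1) by (simp add: rays_def)
    have "?x \<in> chart \<Sigma> ?\<tau>"
      using orbit_point_in[OF \<tau> one_char] face_refl[OF \<tau>] by (simp add: mem_chart orbit_point_def)
    then have x: "?x \<in> codim1_part j" unfolding codim1_part_def using \<rho>' by blast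
    have "fst ?x \<subseteq> \<sigma> ?x" by (rule chart_subset[OF NQ(1)[OF x]])
    moreover have "rvec \<rho>' \<in> fst ?x" by (simp add: orbit_point_def hull_inc)
    ultimately have in': "rvec \<rho>' \<in> \<sigma> ?x" by blast
    have \<Psi>0: "\<Psi> \<noteq> 0" using m by auto
    have Q0: "Q ?x \<noteq> 0" using NQ(4)[OF x] by (auto simp: eval_at_ev)
    obtain m' q k where *: "k \<in> Poly_Mapping.keys (\<Psi> * Q ?x)" "rvec k \<bullet> rvec \<rho>' = rvec m' \<bullet> rvec \<rho>' + rvec q \<bullet> rvec \<rho>'"
      "\<And>m. m \<in> Poly_Mapping.keys \<Psi> \<Longrightarrow> rvec m' \<bullet> rvec \<rho>' \<le> rvec m \<bullet> rvec \<rho>'"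
      "\<And>m. m \<in> Poly_Mapping.keys (Q ?x) \<Longrightarrow> rvec q \<bullet> rvec \<rho>' \<le> rvec m \<bullet> rvec \<rho>'"
      by (rule initial_exponents[where l = "\<lambda>m. rvec m \<bullet> rvec \<rho>'", OF \<Psi>0 Q0 rvec_add_inner]) (rule that; blast)
    have k: "rvec k \<bullet> rvec \<rho>' \<ge> 0"
      using NQ(2)[OF x] *(1) in' unfolding \<Psi>[OF x] coord_ring_def dual_lattice_points_def by blast
    have "restr (perp_lattice_points ?\<tau>) (Q ?x) \<noteq> 0" using NQ(4)[OF x] by (auto simp: eval_orbit_point)
    then have "Poly_Mapping.keys (Q ?x) \<inter> perp_lattice_points ?\<tau> \<noteq> {}"
      unfolding keys_restr[symmetric] by simp
    then obtain q' where "q' \<in> Poly_Mapping.keys (Q ?x)" "pairing q' \<rho>' = (0::int)" by (auto simp: perp_ray)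
    then have "rvec q \<bullet> rvec \<rho>' \<le> 0" using *(4)[of q'] by (simp add: rvec_inner)
    then have "rvec m \<bullet> rvec \<rho>' \<ge> 0" using k *(2) *(3)[OF m] by linarith
    then show ?thesis by (simp add: rvec_inner)
  qed
  \<comment> \<open>\<open>F'\<close> is \<open>F / mon\<close>, the inverse of the function above.
    It vanishes at \<open>y0\<close>, so its pullback under \<open>g\<close> vanishes at
    \<open>x0\<close>, and the product of this pullback with \<open>\<Psi>\<close> is 1.\<close>
  define F' where "F' = F * Poly_Mapping.single (- m0) 1"
  let ?V' = "g -` T \<inter> X"
  have "regular_on \<Sigma> T (eval_at F')"
    using regular_eval[OF torus_open zero_cone] by (simp add: torus_eq_chart coord_ring_zero_cone)
  then have regF: "regular_on \<Sigma> ?V' (eval_at F' \<circ> g)" by (rule endoD(3)[OF endo(1) torus_open])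
  have "x0 \<in> ?V'" using x0 moved y0 by simp
  with regF obtain \<sigma>1 A1 B1 G1 where "\<sigma>1 \<in> \<Sigma>" and AB: "x0 \<in> chart \<Sigma> \<sigma>1"
    "A1 \<in> coord_ring \<sigma>1" and "B1 \<in> coord_ring \<sigma>1" and AB': "eval_at B1 x0 \<noteq> 0"
    "(eval_at F' \<circ> g) x0 = eval_at A1 x0 / eval_at B1 x0" "G1 \<noteq> 0"
    "\<forall>\<gamma>. character \<gamma> \<longrightarrow> ev \<gamma> G1 \<noteq> 0 \<longrightarrow>
      ({0}, \<gamma>) \<in> ?V' \<and> ev \<gamma> B1 \<noteq> 0 \<and> (eval_at F' \<circ> g) ({0}, \<gamma>) = ev \<gamma> A1 / ev \<gamma> B1"
    by (rule regular_germ) (rule that, assumption+)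
  note AB = AB AB'
  have "\<sigma>0 \<subseteq> \<sigma>1" using chart_subset[OF AB(1)] x0(2) by simp
  then have A1: "A1 \<in> coord_ring \<sigma>0" using AB(2) coord_ring_antimono by blast
  have "eval_at F' y0 = 0" using F(2) by (simp add: eval_torus[OF one_char] F'_def ev_mult_char[OF one_char])
  then have A10: "Poly_Mapping.lookup A1 0 = 0" using AB(3,4) by (simp add: moved eval_x0)
  have y0_O: "y0 \<in> codim1_part j" using y0 T_in_codim1 by blast
  have "\<Psi> * A1 = B1"
  proof (rule laurent_eq_generic)
    show "G1 * G y0 \<noteq> 0" using NQ(5)[OF y0_O] AB(5) by (simp add: laurent_no_zero_divisors)
    fix \<gamma> assume \<gamma>: "character \<gamma>" "ev \<gamma> (G1 * G y0) \<noteq> 0"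
    then have nz: "ev \<gamma> G1 \<noteq> 0" "ev \<gamma> (G y0) \<noteq> 0" by (auto simp: ev_mult_char)
    let ?t = "({0}, \<gamma>) :: ('n, 'k) tpoint"
    have t: "?t \<in> codim1_part j" using torus_char[OF \<gamma>(1)] T_in_codim1 by blast
    have gt: "g ?t \<in> V" "g ?t \<in> T" using O_sub t AB(6)[rule_format, OF \<gamma>(1) nz(1)] by blast+
    obtain \<gamma>' where \<gamma>': "g ?t = ({0}, \<gamma>')" "character \<gamma>'" using gt(2) by (rule torusE)
    obtain f q where fq: "good (g ?t) f q" using good_ex[OF gt(1)] by blast
    have fF: "f = F * q" and fnz: "eval_at f (g ?t) \<noteq> 0" using fq unfolding good_def by blast+
    have evf: "ev \<gamma>' f = ev \<gamma>' F * ev \<gamma>' q" unfolding fF by (rule ev_mult_char[OF \<gamma>'(2)])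
    then have "ev \<gamma>' F * ev \<gamma>' q \<noteq> 0" using fnz \<gamma>' by (simp add: eval_torus)
    moreover have "\<gamma>' m0 * \<gamma>' (- m0) = 1" using characterD(2)[OF \<gamma>'(2), of m0 "- m0"] characterD(1)[OF \<gamma>'(2)] by simp
    moreover have "\<phi> (g ?t) = ev \<gamma>' (mon * q) / ev \<gamma>' f"
      using \<phi>[OF _ fq] gt(2) T_subset \<gamma>' by (auto simp: eval_torus)
    then have "\<phi> (g ?t) = (\<gamma>' m0 * ev \<gamma>' q) / (ev \<gamma>' F * ev \<gamma>' q)"
      unfolding evf using \<gamma>'(2) by (simp add: mon_def ev_mult_char)
    moreover have "eval_at F' (g ?t) = ev \<gamma>' F * \<gamma>' (- m0)"
      using \<gamma>' by (simp add: F'_def eval_torus ev_mult_char)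
    ultimately have prod: "\<psi> ?t * eval_at F' (g ?t) = 1"
    proof -
      assume *: "ev \<gamma>' F * ev \<gamma>' q \<noteq> 0" "\<gamma>' m0 * \<gamma>' (- m0) = 1"
        "\<phi> (g ?t) = (\<gamma>' m0 * ev \<gamma>' q) / (ev \<gamma>' F * ev \<gamma>' q)" "eval_at F' (g ?t) = ev \<gamma>' F * \<gamma>' (- m0)"
      have cancel: "(a * q) / (F * q) * (F * b) = a * b" if "F * q \<noteq> 0" for a b F q :: 'k
        using that by (simp add: field_simps)
      show ?thesis unfolding \<psi>_def comp_apply *(3,4) cancel[OF *(1)] by (rule *(2))
    qed
    have "ev \<gamma> (Q y0) \<noteq> 0" "\<psi> ?t = ev \<gamma> (N y0) / ev \<gamma> (Q y0)" using NQ(6)[OF y0_O \<gamma>(1) nz(2)] by auto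
    then have "\<psi> ?t = ev \<gamma> \<Psi>" unfolding \<Psi>[OF y0_O] by (simp add: ev_mult_char[OF \<gamma>(1)])
    moreover have "ev \<gamma> B1 \<noteq> 0" "eval_at F' (g ?t) = ev \<gamma> A1 / ev \<gamma> B1" using AB(6)[rule_format, OF \<gamma>(1) nz(1)] by auto
    ultimately show "ev \<gamma> (\<Psi> * A1) = ev \<gamma> B1" using prod by (simp add: ev_mult_char[OF \<gamma>(1)])
  qed
  \<comment> \<open>\<open>B1\<close> is nonzero at \<open>x0\<close>, that is, it has a constant
    coefficient; so some exponents of \<open>\<Psi>\<close> and \<open>A1\<close> are opposite, and
    they are nonzero because \<open>A1\<close> has no constant coefficient.\<close>
  then have "0 \<in> Poly_Mapping.keys (\<Psi> * A1)" using AB(3) by (simp add: eval_x0 in_keys_iff)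
  then obtain m1 m2 where m: "m1 \<in> Poly_Mapping.keys \<Psi>" "m2 \<in> Poly_Mapping.keys A1" "0 = m1 + m2"
    using keys_mult[of \<Psi> A1] by blast
  have m1: "m1 = - m2" using m(3) by (simp add: eq_neg_iff_add_eq_0)
  have m2le: "pairing m2 (e i) \<le> (0::int)" for i
    using A1 m(2) dual_basis_cone[of m2 e] by (auto simp: coord_ring_def)
  have "m2 \<noteq> 0" using m(2) A10 by (auto simp: in_keys_iff)
  \<comment> \<open>\<open>m1 = - m2\<close> pairs nonnegatively with \<open>e i\<close> since
    \<open>m2\<close> lies in the dual of \<open>\<sigma>0\<close>, and nonpositively since
    \<open>- e i\<close> is a ray other than \<open>- e j\<close>.\<close>
  have zero: "pairing m1 (e i) = (0::int)" if "i \<noteq> j" for i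
  proof -
    have "- e i \<noteq> - e j" using that lattice_basis_inj[OF basis] by (auto simp: inj_eq)
    then have "pairing m1 (- e i) \<ge> (0::int)" using keys\<Psi>[OF basis_vector_ray[OF fan basis \<sigma>0] _ m(1)] by blast
    then show ?thesis using m2le[of i] by (simp add: m1 pairing_uminus_left pairing_uminus_right)
  qed
  define b where "b = (pairing m1 (e j) :: int)"
  have "b \<ge> 0" using m2le[of j] by (simp add: b_def m1 pairing_uminus_left)
  moreover have "b \<noteq> 0"
  proof
    assume "b = 0"
    then have "pairing m1 (e i) = (0::int)" for i using zero[of i] by (cases "i = j") (auto simp: b_def)
    then have "m1 = 0" using lattice_point_eqI[OF basis, of m1 0] by simp
    then show False using \<open>m2 \<noteq> 0\<close> m1 by simp
  qed
  moreover have "pairing m1 \<rho> = b * pairing (dual_basis e j) \<rho>"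
  proof -
    have "pairing m1 \<rho> = (\<Sum>i\<in>UNIV. pairing m1 (e i) * pairing (dual_basis e i) \<rho>)"
      using pairing_expand[OF basis, of m1 \<rho>] by simp
    also have "\<dots> = (\<Sum>i\<in>UNIV. if i = j then b * pairing (dual_basis e j) \<rho> else 0)"
      using zero by (intro sum.cong) (auto simp: b_def)
    finally show ?thesis by simp
  qed
  moreover have "pairing m1 \<rho> \<ge> (0::int)" by (rule keys\<Psi>[OF \<rho> m(1)])
  ultimately show ?thesis by (simp add: zero_le_mult_iff)
qed

end

section \<open>Multiplicity and derivatives\<close>

interpretation alg: vector_space "alg_scale :: 'k::field \<Rightarrow> ((int^'n) \<Rightarrow>\<^sub>0 'k) \<Rightarrow> (int^'n) \<Rightarrow>\<^sub>0 'k"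
  by (rule vector_space_alg_scale)

lemma alg_scale_mult_right: "f * alg_scale c s = alg_scale c (f * s)"
  by (simp add: alg_scale_def mult.left_commute)

lemma alg_scale_mult_left: "alg_scale c s * f = alg_scale c (s * f)"
  by (simp add: alg_scale_def mult.assoc)

lemma alg_scale_single: "alg_scale c (Poly_Mapping.single m b) = Poly_Mapping.single m (c * b)"
  by (simp add: alg_scale_def mult_single)

lemma lookup_alg_scale: "Poly_Mapping.lookup (alg_scale c f) m = c * Poly_Mapping.lookup f m"
  using lookup_times_single[of f 0 c m] by (simp add: alg_scale_def mult.commute)

lemma ev_alg_scale: "ev \<gamma> (alg_scale c f) = c * ev \<gamma> f"
proof -
  have "Poly_Mapping.keys (alg_scale c f) \<subseteq> Poly_Mapping.keys f"
    by (auto simp: in_keys_iff lookup_alg_scale)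
  then show ?thesis using ev_superset[OF finite_keys, of "alg_scale c f" f \<gamma>]
    by (simp add: lookup_alg_scale ev_def sum_distrib_left mult.assoc)
qed

section \<open>Powers of the maximal ideal of a torus point\<close>

text \<open>The recursion copies \<open>mult_sections\<close> with the whole ring as start, so that
  the two agree at points of the torus.\<close>

definition ideal_power :: "(int^'n \<Rightarrow> 'k::field) \<Rightarrow> nat \<Rightarrow> ((int^'n) \<Rightarrow>\<^sub>0 'k) set" where
  "ideal_power \<gamma> \<mu> = rec_nat UNIV (\<lambda>_ J. alg.span {f * s | f s. ev \<gamma> f = 0 \<and> s \<in> J}) \<mu>"

lemma ideal_power_simps:
  "ideal_power \<gamma> 0 = UNIV"
  "ideal_power \<gamma> (Suc \<mu>) = alg.span {f * s | f s. ev \<gamma> f = 0 \<and> s \<in> ideal_power \<gamma> \<mu>}"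
  by (simp_all add: ideal_power_def)

lemma subspace_ideal_power: "alg.subspace (ideal_power \<gamma> \<mu>)"
  by (cases \<mu>) (simp_all add: ideal_power_simps)

lemma ideal_power_Suc_I: "ev \<gamma> f = 0 \<Longrightarrow> s \<in> ideal_power \<gamma> \<mu> \<Longrightarrow> f * s \<in> ideal_power \<gamma> (Suc \<mu>)"
  unfolding ideal_power_simps by (rule alg.span_base) blast

lemma ideal_power_Suc_subset:
  assumes "alg.subspace S" "\<And>f s. ev \<gamma> f = 0 \<Longrightarrow> s \<in> ideal_power \<gamma> \<mu> \<Longrightarrow> f * s \<in> S"
  shows "ideal_power \<gamma> (Suc \<mu>) \<subseteq> S"
  unfolding ideal_power_simps by (rule alg.span_minimal) (use assms in auto)

lemma subspace_mult_preimage: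
  assumes "alg.subspace S"
  shows "alg.subspace {u. u * s \<in> S}"
  using assms unfolding alg.subspace_def
  by (auto simp: distrib_right alg_scale_mult_left)

text \<open>The powers are spans over the field; they are ideals because a multiplier can be
  absorbed into the factor that vanishes at the point.\<close>

lemma ideal_power_mult:
  assumes \<gamma>: "character \<gamma>" and "u \<in> ideal_power \<gamma> \<nu>" "s \<in> ideal_power \<gamma> \<mu>"
  shows "u * s \<in> ideal_power \<gamma> (\<nu> + \<mu>)"
proof -
  have ideal: "u * s \<in> ideal_power \<gamma> \<mu>" if "s \<in> ideal_power \<gamma> \<mu>" for u s \<mu>
  proof (cases \<mu>)
    case (Suc \<mu>')
    have "ideal_power \<gamma> (Suc \<mu>') \<subseteq> {s. s * u \<in> ideal_power \<gamma> (Suc \<mu>')}"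
    proof (rule ideal_power_Suc_subset[OF subspace_mult_preimage[OF subspace_ideal_power]])
      fix f s assume "ev \<gamma> f = 0" "s \<in> ideal_power \<gamma> \<mu>'"
      then have "(f * u) * s \<in> ideal_power \<gamma> (Suc \<mu>')"
        by (intro ideal_power_Suc_I) (simp_all add: ev_mult_char[OF \<gamma>])
      then show "f * s \<in> {s. s * u \<in> ideal_power \<gamma> (Suc \<mu>')}" by (simp add: mult_ac)
    qed
    then show ?thesis using that Suc by (auto simp: mult.commute)
  qed (simp add: ideal_power_simps)
  show ?thesis using assms(2)
  proof (induction \<nu> arbitrary: u)
    case 0
    then show ?case using ideal[OF assms(3)] by simp
  next
    case (Suc \<nu>)
    have "ideal_power \<gamma> (Suc \<nu>) \<subseteq> {u. u * s \<in> ideal_power \<gamma> (Suc \<nu> + \<mu>)}"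
    proof (rule ideal_power_Suc_subset[OF subspace_mult_preimage[OF subspace_ideal_power]])
      fix f t assume "ev \<gamma> f = 0" "t \<in> ideal_power \<gamma> \<nu>"
      then have "f * (t * s) \<in> ideal_power \<gamma> (Suc (\<nu> + \<mu>))"
        using Suc.IH by (intro ideal_power_Suc_I) auto
      then show "f * t \<in> {u. u * s \<in> ideal_power \<gamma> (Suc \<nu> + \<mu>)}" by (simp add: mult.assoc)
    qed
    then show ?case using Suc.prems by blast
  qed
qed

lemma point_mem_ideal_power_1: "ev \<gamma> f = 0 \<Longrightarrow> f \<in> ideal_power \<gamma> 1"
  using ideal_power_Suc_I[of \<gamma> f 1 0] by (simp add: ideal_power_simps)

text \<open>The zero cone contains no ray, so all Laurent polynomials are sections on its chart,
  whatever \<open>d\<close> is.\<close>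

lemma mult_sections_torus:
  assumes "character \<gamma>"
  shows "mult_sections \<Sigma> d ({0}, \<gamma>) \<mu> = ideal_power \<gamma> \<mu>"
proof (induction \<mu>)
  case 0
  have "cone_rays \<Sigma> {0} = {}"
    using primitive_nonzero by (auto simp: cone_rays_def rays_def rvec_eq_0)
  then show ?case by (auto simp: chart_sections_def ideal_power_simps)
next
  case (Suc \<mu>)
  have "point_ideal ({0}, \<gamma>) = {f. ev \<gamma> f = 0}"
    by (simp add: point_ideal_def coord_ring_zero_cone eval_at_ev)
  then show ?case using Suc by (simp add: ideal_power_simps)
qed

section \<open>Euler derivations and jets\<close>

text \<open>For additive \<open>l\<close> this is a derivation with the characters as eigenvectors;
  if \<open>l\<close> is the exponent of a coordinate, it is that coordinate times the partial
  derivative.\<close>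

definition euler :: "('m \<Rightarrow> int) \<Rightarrow> ('m \<Rightarrow>\<^sub>0 'k::comm_ring_1) \<Rightarrow> 'm \<Rightarrow>\<^sub>0 'k" where
  "euler l f = Poly_Mapping.mapp (\<lambda>m c. of_int (l m) * c) f"

lemma lookup_euler: "Poly_Mapping.lookup (euler l f) m = of_int (l m) * Poly_Mapping.lookup f m"
  by (simp add: euler_def lookup_mapp when_def in_keys_iff)

lemma keys_euler: "Poly_Mapping.keys (euler l f) \<subseteq> Poly_Mapping.keys f"
  by (auto simp: in_keys_iff lookup_euler)

lemma euler_add: "euler l (f + g) = euler l f + euler l g"
  by (rule poly_mapping_eqI) (simp add: lookup_euler lookup_add distrib_left)

lemma euler_sum: "euler l (sum f A) = (\<Sum>x\<in>A. euler l (f x))"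
  by (rule poly_mapping_eqI) (simp add: lookup_euler lookup_sum sum_distrib_left)

lemma euler_single: "euler l (Poly_Mapping.single m c) = Poly_Mapping.single m (of_int (l m) * c)"
  by (rule poly_mapping_eqI) (simp add: lookup_euler lookup_single when_def)

lemma euler_scale: "euler l (alg_scale c f) = alg_scale c (euler l f)"
  by (rule poly_mapping_eqI) (simp add: lookup_euler lookup_alg_scale mult.left_commute)

lemma times_expand_superset:
  fixes f g :: "'m::monoid_add \<Rightarrow>\<^sub>0 'k::semiring_0"
  assumes "finite A" "Poly_Mapping.keys f \<subseteq> A" "finite B" "Poly_Mapping.keys g \<subseteq> B"
  shows "f * g = (\<Sum>m\<in>A. \<Sum>m'\<in>B.
      Poly_Mapping.single (m + m') (Poly_Mapping.lookup f m * Poly_Mapping.lookup g m'))"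
proof -
  have "f * g = (\<Sum>m\<in>A. Poly_Mapping.single m (Poly_Mapping.lookup f m))
      * (\<Sum>m\<in>B. Poly_Mapping.single m (Poly_Mapping.lookup g m))"
    using poly_mapping_expand[OF assms(1,2)] poly_mapping_expand[OF assms(3,4)] by simp
  then show ?thesis by (simp add: sum_product mult_single)
qed

lemma euler_mult:
  fixes f g :: "'m::monoid_add \<Rightarrow>\<^sub>0 'k::comm_ring_1"
  assumes "\<And>m m'. l (m + m') = l m + l m'"
  shows "euler l (f * g) = euler l f * g + f * euler l g"
proof -
  let ?s = "\<lambda>m m' c. Poly_Mapping.single (m + m') (c :: 'k)"
  let ?K = "Poly_Mapping.keys"
  have "euler l (f * g) = (\<Sum>m\<in>?K f. \<Sum>m'\<in>?K g.
      ?s m m' (Poly_Mapping.lookup (euler l f) m * Poly_Mapping.lookup g m')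
      + ?s m m' (Poly_Mapping.lookup f m * Poly_Mapping.lookup (euler l g) m'))"
    unfolding times_expand euler_sum euler_single assms
    by (intro sum.cong refl) (simp add: lookup_euler algebra_simps flip: single_add)
  also have "\<dots> = euler l f * g + f * euler l g"
    using times_expand_superset[OF finite_keys keys_euler finite_keys subset_refl, of l f g]
      times_expand_superset[OF finite_keys subset_refl finite_keys keys_euler, of f l g]
    by (simp add: sum.distrib)
  finally show ?thesis .
qed

text \<open>The Euler derivations are invertible multiples of the partial derivatives on the torus.\<close>

locale torus_coordinates =
  fixes e :: "'n \<Rightarrow> int^'n" and \<gamma> :: "int^'n \<Rightarrow> 'k::field_char_0"
  assumes basis: "lattice_basis e" and char: "character \<gamma>"
begin

text \<open>The \<open>j\<close>-th coordinate is the character of \<open>- dual_basis e j\<close>,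
  so this is its exponent in \<open>\<chi>\<^sup>m\<close>.\<close>

definition expo :: "'n \<Rightarrow> int^'n \<Rightarrow> int" where
  "expo j m = - pairing m (e j)"

abbreviation "\<theta> j \<equiv> euler (expo j) :: ((int^'n) \<Rightarrow>\<^sub>0 'k) \<Rightarrow> _"

lemma expo_add: "expo j (m + m') = expo j m + expo j m'"
  by (simp add: expo_def pairing_add_left)

lemma \<theta>_mult: "\<theta> j (f * g) = \<theta> j f * g + f * \<theta> j g"
  by (rule euler_mult) (rule expo_add)

text \<open>The functions whose iterated Euler derivatives of order less than \<open>\<mu>\<close>
  all vanish at the point.\<close>

primrec jet :: "nat \<Rightarrow> ((int^'n) \<Rightarrow>\<^sub>0 'k) set" where
  "jet 0 = UNIV"
| "jet (Suc \<mu>) = {s. ev \<gamma> s = 0 \<and> (\<forall>j. \<theta> j s \<in> jet \<mu>)}"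

lemma subspace_jet: "alg.subspace (jet \<mu>)"
proof (induction \<mu>)
  case (Suc \<mu>)
  have z: "\<theta> j 0 = 0" for j by (rule poly_mapping_eqI) (simp add: lookup_euler)
  show ?case using Suc unfolding alg.subspace_def
    by (auto simp: ev_add ev_alg_scale euler_add euler_scale z)
qed simp

lemma jet_mono: "jet (Suc \<mu>) \<subseteq> jet \<mu>"
  by (induction \<mu>) auto

lemma jet_ideal: "s \<in> jet \<mu> \<Longrightarrow> r * s \<in> jet \<mu>"
proof (induction \<mu> arbitrary: r s)
  case (Suc \<mu>)
  have "s \<in> jet \<mu>" using Suc.prems jet_mono by blast
  then have "\<theta> j (r * s) \<in> jet \<mu>" for j
    unfolding \<theta>_mult using Suc by (intro alg.subspace_add[OF subspace_jet]) auto
  then show ?case using Suc.prems by (simp add: ev_mult_char[OF char])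
qed simp

text \<open>By the Leibniz rule the derivative of \<open>f * s\<close> has two terms:
  \<open>\<theta> j f * s\<close> keeps the order of \<open>s\<close>, and in
  \<open>f * \<theta> j s\<close> the factor \<open>f\<close> regains, by induction, the order that
  the derivation loses.\<close>

lemma jet_mult: "ev \<gamma> f = 0 \<Longrightarrow> s \<in> jet \<mu> \<Longrightarrow> f * s \<in> jet (Suc \<mu>)"
proof (induction \<mu> arbitrary: s)
  case 0
  then show ?case by (simp add: ev_mult_char[OF char])
next
  case (Suc \<mu>)
  have "\<theta> j (f * s) \<in> jet (Suc \<mu>)" for j unfolding \<theta>_mult
    using Suc jet_ideal[OF Suc.prems(2), of "\<theta> j f"]
    by (intro alg.subspace_add[OF subspace_jet]) auto
  then show ?case using Suc.prems by (simp add: ev_mult_char[OF char])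
qed

lemma ideal_power_subset_jet: "ideal_power \<gamma> \<mu> \<subseteq> jet \<mu>"
proof (induction \<mu>)
  case (Suc \<mu>)
  show ?case by (rule ideal_power_Suc_subset[OF subspace_jet]) (use Suc jet_mult in blast)
qed simp

section \<open>Euler's formula modulo powers of the maximal ideal\<close>

text \<open>The character of \<open>m\<close>, normalized to the value 1 at the point, minus 1.
  These functions span the maximal ideal.\<close>

definition unif :: "int^'n \<Rightarrow> (int^'n) \<Rightarrow>\<^sub>0 'k" where
  "unif m = Poly_Mapping.single m (inverse (\<gamma> m)) - 1"

definition t :: "'n \<Rightarrow> (int^'n) \<Rightarrow>\<^sub>0 'k" where
  "t j = unif (- dual_basis e j)"

text \<open>The linear part of \<open>unif m\<close> in the local parameters
  \<open>t j\<close>.\<close>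

definition lin :: "int^'n \<Rightarrow> (int^'n) \<Rightarrow>\<^sub>0 'k" where
  "lin m = (\<Sum>j\<in>UNIV. alg_scale (of_int (expo j m)) (t j))"

text \<open>To leading order, the Euler vector field centred at the point: on the power
  \<open>\<mu>\<close> of the maximal ideal modulo the next one it is multiplication by
  \<open>\<mu>\<close>.\<close>

definition E :: "((int^'n) \<Rightarrow>\<^sub>0 'k) \<Rightarrow> (int^'n) \<Rightarrow>\<^sub>0 'k" where
  "E s = (\<Sum>j\<in>UNIV. t j * \<theta> j s)"

lemma ev_unif: "ev \<gamma> (unif m) = 0"
  using character_nonzero[OF char, of m] by (simp add: unif_def ev_diff ev_one_char[OF char])

lemma ev_t: "ev \<gamma> (t j) = 0"
  by (simp add: t_def ev_unif)

lemma unif_add: "unif (m + m') = unif m + unif m' + unif m * unif m'"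
proof -
  have "Poly_Mapping.single (m + m') (inverse (\<gamma> (m + m')))
      = Poly_Mapping.single m (inverse (\<gamma> m)) * Poly_Mapping.single m' (inverse (\<gamma> m'))"
    by (simp add: mult_single characterD(2)[OF char] inverse_mult_distrib)
  then show ?thesis by (simp add: unif_def algebra_simps)
qed

lemma lin_add: "lin (m + m') = lin m + lin m'"
  by (simp add: lin_def expo_add alg.scale_left_distrib sum.distrib)

lemma lin_uminus: "lin (- m) = - lin m"
  using lin_add[of m "- m"] by (simp add: lin_def expo_def pairing_uminus_left sum_negf)

text \<open>Modulo the square of the maximal ideal \<open>unif\<close> is additive in
  \<open>m\<close>, as \<open>lin\<close> is exactly. So the \<open>m\<close> where they agree form
  a subgroup, and it contains the negatives of the dual basis, on which both equal
  \<open>t j\<close>.\<close>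

lemma unif_lin: "unif m - lin m \<in> ideal_power \<gamma> 2"
proof -
  note sub = subspace_ideal_power[of \<gamma> 2]
  define H where "H = {m. unif m - lin m \<in> ideal_power \<gamma> 2}"
  have uu: "unif m * unif m' \<in> ideal_power \<gamma> 2" for m m'
    using ideal_power_mult[OF char point_mem_ideal_power_1[OF ev_unif] point_mem_ideal_power_1[OF ev_unif]]
    by (simp add: numeral_2_eq_2)
  have add: "m + m' \<in> H" if "m \<in> H" "m' \<in> H" for m m'
  proof -
    have "unif (m + m') - lin (m + m') = (unif m - lin m) + (unif m' - lin m') + unif m * unif m'"
      by (simp add: unif_add lin_add)
    also have "\<dots> \<in> ideal_power \<gamma> 2"
      using that uu by (intro alg.subspace_add[OF sub]) (auto simp: H_def)
    finally show ?thesis by (simp add: H_def)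
  qed
  have zero: "0 \<in> H"
    using alg.subspace_0[OF sub] by (simp add: H_def unif_def characterD(1)[OF char] lin_def expo_def)
  have neg: "- m \<in> H" if "m \<in> H" for m
  proof -
    have "unif m + unif (- m) + unif m * unif (- m) = 0"
      using unif_add[of m "- m"] by (simp add: unif_def characterD(1)[OF char])
    then have "unif (- m) = - unif m - unif m * unif (- m)" by (simp add: eq_neg_iff_add_eq_0 algebra_simps)
    then have "unif (- m) - lin (- m) = - (unif m - lin m) - unif m * unif (- m)"
      by (simp add: lin_uminus)
    moreover have "- (unif m - lin m) \<in> ideal_power \<gamma> 2"
      using alg.subspace_neg[OF sub] that unfolding H_def by blast
    ultimately have "unif (- m) - lin (- m) \<in> ideal_power \<gamma> 2"
      using alg.subspace_diff[OF sub _ uu] by metis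
    then show ?thesis by (simp add: H_def)
  qed
  have nat_mult: "int n *s m \<in> H" if "m \<in> H" for n m
  proof (induction n)
    case (Suc n)
    have "int (Suc n) *s m = m + int n *s m" by (simp add: vec_eq_iff algebra_simps)
    then show ?case using add[OF that Suc] by simp
  qed (simp add: zero)
  have mult: "z *s m \<in> H" if "m \<in> H" for z m
  proof (cases "z \<ge> 0")
    case True
    then show ?thesis using nat_mult[OF that, of "nat z"] by simp
  next
    case False
    then have "z *s m = - (int (nat (- z)) *s m)" by (simp add: vec_eq_iff)
    then show ?thesis using neg[OF nat_mult[OF that, of "nat (- z)"]] by simp
  qed
  have gen: "- dual_basis e j \<in> H" for j
  proof -
    have "lin (- dual_basis e j) = (\<Sum>i\<in>UNIV. if i = j then t j else 0)"
      unfolding lin_def by (rule sum.cong)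
        (auto simp: expo_def pairing_uminus_left dual_basis_pairing[OF basis])
    then show ?thesis using alg.subspace_0[OF sub] by (simp add: H_def t_def)
  qed
  have "(\<Sum>j\<in>A. expo j m *s (- dual_basis e j)) \<in> H" for A
  proof (induction A rule: infinite_finite_induct)
    case (insert j A)
    show ?case unfolding sum.insert[OF insert(1,2)] by (rule add[OF mult[OF gen] insert(3)])
  qed (simp_all add: zero)
  moreover have "m = (\<Sum>j\<in>UNIV. expo j m *s (- dual_basis e j))"
    by (subst dual_basis_expand[OF basis, of m]) (simp add: expo_def vec_eq_iff)
  ultimately have "m \<in> H" by metis
  then show ?thesis by (simp add: H_def)
qed

lemma E_add: "E (f + g) = E f + E g"
  by (simp add: E_def euler_add distrib_left sum.distrib)

lemma E_scale: "E (alg_scale c f) = alg_scale c (E f)"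
  by (simp add: E_def euler_scale alg_scale_mult_right alg.scale_sum_right)

lemma E_0: "E 0 = 0"
  using E_scale[of 0 0] by simp

lemma E_sum: "E (sum f A) = (\<Sum>x\<in>A. E (f x))"
proof (induction A rule: infinite_finite_induct)
  case (insert x A)
  then show ?case by (simp add: E_add)
qed (simp_all add: E_0)

lemma E_mult: "E (f * g) = E f * g + f * E g"
  by (simp add: E_def \<theta>_mult distrib_left sum.distrib sum_distrib_left sum_distrib_right mult_ac)

text \<open>A function vanishing at the point is a combination of functions \<open>unif m\<close>,
  and \<open>E (unif m) = lin m * (unif m + 1)\<close>, which is \<open>unif m\<close> modulo the
  square of the maximal ideal.\<close>

lemma E_point:
  assumes "ev \<gamma> f = 0"
  shows "E f - f \<in> ideal_power \<gamma> 2"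
proof -
  note sub = subspace_ideal_power[of \<gamma> 2]
  have \<theta>1: "\<theta> j 1 = 0" for j
    using euler_single[of "expo j" 0 1] by (simp add: expo_def)
  have E1: "E 1 = 0" by (simp add: E_def \<theta>1)
  have Eunif: "E (unif m) - unif m \<in> ideal_power \<gamma> 2" for m
  proof -
    have s: "Poly_Mapping.single m (inverse (\<gamma> m)) = unif m + 1" by (simp add: unif_def)
    have "E (unif m) = E (unif m + 1)" by (simp add: E_add E1)
    also have "\<dots> = (\<Sum>j\<in>UNIV. t j * alg_scale (of_int (expo j m)) (unif m + 1))"
      unfolding E_def s[symmetric] by (simp add: euler_single alg_scale_single)
    also have "\<dots> = lin m * (unif m + 1)"
      by (simp add: lin_def sum_distrib_right alg_scale_mult_right alg_scale_mult_left)
    finally have "E (unif m) - unif m = lin m * unif m - (unif m - lin m)" by (simp add: algebra_simps)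
    moreover have "lin m \<in> ideal_power \<gamma> 1"
      unfolding lin_def by (intro alg.subspace_sum[OF subspace_ideal_power]
          alg.subspace_scale[OF subspace_ideal_power] point_mem_ideal_power_1 ev_t)
    then have "lin m * unif m \<in> ideal_power \<gamma> (1 + 1)"
      by (rule ideal_power_mult[OF char _ point_mem_ideal_power_1[OF ev_unif]])
    then have "lin m * unif m \<in> ideal_power \<gamma> 2" by (simp only: one_add_one)
    then have "lin m * unif m - (unif m - lin m) \<in> ideal_power \<gamma> 2"
      by (rule alg.subspace_diff[OF sub _ unif_lin])
    ultimately show ?thesis by (simp only:)
  qed
  have "f = (\<Sum>m\<in>Poly_Mapping.keys f. alg_scale (Poly_Mapping.lookup f m * \<gamma> m) (unif m + 1))"
    using poly_mapping_expand[of "Poly_Mapping.keys f" f] character_nonzero[OF char]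
    by (simp add: unif_def alg_scale_single mult.assoc)
  also have "\<dots> = (\<Sum>m\<in>Poly_Mapping.keys f. alg_scale (Poly_Mapping.lookup f m * \<gamma> m) (unif m))
      + alg_scale (ev \<gamma> f) 1"
    by (simp add: alg.scale_right_distrib sum.distrib ev_def alg.scale_sum_left)
  finally have f: "f = (\<Sum>m\<in>Poly_Mapping.keys f. alg_scale (Poly_Mapping.lookup f m * \<gamma> m) (unif m))"
    using assms by simp
  have "E f - f = (\<Sum>m\<in>Poly_Mapping.keys f. alg_scale (Poly_Mapping.lookup f m * \<gamma> m) (E (unif m) - unif m))"
  proof -
    have "E f = (\<Sum>m\<in>Poly_Mapping.keys f. alg_scale (Poly_Mapping.lookup f m * \<gamma> m) (E (unif m)))"
      using arg_cong[OF f, of E] unfolding E_sum E_scale .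
    from arg_cong2[OF this f, of "(-)"] show ?thesis
      by (simp only: alg.scale_right_diff_distrib sum_subtractf)
  qed
  also have "\<dots> \<in> ideal_power \<gamma> 2"
    by (intro alg.subspace_sum[OF sub] alg.subspace_scale[OF sub] Eunif)
  finally show ?thesis .
qed

text \<open>On a product \<open>f * s\<close> the Leibniz rule adds the eigenvalue 1 of
  \<open>f\<close> to the eigenvalue of \<open>s\<close>; the error terms fall into the next
  power.\<close>

lemma E_ideal_power:
  "s \<in> ideal_power \<gamma> \<mu> \<Longrightarrow> E s - alg_scale (of_nat \<mu>) s \<in> ideal_power \<gamma> (Suc \<mu>)"
proof (induction \<mu> arbitrary: s)
  case 0
  have "E s \<in> ideal_power \<gamma> (Suc 0)" unfolding E_def
    by (intro alg.subspace_sum[OF subspace_ideal_power] ideal_power_Suc_I ev_t) (simp add: ideal_power_simps)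
  then show ?case by simp
next
  case (Suc \<mu>)
  let ?S = "{s. E s - alg_scale (of_nat (Suc \<mu>)) s \<in> ideal_power \<gamma> (Suc (Suc \<mu>))}"
  have "ideal_power \<gamma> (Suc \<mu>) \<subseteq> ?S"
  proof (rule ideal_power_Suc_subset)
    note sub = subspace_ideal_power[of \<gamma> "Suc (Suc \<mu>)"]
    show "alg.subspace ?S" unfolding alg.subspace_def
    proof (intro conjI ballI allI)
      have "E 0 = 0" using E_scale[of 0 0] by simp
      then show "0 \<in> ?S" using alg.subspace_0[OF sub] by simp
      fix x assume x: "x \<in> ?S"
      show "alg_scale c x \<in> ?S" for c
      proof -
        have "E (alg_scale c x) - alg_scale (of_nat (Suc \<mu>)) (alg_scale c x)
            = alg_scale c (E x - alg_scale (of_nat (Suc \<mu>)) x)"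
          unfolding E_scale alg.scale_right_diff_distrib alg.scale_scale by (simp only: mult.commute)
        then show ?thesis using alg.subspace_scale[OF sub] x by simp
      qed
      fix y assume y: "y \<in> ?S"
      have "E (x + y) - alg_scale (of_nat (Suc \<mu>)) (x + y)
          = (E x - alg_scale (of_nat (Suc \<mu>)) x) + (E y - alg_scale (of_nat (Suc \<mu>)) y)"
        by (simp add: E_add alg.scale_right_distrib)
      then show "x + y \<in> ?S" using alg.subspace_add[OF sub] x y by simp
    qed
    fix f s assume f: "ev \<gamma> f = 0" and s: "s \<in> ideal_power \<gamma> \<mu>"
    have "alg_scale (of_nat (Suc \<mu>)) (f * s) = f * s + f * alg_scale (of_nat \<mu>) s"
      by (simp add: alg.scale_left_distrib alg_scale_mult_right)
    then have eq: "E (f * s) - alg_scale (of_nat (Suc \<mu>)) (f * s)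
        = (E f - f) * s + f * (E s - alg_scale (of_nat \<mu>) s)"
      by (simp add: E_mult algebra_simps)
    have "(E f - f) * s \<in> ideal_power \<gamma> (2 + \<mu>)" by (rule ideal_power_mult[OF char E_point[OF f] s])
    moreover have "f * (E s - alg_scale (of_nat \<mu>) s) \<in> ideal_power \<gamma> (Suc (Suc \<mu>))"
      by (rule ideal_power_Suc_I[OF f Suc.IH[OF s]])
    ultimately have "(E f - f) * s + f * (E s - alg_scale (of_nat \<mu>) s) \<in> ideal_power \<gamma> (Suc (Suc \<mu>))"
      using alg.subspace_add[OF sub] by simp
    then show "f * s \<in> ?S" unfolding mem_Collect_eq eq .
  qed
  then show ?case using Suc.prems by blast
qed

text \<open>By induction \<open>s\<close> and all \<open>\<theta> j s\<close> lie in the power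
  \<open>\<mu>\<close>, so \<open>E s\<close> lies in the next one. There \<open>E s\<close> agrees
  with \<open>\<mu>\<close> times \<open>s\<close>, and in characteristic zero a positive
  \<open>\<mu>\<close> can be divided out; for \<open>\<mu> = 0\<close> the vanishing of
  \<open>s\<close> at the point is already the claim.\<close>

lemma jet_subset_ideal_power: "jet \<mu> \<subseteq> ideal_power \<gamma> \<mu>"
proof (induction \<mu>)
  case (Suc \<mu>)
  show ?case
  proof
    fix s assume s: "s \<in> jet (Suc \<mu>)"
    show "s \<in> ideal_power \<gamma> (Suc \<mu>)"
    proof (cases "\<mu> = 0")
      case True
      then show ?thesis using s point_mem_ideal_power_1[of \<gamma> s] by simp
    next
      case False
      note sub = subspace_ideal_power[of \<gamma> "Suc \<mu>"]
      have "s \<in> ideal_power \<gamma> \<mu>" using s jet_mono Suc by blast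
      then have 1: "E s - alg_scale (of_nat \<mu>) s \<in> ideal_power \<gamma> (Suc \<mu>)" by (rule E_ideal_power)
      have "E s \<in> ideal_power \<gamma> (Suc \<mu>)" unfolding E_def
        using s Suc by (intro alg.subspace_sum[OF sub] ideal_power_Suc_I ev_t) auto
      then have "E s - (E s - alg_scale (of_nat \<mu>) s) \<in> ideal_power \<gamma> (Suc \<mu>)"
        using 1 by (rule alg.subspace_diff[OF sub])
      then have "alg_scale (of_nat \<mu>) s \<in> ideal_power \<gamma> (Suc \<mu>)" by simp
      then have "alg_scale (inverse (of_nat \<mu>)) (alg_scale (of_nat \<mu>) s) \<in> ideal_power \<gamma> (Suc \<mu>)"
        by (rule alg.subspace_scale[OF sub])
      then show ?thesis using False by simp
    qed
  qed
qed (simp add: ideal_power_simps)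

lemma ideal_power_eq_jet: "ideal_power \<gamma> \<mu> = jet \<mu>"
  using ideal_power_subset_jet jet_subset_ideal_power by blast

section \<open>Euler derivatives and partial derivatives\<close>

text \<open>The falling factorial, which is the factor produced by the \<open>n\<close>-th
  derivative of the power with exponent \<open>z\<close>, also for negative
  \<open>z\<close>.\<close>

definition ffact :: "int \<Rightarrow> nat \<Rightarrow> 'k" where
  "ffact z n = (\<Prod>i<n. of_int z - of_nat i)"

text \<open>The value at the point of the partial derivative of orders \<open>u\<close>, multiplied
  by the monomial with exponents \<open>u\<close>. This factor is invertible on the torus and
  restores the original exponents.\<close>

definition deriv_at :: "('n \<Rightarrow> nat) \<Rightarrow> ((int^'n) \<Rightarrow>\<^sub>0 'k) \<Rightarrow> 'k" where
  "deriv_at u s = ev (\<lambda>m. (\<Prod>j\<in>UNIV. ffact (expo j m) (u j)) * \<gamma> m) s"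

lemma deriv_at_0: "deriv_at (\<lambda>_. 0) s = ev \<gamma> s"
  by (simp add: deriv_at_def ffact_def)

lemma ev_euler: "ev \<beta> (euler l s) = ev (\<lambda>m. of_int (l m) * \<beta> m) s"
  using ev_superset[OF finite_keys keys_euler, of \<beta> l s]
  by (simp add: lookup_euler ev_def mult_ac)

text \<open>From \<open>ffact z (Suc n) = (z - n) * ffact z n\<close>: the factor \<open>z\<close>
  amounts to the Euler derivation.\<close>

lemma deriv_at_Suc: "deriv_at (u(j := Suc (u j))) s = deriv_at u (\<theta> j s) - of_nat (u j) * deriv_at u s"
proof -
  have *: "(\<Prod>i\<in>UNIV. ffact (expo i m) ((u(j := Suc (u j))) i)) * \<gamma> m
      = of_int (expo j m) * ((\<Prod>i\<in>UNIV. ffact (expo i m) (u i)) * \<gamma> m)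
        - of_nat (u j) * ((\<Prod>i\<in>UNIV. ffact (expo i m) (u i)) * \<gamma> m)" for m
  proof -
    have "(\<Prod>i\<in>UNIV. ffact (expo i m) ((u(j := Suc (u j))) i))
        = ffact (expo j m) (Suc (u j)) * (\<Prod>i\<in>UNIV - {j}. ffact (expo i m) (u i))"
      by (subst prod.remove[of _ j]) (auto intro!: prod.cong)
    also have "\<dots> = (of_int (expo j m) - of_nat (u j)) * (\<Prod>i\<in>UNIV. ffact (expo i m) (u i))"
      by (subst (2) prod.remove[of _ j]) (auto simp: ffact_def)
    finally show ?thesis by (simp only: left_diff_distrib mult.assoc)
  qed
  show ?thesis unfolding deriv_at_def ev_euler * unfolding ev_def
    by (simp add: right_diff_distrib sum_subtractf sum_distrib_left mult_ac)
qed

text \<open>Raising one order by 1 means applying \<open>\<theta> j - u j\<close>, so the two kinds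
  of derivatives differ by a change that is triangular with respect to the order; up to any given
  order they vanish together.\<close>

lemma jet_iff: "s \<in> jet \<mu> \<longleftrightarrow> (\<forall>u. sum u UNIV < \<mu> \<longrightarrow> deriv_at u s = 0)"
proof (induction \<mu> arbitrary: s)
  case (Suc \<mu>)
  note IH = Suc.IH
  have sumS: "sum (u(j := Suc (u j))) UNIV = Suc (sum u UNIV)" for u :: "'n \<Rightarrow> nat" and j
    by (subst (1 2) sum.remove[of _ j]) (auto intro!: sum.cong)
  show ?case
  proof
    assume s: "s \<in> jet (Suc \<mu>)"
    have "sum u UNIV < Suc \<mu> \<longrightarrow> deriv_at u s = 0" for u
    proof (induction "sum u UNIV" arbitrary: u)
      case 0
      then have "u = (\<lambda>_. 0)" by auto
      then show ?case using s by (simp add: deriv_at_0)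
    next
      case (Suc n)
      have "\<exists>j. u j \<noteq> 0"
      proof (rule ccontr)
        assume "\<nexists>j. u j \<noteq> 0"
        then show False using Suc(2) by simp
      qed
      then obtain j k where j: "u j = Suc k" by (meson not0_implies_Suc)
      define v where "v = u(j := k)"
      have u: "u = v(j := Suc (v j))" using j by (auto simp: v_def fun_eq_iff)
      then have n: "sum v UNIV = n" using sumS[of v j] Suc(2) by simp
      show ?case
      proof
        assume "sum u UNIV < Suc \<mu>"
        then have lt: "n < \<mu>" using Suc(2) by simp
        then have "deriv_at v s = 0" using Suc(1)[of v] n by simp
        moreover have "deriv_at v (\<theta> j s) = 0" using s IH lt n by simp
        ultimately show "deriv_at u s = 0" by (subst u) (simp add: deriv_at_Suc)
      qed
    qed
    then show "\<forall>u. sum u UNIV < Suc \<mu> \<longrightarrow> deriv_at u s = 0" by blast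
  next
    assume *: "\<forall>u. sum u UNIV < Suc \<mu> \<longrightarrow> deriv_at u s = 0"
    have "deriv_at u (\<theta> j s) = 0" if "sum u UNIV < \<mu>" for u j
      using deriv_at_Suc[of u j s] *[rule_format, of u] *[rule_format, of "u(j := Suc (u j))"] that
      unfolding sumS by simp
    then have "\<theta> j s \<in> jet \<mu>" for j using Suc.IH by blast
    moreover have "ev \<gamma> s = 0" using *[rule_format, of "\<lambda>_. 0"] by (simp add: deriv_at_0)
    ultimately show "s \<in> jet (Suc \<mu>)" by simp
  qed
qed simp

end

section \<open>The entries of the interpolation matrix\<close>

text \<open>The exponent subtraction in the definition truncates only when \<open>\<alpha>\<close>
  does not involve \<open>j\<close>, and then the coefficient is 0.\<close>

lemma lookup_partial_deriv:
  "Poly_Mapping.lookup (partial_deriv j f) \<beta> =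
    of_nat (Poly_Mapping.lookup \<beta> j + 1) * Poly_Mapping.lookup f (\<beta> + Poly_Mapping.single j 1)"
proof -
  let ?s = "Poly_Mapping.single j (1::nat)"
  have "Poly_Mapping.lookup (partial_deriv j f) \<beta>
      = (\<Sum>\<alpha>\<in>Poly_Mapping.keys f. if \<alpha> = \<beta> + ?s
          then of_nat (Poly_Mapping.lookup \<beta> j + 1) * Poly_Mapping.lookup f (\<beta> + ?s) else 0)"
    unfolding partial_deriv_def lookup_sum
  proof (rule sum.cong[OF refl])
    fix \<alpha>
    consider "\<alpha> = \<beta> + ?s" | "\<alpha> \<noteq> \<beta> + ?s" "Poly_Mapping.lookup \<alpha> j = 0"
      | "\<alpha> \<noteq> \<beta> + ?s" "Poly_Mapping.lookup \<alpha> j \<noteq> 0" by blast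
    then show "Poly_Mapping.lookup (Poly_Mapping.single (\<alpha> - ?s)
          (of_nat (Poly_Mapping.lookup \<alpha> j) * Poly_Mapping.lookup f \<alpha>)) \<beta>
        = (if \<alpha> = \<beta> + ?s then of_nat (Poly_Mapping.lookup \<beta> j + 1) * Poly_Mapping.lookup f (\<beta> + ?s) else 0)"
    proof cases
      case 3
      have "\<alpha> - ?s \<noteq> \<beta>"
      proof
        assume "\<alpha> - ?s = \<beta>"
        moreover have "\<alpha> = (\<alpha> - ?s) + ?s"
          using 3(2) by (intro poly_mapping_eqI) (auto simp: lookup_add lookup_minus lookup_single when_def)
        ultimately show False using 3(1) by simp
      qed
      then show ?thesis using 3(1) by (simp add: lookup_single)
    qed (simp_all add: lookup_add)
  qed
  then show ?thesis by (simp add: in_keys_iff)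
qed

lemma partial_deriv_commute: "partial_deriv i (partial_deriv j f) = partial_deriv j (partial_deriv i f)"
proof (cases "i = j")
  case False
  then show ?thesis
    by (intro poly_mapping_eqI)
      (simp add: lookup_partial_deriv lookup_add lookup_single ac_simps)
qed simp

lemma partial_deriv_funpow_commute:
  "(partial_deriv i ^^ a) ((partial_deriv j ^^ b) f) = (partial_deriv j ^^ b) ((partial_deriv i ^^ a) f)"
proof -
  have c: "partial_deriv i ((partial_deriv j ^^ b) f) = (partial_deriv j ^^ b) (partial_deriv i f)" for f
    by (induction b) (simp_all add: partial_deriv_commute[of i j])
  show ?thesis by (induction a) (simp_all add: c)
qed

lemma partial_deriv_single:
  "partial_deriv j (Poly_Mapping.single \<alpha> c) =
    Poly_Mapping.single (\<alpha> - Poly_Mapping.single j 1) (of_nat (Poly_Mapping.lookup \<alpha> j) * c)"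
  by (cases "c = 0") (simp_all add: partial_deriv_def)

lemma partial_deriv_funpow_single:
  "(partial_deriv j ^^ k) (Poly_Mapping.single \<alpha> c) =
    Poly_Mapping.single (\<alpha> - Poly_Mapping.single j k) ((\<Prod>i<k. of_nat (Poly_Mapping.lookup \<alpha> j - i)) * c)"
proof (induction k)
  case (Suc k)
  have "\<alpha> - Poly_Mapping.single j k - Poly_Mapping.single j 1 = \<alpha> - Poly_Mapping.single j (Suc k)"
    by (rule poly_mapping_eqI) (simp add: lookup_minus lookup_single when_def)
  then show ?case using Suc by (simp add: partial_deriv_single lookup_minus mult_ac)
qed simp

text \<open>Differentiating in one variable leaves the other exponents alone, so the coefficients
  multiply. If an order exceeds the exponent, the subtraction truncates but the coefficient contains
  a factor 0.\<close>

lemma fold_partial_deriv_single: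
  fixes \<alpha> :: "'n::finite \<Rightarrow>\<^sub>0 nat"
  shows "Finite_Set.fold (\<lambda>j. partial_deriv j ^^ u j) (Poly_Mapping.single \<alpha> c) UNIV =
    Poly_Mapping.single (\<alpha> - (\<Sum>j\<in>UNIV. Poly_Mapping.single j (u j)))
      ((\<Prod>j\<in>UNIV. \<Prod>i<u j. of_nat (Poly_Mapping.lookup \<alpha> j - i)) * c)"
proof -
  interpret comp_fun_commute "\<lambda>j. partial_deriv j ^^ u j"
    by unfold_locales (simp add: fun_eq_iff partial_deriv_funpow_commute)
  have "Finite_Set.fold (\<lambda>j. partial_deriv j ^^ u j) (Poly_Mapping.single \<alpha> c) S =
    Poly_Mapping.single (\<alpha> - (\<Sum>j\<in>S. Poly_Mapping.single j (u j)))
      ((\<Prod>j\<in>S. \<Prod>i<u j. of_nat (Poly_Mapping.lookup \<alpha> j - i)) * c)" if "finite S" for S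
    using that
  proof (induction S)
    case (insert j S)
    have "Poly_Mapping.lookup (\<Sum>j\<in>S. Poly_Mapping.single j (u j)) j = 0"
      using insert(2) by (auto simp: lookup_sum lookup_single when_def)
    then have l: "Poly_Mapping.lookup (\<alpha> - (\<Sum>j\<in>S. Poly_Mapping.single j (u j))) j = Poly_Mapping.lookup \<alpha> j"
      by (simp add: lookup_minus)
    have "\<alpha> - (\<Sum>j\<in>S. Poly_Mapping.single j (u j)) - Poly_Mapping.single j (u j)
        = \<alpha> - (\<Sum>j\<in>insert j S. Poly_Mapping.single j (u j))"
      using insert(1,2) by (intro poly_mapping_eqI) (simp add: lookup_minus lookup_add)
    then show ?case using insert by (simp add: partial_deriv_funpow_single l mult_ac)
  qed simp
  then show ?thesis by simp
qed

text \<open>For \<open>k > n\<close> the truncated differences are wrong beyond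
  \<open>i = n\<close>, but at \<open>i = n\<close> both products have a factor 0.\<close>

lemma prod_of_nat_diff: "(\<Prod>i<k. of_nat (n - i)) = (\<Prod>i<k. of_nat n - of_nat i :: 'k::comm_ring_1)"
proof (cases "k \<le> n")
  case True
  then show ?thesis by (intro prod.cong) (auto simp: of_nat_diff)
next
  case False
  then have "n \<in> {..<k}" by simp
  then have "(\<Prod>i<k. of_nat (n - i)) = (0::'k)" "(\<Prod>i<k. of_nat n - of_nat i) = (0::'k)"
    by (subst prod.remove[of _ n]; simp)+
  then show ?thesis by simp
qed

lemma var_power: "var j ^ n = Poly_Mapping.single (Poly_Mapping.single j n) 1"
proof (induction n)
  case (Suc n)
  then show ?case by (simp add: var_def mult_single flip: single_add)
qed simp

lemma prod_var_power:
  "finite S \<Longrightarrow> (\<Prod>j\<in>S. var j ^ n j) = Poly_Mapping.single (\<Sum>j\<in>S. Poly_Mapping.single j (n j)) 1"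
  by (induction S rule: finite_induct) (simp_all add: var_power mult_single)

lemma lookup_sum_single:
  "Poly_Mapping.lookup (\<Sum>j\<in>UNIV. Poly_Mapping.single j (n j)) i = n (i :: 'n::finite)"
proof -
  have "Poly_Mapping.lookup (\<Sum>j\<in>UNIV. Poly_Mapping.single j (n j)) i = (\<Sum>j\<in>UNIV. if j = i then n i else 0)"
    unfolding lookup_sum by (intro sum.cong) (auto simp: lookup_single when_def)
  then show ?thesis by simp
qed

text \<open>Only the rays \<open>- e j\<close> contribute, and there the exponent
  \<open>d (- e j) - pairing m (- e j)\<close> is \<open>pairing m (e j)\<close> by the standard
  form.\<close>

lemma y_monomial_eq:
  assumes fan: "complete_fan \<Sigma>" and e: "lattice_basis e" and rays: "\<And>j. - e j \<in> rays \<Sigma>"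
    and d: "standard_form e d"
  shows "y_monomial \<Sigma> e d m
    = Poly_Mapping.single (\<Sum>j\<in>UNIV. Poly_Mapping.single j (nat (pairing m (e j)))) 1"
proof -
  have inj: "inj (\<lambda>j. - e j)" using lattice_basis_inj[OF e] by (auto simp: inj_def)
  have cox: "cox_subst e (- e j) = var j" for j
  proof -
    have "(THE i. - e j = - e i) = j" using lattice_basis_inj[OF e] by (intro the_equality) (auto simp: inj_def)
    then show ?thesis by (auto simp: cox_subst_def)
  qed
  have "y_monomial \<Sigma> e d m = (\<Prod>\<rho>\<in>range (\<lambda>j. - e j). cox_subst e \<rho> ^ nat (d \<rho> - pairing m \<rho>))"
    unfolding y_monomial_def
    by (rule prod.mono_neutral_right[OF finite_rays[OF fan]]) (use rays in \<open>auto simp: cox_subst_def\<close>)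
  also have "\<dots> = (\<Prod>j\<in>UNIV. var j ^ nat (pairing m (e j)))"
    using d by (subst prod.reindex[OF inj]) (simp add: cox pairing_uminus_right standard_form_def)
  finally show ?thesis by (simp add: prod_var_power)
qed

lemma character_torus_point:
  assumes "\<And>j. a $ j \<noteq> 0"
  shows "character (snd (torus_point e a))"
proof -
  have "(\<Prod>j\<in>UNIV. (a $ j) powi (- pairing (m + m') (e j)))
      = (\<Prod>j\<in>UNIV. (a $ j) powi (- pairing m (e j))) * (\<Prod>j\<in>UNIV. (a $ j) powi (- pairing m' (e j)))" for m m'
    unfolding prod.distrib[symmetric] using assms
    by (intro prod.cong refl) (simp add: pairing_add_left power_int_add power_int_diff power_int_minus field_simps)
  then show ?thesis by (simp add: character_def torus_point_def)
qed

section \<open>Dimensions\<close>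

interpretation fun_vs: vector_space "\<lambda>(c::'k::field) (v::'c \<Rightarrow> 'k) x. c * v x"
  by (rule vector_space_fun_scale)

lemma dim_injective_image:
  assumes "vector_space s1" "vector_space s2" and f: "Vector_Spaces.linear s1 s2 f"
    and V: "module.subspace s1 V" and inj: "inj_on f V"
  shows "vector_space.dim s2 (f ` V) = vector_space.dim s1 V"
proof -
  interpret vector_space_pair s1 s2 using assms(1,2) by (simp add: vector_space_pair_def)
  obtain B where B: "B \<subseteq> V" "vs1.independent B" "V \<subseteq> vs1.span B" "card B = vs1.dim V"
    using vs1.basis_exists by blast
  have span: "vs1.span B = V" using B V vs1.span_minimal by blast
  have "vs2.independent (f ` B)"
    by (rule linear_independent_injective_image[OF f B(2)]) (use inj span in simp)
  moreover have "vs2.span (f ` B) = vs2.span (f ` V)"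
  proof -
    have sV: "vs1.span V = V" using vs1.span_span[of B] unfolding span .
    show ?thesis by (simp only: linear_span_image[OF f] span sV)
  qed
  ultimately have "vs2.dim (f ` V) = card (f ` B)" by (intro vs2.dim_eq_card) auto
  then show ?thesis using B(4) card_image[OF inj_on_subset[OF inj B(1)]] by simp
qed

text \<open>\<open>T\<close> makes a basis of \<open>U\<close> finite, so that adding
  \<open>z\<close> raises its cardinality.\<close>

lemma (in vector_space) dim_span_insert:
  assumes U: "subspace U" "U \<subseteq> span T" "finite T" and z: "z \<notin> U"
  shows "dim (span (insert z U)) = dim U + 1"
proof -
  obtain B where B: "B \<subseteq> U" "independent B" "U \<subseteq> span B" "card B = dim U" using basis_exists by blast
  have span: "span B = U" using B U(1) span_minimal by blast
  have "finite B" using independent_span_bound[OF U(3) B(2)] B(1) U(2) by blast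
  moreover have "independent (insert z B)" using independent_insertI[of z B] z B(2) span by simp
  moreover have "span (insert z U) = span (insert z B)"
  proof
    have "U \<subseteq> span (insert z B)" using span_mono[of B "insert z B"] span by blast
    then show "span (insert z U) \<subseteq> span (insert z B)"
      by (intro span_minimal subspace_span) (auto intro: span_base)
    show "span (insert z B) \<subseteq> span (insert z U)" using B(1) by (intro span_mono) blast
  qed
  moreover have "z \<notin> B" using B(1) z by blast
  ultimately show ?thesis using B(4) by (simp add: dim_eq_card_independent)
qed

section \<open>Annihilators and rank\<close>

text \<open>The coordinate space of vectors indexed by \<open>C\<close>, kept inside the full
  function type so that \<open>C\<close> can vary in an induction.\<close>

definition supported :: "'c set \<Rightarrow> ('c \<Rightarrow> 'k::field) set" where
  "supported C = {v. \<forall>x. x \<notin> C \<longrightarrow> v x = 0}"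

definition annihilator :: "'c set \<Rightarrow> ('c \<Rightarrow> 'k::field) set \<Rightarrow> ('c \<Rightarrow> 'k) set" where
  "annihilator C W = {v \<in> supported C. \<forall>w\<in>W. (\<Sum>x\<in>C. w x * v x) = 0}"

lemma subspace_supported: "fun_vs.subspace (supported C)"
  by (auto simp: fun_vs.subspace_def supported_def)

lemma subspace_annihilator: "fun_vs.subspace (annihilator C W)"
  using subspace_supported[of C] unfolding fun_vs.subspace_def annihilator_def
  by (auto simp: distrib_left sum.distrib mult.left_commute simp flip: sum_distrib_left)

lemma supported_spanned:
  assumes "finite C"
  shows "supported C \<subseteq> fun_vs.span ((\<lambda>c x. if x = c then 1 else 0 :: 'k::field) ` C)"
proof
  fix v :: "_ \<Rightarrow> 'k" assume v: "v \<in> supported C"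
  have "(\<Sum>c\<in>A. (\<lambda>x. v c * (if x = c then 1 else 0))) x = (\<Sum>c\<in>A. if c = x then v c else 0)" for A x
    by (induction A rule: infinite_finite_induct) auto
  then have "v = (\<Sum>c\<in>C. (\<lambda>x. v c * (if x = c then 1 else 0)))"
    using v assms by (auto simp: supported_def fun_eq_iff)
  also have "\<dots> \<in> fun_vs.span ((\<lambda>c x. if x = c then 1 else 0) ` C)"
    by (intro fun_vs.span_sum fun_vs.span_scale fun_vs.span_base) auto
  finally show "v \<in> fun_vs.span ((\<lambda>c x. if x = c then 1 else 0) ` C)" .
qed

text \<open>If \<open>W\<close> vanishes at the new index \<open>c\<close>, the annihilator gains
  the unit vector of \<open>c\<close>. Otherwise the subspace of \<open>W\<close> vanishing at
  \<open>c\<close> has one dimension less, and each vector annihilating it has exactly one value at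
  \<open>c\<close> that makes it annihilate \<open>W\<close>.\<close>

lemma dim_annihilator:
  fixes W :: "('c \<Rightarrow> 'k::field) set"
  assumes "finite C" "fun_vs.subspace W" "W \<subseteq> supported C"
  shows "fun_vs.dim W + fun_vs.dim (annihilator C W) = card C"
  using assms
proof (induction C arbitrary: W rule: finite_induct)
  case empty
  have s: "supported {} = {0 :: 'c \<Rightarrow> 'k}" by (auto simp: supported_def)
  then have "W = {0}" using empty fun_vs.subspace_0 by fastforce
  moreover have "annihilator {} W = {0}"
    using s fun_vs.subspace_0[OF subspace_annihilator, of "{}" W] by (auto simp: annihilator_def)
  moreover have "fun_vs.dim {0 :: 'c \<Rightarrow> 'k} = 0"
    using fun_vs.dim_eq_card[of "{}" "{0 :: 'c \<Rightarrow> 'k}"] fun_vs.independent_empty by simp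
  ultimately show ?case by simp
next
  case (insert c C)
  note sp = supported_spanned[OF insert(1)]
  have finI: "finite ((\<lambda>c x. if x = c then 1 else 0 :: 'k) ` C)" using insert(1) by simp
  have mono: "supported C \<subseteq> (supported (insert c C) :: ('c \<Rightarrow> 'k) set)" by (auto simp: supported_def)
  show ?case
  proof (cases "\<forall>w\<in>W. w c = 0")
    case True
    have W: "W \<subseteq> supported C" unfolding supported_def
    proof (intro subsetI CollectI allI impI)
      fix w x assume "w \<in> W" "x \<notin> C"
      then show "w x = 0" using True insert.prems(2) by (cases "x = c") (auto simp: supported_def)
    qed
    define \<delta> where "\<delta> = (\<lambda>x. if x = c then 1 else 0 :: 'k)"
    have eq: "annihilator (insert c C) W = fun_vs.span (insert \<delta> (annihilator C W))"
    proof (intro equalityI subsetI)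
      fix v assume v: "v \<in> annihilator (insert c C) W"
      define v' where "v' = v - (\<lambda>x. v c * \<delta> x)"
      have "v' \<in> annihilator C W"
      proof -
        have "(\<Sum>x\<in>C. w x * v' x) = (\<Sum>x\<in>insert c C. w x * v x)" if "w \<in> W" for w
        proof -
          have "w c = 0" using True that by blast
          then have "(\<Sum>x\<in>insert c C. w x * v x) = (\<Sum>x\<in>C. w x * v x)" using insert(1,2) by simp
          also have "\<dots> = (\<Sum>x\<in>C. w x * v' x)"
            using insert(2) by (intro sum.cong) (auto simp: v'_def \<delta>_def)
          finally show ?thesis by simp
        qed
        then show ?thesis using v by (auto simp: annihilator_def supported_def v'_def \<delta>_def)
      qed
      then have "v' + (\<lambda>x. v c * \<delta> x) \<in> fun_vs.span (insert \<delta> (annihilator C W))"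
        by (intro fun_vs.span_add fun_vs.span_scale fun_vs.span_base) auto
      then show "v \<in> fun_vs.span (insert \<delta> (annihilator C W))" by (simp add: v'_def)
    next
      have "\<delta> \<in> annihilator (insert c C) W"
      proof -
        have "(\<Sum>x\<in>insert c C. w x * \<delta> x) = 0" if "w \<in> W" for w
          using True that by (intro sum.neutral) (auto simp: \<delta>_def)
        then show ?thesis by (auto simp: annihilator_def supported_def \<delta>_def)
      qed
      moreover have "annihilator C W \<subseteq> annihilator (insert c C) W"
        using True insert(1,2) mono by (auto simp: annihilator_def)
      ultimately have "fun_vs.span (insert \<delta> (annihilator C W)) \<subseteq> annihilator (insert c C) W"
        by (intro fun_vs.span_minimal subspace_annihilator) auto
      then show "v \<in> annihilator (insert c C) W" if "v \<in> fun_vs.span (insert \<delta> (annihilator C W))" for v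
        using that by blast
    qed
    have "\<delta> \<notin> annihilator C W" using insert(2) by (auto simp: annihilator_def supported_def \<delta>_def)
    moreover have "annihilator C W \<subseteq> fun_vs.span ((\<lambda>c x. if x = c then 1 else 0 :: 'k) ` C)"
      using sp by (auto simp: annihilator_def)
    ultimately have "fun_vs.dim (annihilator (insert c C) W) = fun_vs.dim (annihilator C W) + 1"
      unfolding eq by (intro fun_vs.dim_span_insert[OF subspace_annihilator _ finI])
    then show ?thesis using insert.IH[OF insert.prems(1) W] insert(1,2) by simp
  next
    case False
    then obtain w1 where w1: "w1 \<in> W" "w1 c \<noteq> 0" by blast
    define w0 where "w0 = (\<lambda>x. inverse (w1 c) * w1 x)"
    have w0: "w0 \<in> W" "w0 c = 1"
      using fun_vs.subspace_scale[OF insert.prems(1) w1(1)] w1(2) by (auto simp: w0_def)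
    define W0 where "W0 = {w \<in> W. w c = 0}"
    have W0: "fun_vs.subspace W0" using insert.prems(1) by (auto simp: fun_vs.subspace_def W0_def)
    have W0s: "W0 \<subseteq> supported C" using insert.prems(2) by (auto simp: W0_def supported_def)
    have eq: "W = fun_vs.span (insert w0 W0)"
    proof (intro equalityI subsetI)
      fix w assume w: "w \<in> W"
      define w' where "w' = w - (\<lambda>x. w c * w0 x)"
      have "w' \<in> W" unfolding w'_def
        by (intro fun_vs.subspace_diff[OF insert.prems(1)] fun_vs.subspace_scale[OF insert.prems(1)] w w0)
      then have "w' \<in> W0" by (simp add: W0_def w'_def w0(2))
      then have "w' + (\<lambda>x. w c * w0 x) \<in> fun_vs.span (insert w0 W0)"
        by (intro fun_vs.span_add fun_vs.span_scale fun_vs.span_base) auto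
      then show "w \<in> fun_vs.span (insert w0 W0)" by (simp add: w'_def)
    next
      have "fun_vs.span (insert w0 W0) \<subseteq> W"
        by (intro fun_vs.span_minimal insert.prems(1)) (use w0 in \<open>auto simp: W0_def\<close>)
      then show "w \<in> W" if "w \<in> fun_vs.span (insert w0 W0)" for w using that by blast
    qed
    have "w0 \<notin> W0" using w0(2) by (simp add: W0_def)
    then have dW: "fun_vs.dim W = fun_vs.dim W0 + 1"
      using fun_vs.dim_span_insert[OF W0 subset_trans[OF W0s sp] finI] eq by metis
    \<comment> \<open>The value at \<open>c\<close> is forced by orthogonality to \<open>w0\<close>,
      which is normalized to 1 at \<open>c\<close>.\<close>
    define f where "f = (\<lambda>v x. if x = c then - (\<Sum>y\<in>C. w0 y * v y) else v x :: 'k)"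
    have lin: "Vector_Spaces.linear (\<lambda>(c::'k) v x. c * v x) (\<lambda>(c::'k) v x. c * v x) f"
    proof (rule Vector_Spaces.linear_iff[THEN iffD2], intro conjI allI)
      show "vector_space (\<lambda>(c::'k) (v::'c \<Rightarrow> 'k) x. c * v x)" by (rule vector_space_fun_scale)
      then show "vector_space (\<lambda>(c::'k) (v::'c \<Rightarrow> 'k) x. c * v x)" .
      show "f (u + v) = f u + f v" for u v
        by (auto simp: f_def fun_eq_iff distrib_left sum.distrib)
      show "f (\<lambda>x. a * v x) = (\<lambda>x. a * f v x)" for a v
        by (auto simp: f_def fun_eq_iff sum_distrib_left mult_ac)
    qed
    have sumC: "(\<Sum>x\<in>insert c C. w x * v x) = w c * v c + (\<Sum>x\<in>C. w x * v x)" for w v :: "'c \<Rightarrow> 'k"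
      using insert(1,2) by simp
    have fC: "(\<Sum>x\<in>C. w x * f v x) = (\<Sum>x\<in>C. w x * v x)" for w v
      using insert(2) by (intro sum.cong) (auto simp: f_def)
    have img: "f ` annihilator C W0 = annihilator (insert c C) W"
    proof (intro equalityI subsetI)
      fix v assume "v \<in> f ` annihilator C W0"
      then obtain v' where v': "v' \<in> annihilator C W0" "v = f v'" by blast
      have "(\<Sum>x\<in>insert c C. w x * v x) = 0" if "w \<in> W" for w
      proof -
        define w' where "w' = w - (\<lambda>x. w c * w0 x)"
        have "w' \<in> W" unfolding w'_def
          by (intro fun_vs.subspace_diff[OF insert.prems(1)] fun_vs.subspace_scale[OF insert.prems(1)] that w0)
        then have "w' \<in> W0" by (simp add: W0_def w'_def w0(2))
        then have "(\<Sum>x\<in>C. w' x * v' x) = 0" using v' by (simp add: annihilator_def)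
        then have "(\<Sum>x\<in>C. w x * v' x) = w c * (\<Sum>x\<in>C. w0 x * v' x)"
          by (simp add: w'_def left_diff_distrib sum_subtractf sum_distrib_left mult.assoc)
        then show ?thesis unfolding sumC v'(2) fC by (simp add: f_def)
      qed
      moreover have "v \<in> supported (insert c C)" using v' by (auto simp: annihilator_def supported_def f_def)
      ultimately show "v \<in> annihilator (insert c C) W" by (simp add: annihilator_def)
    next
      fix v assume v: "v \<in> annihilator (insert c C) W"
      define v' where "v' = v(c := 0)"
      have C': "(\<Sum>x\<in>C. w x * v' x) = (\<Sum>x\<in>C. w x * v x)" for w
        using insert(2) by (intro sum.cong) (auto simp: v'_def)
      have s: "v c * w c + (\<Sum>x\<in>C. w x * v x) = 0" if "w \<in> W" for w
      proof -
        have "(\<Sum>x\<in>insert c C. w x * v x) = 0" using v that unfolding annihilator_def by blast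
        then show ?thesis unfolding sumC by (simp only: mult.commute[of "v c"])
      qed
      have "(\<Sum>x\<in>C. w x * v' x) = 0" if "w \<in> W0" for w
        using s[of w] that by (simp add: C' W0_def)
      moreover have "v' \<in> supported C" using v by (auto simp: v'_def annihilator_def supported_def)
      ultimately have "v' \<in> annihilator C W0" by (simp add: annihilator_def)
      moreover have "v = f v'"
        using s[OF w0(1)] w0(2) C'[of w0] by (auto simp: f_def v'_def fun_eq_iff eq_neg_iff_add_eq_0)
      ultimately show "v \<in> f ` annihilator C W0" by blast
    qed
    have "inj_on f (annihilator C W0)"
    proof (rule inj_onI)
      fix u v assume uv: "u \<in> annihilator C W0" "v \<in> annihilator C W0" "f u = f v"
      have "u x = v x" for x
      proof (cases "x = c")
        case True
        then show ?thesis using uv(1,2) insert(2) by (simp add: annihilator_def supported_def)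
      next
        case False
        then show ?thesis using fun_cong[OF uv(3), of x] by (simp add: f_def)
      qed
      then show "u = v" by blast
    qed
    then have "fun_vs.dim (annihilator (insert c C) W) = fun_vs.dim (annihilator C W0)"
      unfolding img[symmetric]
      by (intro dim_injective_image[OF vector_space_fun_scale vector_space_fun_scale lin subspace_annihilator])
    then show ?thesis using insert.IH[OF W0 W0s] dW insert(1,2) by simp
  qed
qed

section \<open>Counting the orders of differentiation\<close>

text \<open>Stars and bars: the coordinates of \<open>u\<close> together with the slack up to
  \<open>\<mu> - 1\<close> form a list of \<open>CARD('n) + 1\<close> naturals with sum
  \<open>\<mu> - 1\<close>. For \<open>\<mu> = 0\<close> this difference truncates and would still
  count one list, while \<open>Delta e 0\<close> is empty.\<close>

lemma card_Delta_le:
  fixes e :: "'n \<Rightarrow> int^'n"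
  assumes e: "lattice_basis e"
  shows "finite (Delta e \<mu>)" "card (Delta e \<mu>) \<le> (CARD('n) + \<mu> - 1) choose CARD('n)"
proof -
  have iff: "u \<in> Delta e \<mu> \<longleftrightarrow> (\<Sum>j\<in>UNIV. pairing u (e j)) \<le> int \<mu> - 1 \<and> (\<forall>j. 0 \<le> pairing u (e j))" for u :: "int^'n"
    by (simp add: Delta_def pairing_sum_right)
  obtain xs :: "'n list" where xs: "set xs = UNIV" "distinct xs"
    using finite_distinct_list[OF finite[of "UNIV :: 'n set"]] by blast
  then have len: "length xs = CARD('n)" by (metis distinct_card)
  have sl: "sum_list (map f xs) = sum f UNIV" for f :: "'n \<Rightarrow> nat" using xs by (metis sum_list_distinct_conv_sum_set)
  define F where "F = (\<lambda>u. map (\<lambda>j. nat (pairing u (e j))) xs @ [\<mu> - 1 - (\<Sum>j\<in>UNIV. nat (pairing u (e j)))])"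
  define L where "L = {l :: nat list. length l = CARD('n) + 1 \<and> sum_list l = \<mu> - 1}"
  have sub: "F ` Delta e \<mu> \<subseteq> L"
  proof
    fix l assume "l \<in> F ` Delta e \<mu>"
    then obtain u where u: "u \<in> Delta e \<mu>" "l = F u" by blast
    have "int (\<Sum>j\<in>UNIV. nat (pairing u (e j))) = (\<Sum>j\<in>UNIV. pairing u (e j))"
      using u(1) iff by simp
    then have "(\<Sum>j\<in>UNIV. nat (pairing u (e j))) \<le> \<mu> - 1" using u(1) iff[of u] by linarith
    then show "l \<in> L" by (simp add: u(2) F_def L_def len sl)
  qed
  have inj: "inj_on F (Delta e \<mu>)"
  proof (rule inj_onI)
    fix u v assume uv: "u \<in> Delta e \<mu>" "v \<in> Delta e \<mu>" "F u = F v"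
    then have "map (\<lambda>j. nat (pairing u (e j))) xs = map (\<lambda>j. nat (pairing v (e j))) xs" by (simp add: F_def)
    then have "nat (pairing u (e j)) = nat (pairing v (e j))" for j using xs(1) by (auto simp: map_eq_conv)
    then have "pairing u (e j) = pairing v (e j)" for j using uv(1,2) iff by (metis int_nat_eq)
    then show "u = v" by (rule lattice_point_eqI[OF e])
  qed
  have finL: "finite L"
  proof (rule finite_subset)
    show "L \<subseteq> {l. set l \<subseteq> {..\<mu>} \<and> length l = CARD('n) + 1}"
    proof
      fix l assume l: "l \<in> L"
      have "x \<le> \<mu>" if "x \<in> set l" for x using member_le_sum_list[OF that] l by (simp add: L_def)
      then show "l \<in> {l. set l \<subseteq> {..\<mu>} \<and> length l = CARD('n) + 1}" using l by (auto simp: L_def)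
    qed
    show "finite {l. set l \<subseteq> {..\<mu>} \<and> length l = CARD('n) + 1}" by (rule finite_lists_length_eq) simp
  qed
  show "finite (Delta e \<mu>)" using inj_on_finite[OF inj sub finL] .
  show "card (Delta e \<mu>) \<le> (CARD('n) + \<mu> - 1) choose CARD('n)"
  proof (cases "\<mu> = 0")
    case True
    have "Delta e \<mu> = {}"
    proof (rule ccontr)
      assume "Delta e \<mu> \<noteq> {}"
      then obtain u where u: "u \<in> Delta e \<mu>" by blast
      then have "(\<Sum>j\<in>UNIV. pairing u (e j)) \<ge> (0::int)" using iff by (intro sum_nonneg) auto
      then show False using u iff[of u] True by simp
    qed
    then show ?thesis by simp
  next
    case False
    have "card (Delta e \<mu>) \<le> card L" by (rule card_inj_on_le[OF inj sub finL])
    also have "\<dots> = (\<mu> - 1 + (CARD('n) + 1) - 1) choose (\<mu> - 1)"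
      unfolding L_def by (rule card_length_sum_list)
    also have "\<dots> = (CARD('n) + \<mu> - 1) choose CARD('n)"
      using False binomial_symmetric[of "\<mu> - 1" "CARD('n) + \<mu> - 1"] by (simp add: add.commute)
    finally show ?thesis .
  qed
qed

section \<open>The theorem\<close>

text \<open>Lowering the coordinates lowers the pairing with a ray of nonnegative coordinates; at a
  ray \<open>- e j\<close> the bound is 0 and says that the coordinate is nonnegative.\<close>

lemma orthant_down_closed:
  assumes e: "lattice_basis e" and d: "standard_form e d"
    and nonneg: "\<And>j \<rho>. \<rho> \<in> rays \<Sigma> \<Longrightarrow> \<rho> \<noteq> - e j \<Longrightarrow> pairing (dual_basis e j) \<rho> \<ge> (0::int)"
    and m: "m \<in> polytope_points \<Sigma> d" and u: "\<And>j. 0 \<le> pairing u (e j)" "\<And>j. pairing u (e j) \<le> pairing m (e j)"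
  shows "u \<in> polytope_points \<Sigma> d"
  unfolding polytope_points_iff
proof
  fix \<rho> assume \<rho>: "\<rho> \<in> rays \<Sigma>"
  show "pairing u \<rho> \<le> d \<rho>"
  proof (cases "\<exists>j. \<rho> = - e j")
    case True
    then show ?thesis using d u(1) by (auto simp: standard_form_def pairing_uminus_right)
  next
    case False
    have "pairing u \<rho> = (\<Sum>j\<in>UNIV. pairing u (e j) * pairing (dual_basis e j) \<rho>)"
      using pairing_expand[OF e, of u \<rho>] by simp
    also have "\<dots> \<le> (\<Sum>j\<in>UNIV. pairing m (e j) * pairing (dual_basis e j) \<rho>)"
      using nonneg[OF \<rho>] False u(2) by (intro sum_mono mult_right_mono) auto
    also have "\<dots> = pairing m \<rho>" using pairing_expand[OF e, of m \<rho>] by simp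
    also have "\<dots> \<le> d \<rho>" using m \<rho> by (simp add: polytope_points_iff)
    finally show ?thesis .
  qed
qed

section \<open>Sections as the kernel of the matrix\<close>

lemma eval_poly_single: "eval_poly (Poly_Mapping.single \<alpha> c) a = c * (\<Prod>j\<in>UNIV. (a $ j) ^ Poly_Mapping.lookup \<alpha> j)"
  by (cases "c = 0") (simp_all add: eval_poly_def)

lemma snd_torus_point: "snd (torus_point e a) m = (\<Prod>j\<in>UNIV. (a $ j) powi (- pairing m (e j)))"
  by (simp add: torus_point_def)

lemma (in torus_coordinates) ffact_eq_0: "0 \<le> z \<Longrightarrow> z < int n \<Longrightarrow> ffact z n = 0"
  unfolding ffact_def by (rule prod_zero) (auto intro!: bexI[of _ "nat z"])

text \<open>The section of \<open>m\<close> is the character of \<open>- m\<close>, whose coordinate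
  exponents are the pairings of \<open>m\<close> with the basis. Both sides carry the same falling
  factorials; the extra product on the right is the monomial by which \<open>deriv_at\<close>
  differs from the partial derivative.\<close>

lemma deriv_at_monomial:
  fixes a :: "'k::field_char_0^'n" and \<Sigma> :: "(real^'n) set set" and d :: "int^'n \<Rightarrow> int"
  assumes fan: "complete_fan \<Sigma>" and e: "lattice_basis e" and rays: "\<And>j. - e j \<in> rays \<Sigma>"
    and d: "standard_form e d" and a: "\<And>j. a $ j \<noteq> 0" and m: "\<And>j. 0 \<le> pairing m (e j)"
  shows "torus_coordinates.deriv_at e (snd (torus_point e a)) (\<lambda>j. nat (pairing u (e j))) (Poly_Mapping.single (- m) 1)
    = eval_poly (mixed_deriv e u (y_monomial \<Sigma> e d m)) a * (\<Prod>j\<in>UNIV. (a $ j) ^ nat (pairing u (e j)))"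
proof -
  interpret torus_coordinates e "snd (torus_point e a)"
    using e character_torus_point[OF a] by (simp add: torus_coordinates_def)
  let ?n = "\<lambda>j. nat (pairing m (e j))" and ?u = "\<lambda>j. nat (pairing u (e j))"
  have factor: "(\<Prod>i<?u j. of_nat (?n j - i)) * (a $ j) ^ (?n j - ?u j) * (a $ j) ^ ?u j
      = ffact (pairing m (e j)) (?u j) * (a $ j) powi pairing m (e j)" for j
  proof -
    have p: "(a $ j) powi pairing m (e j) = (a $ j) ^ ?n j" using m[of j] by (simp add: power_int_def)
    have c: "(\<Prod>i<?u j. of_nat (?n j - i)) = ffact (pairing m (e j)) (?u j)"
      using m[of j] by (simp add: prod_of_nat_diff ffact_def)
    show ?thesis
    proof (cases "?u j \<le> ?n j")
      case True
      then have "(a $ j) ^ (?n j - ?u j) * (a $ j) ^ ?u j = (a $ j) ^ ?n j" by (simp flip: power_add)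
      then show ?thesis by (simp add: c p mult.assoc)
    next
      case False
      then have "ffact (pairing m (e j)) (?u j) = 0" using m[of j] by (intro ffact_eq_0) auto
      then show ?thesis by (simp add: c)
    qed
  qed
  have "deriv_at ?u (Poly_Mapping.single (- m) 1)
      = (\<Prod>j\<in>UNIV. ffact (pairing m (e j)) (?u j) * (a $ j) powi pairing m (e j))"
    by (simp add: deriv_at_def snd_torus_point expo_def pairing_uminus_left prod.distrib)
  also have "\<dots> = (\<Prod>j\<in>UNIV. \<Prod>i<?u j. of_nat (?n j - i)) * (\<Prod>j\<in>UNIV. (a $ j) ^ (?n j - ?u j))
      * (\<Prod>j\<in>UNIV. (a $ j) ^ ?u j)"
    unfolding factor[symmetric] by (simp only: prod.distrib)
  also have "(\<Prod>j\<in>UNIV. \<Prod>i<?u j. of_nat (?n j - i)) * (\<Prod>j\<in>UNIV. (a $ j) ^ (?n j - ?u j))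
      = eval_poly (mixed_deriv e u (y_monomial \<Sigma> e d m)) a"
    unfolding mixed_deriv_def y_monomial_eq[OF fan e rays d] fold_partial_deriv_single eval_poly_single
    by (simp add: lookup_minus lookup_sum_single)
  finally show ?thesis .
qed

text \<open>Multiplicity at least \<open>\<mu>\<close> means membership in \<open>jet\<close>, hence
  vanishing derivatives of order below \<open>\<mu>\<close>. Expanded over the exponents of
  \<open>s\<close>, each derivative is a row of the matrix applied to the coefficients, times a
  product of powers of the nonzero coordinates of \<open>a\<close>.\<close>

lemma mult_sections_iff:
  fixes a :: "'k::field_char_0^'n" and \<Sigma> :: "(real^'n) set set" and d :: "int^'n \<Rightarrow> int"
  assumes fan: "complete_fan \<Sigma>" and e: "lattice_basis e" and rays: "\<And>j. - e j \<in> rays \<Sigma>"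
    and d: "standard_form e d" and a: "\<And>j. a $ j \<noteq> 0"
    and s: "Poly_Mapping.keys s \<subseteq> uminus ` polytope_points \<Sigma> d"
  shows "s \<in> mult_sections \<Sigma> d (torus_point e a) \<mu> \<longleftrightarrow>
    (\<forall>u\<in>Delta e \<mu>. (\<Sum>m\<in>polytope_points \<Sigma> d.
      eval_poly (mixed_deriv e u (y_monomial \<Sigma> e d m)) a * Poly_Mapping.lookup s (- m)) = 0)"
proof -
  let ?C = "polytope_points \<Sigma> d"
  have char: "character (snd (torus_point e a))" using character_torus_point[OF a] .
  interpret torus_coordinates e "snd (torus_point e a)"
    using e char by (simp add: torus_coordinates_def)
  have "torus_point e a = ({0}, snd (torus_point e a))" by (simp add: torus_point_def)
  then have "mult_sections \<Sigma> d (torus_point e a) \<mu> = jet \<mu>"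
    using mult_sections_torus[OF char, of \<Sigma> d \<mu>] ideal_power_eq_jet by simp
  then have 1: "s \<in> mult_sections \<Sigma> d (torus_point e a) \<mu> \<longleftrightarrow> (\<forall>u. sum u UNIV < \<mu> \<longrightarrow> deriv_at u s = 0)"
    by (simp only: jet_iff)
  have pos: "0 \<le> pairing m (e j)" if "m \<in> ?C" for m j
    using that rays[of j] d by (force simp: polytope_points_iff standard_form_def pairing_uminus_right)
  have der: "deriv_at (\<lambda>j. nat (pairing u (e j))) s = (\<Sum>m\<in>?C.
      eval_poly (mixed_deriv e u (y_monomial \<Sigma> e d m)) a * Poly_Mapping.lookup s (- m))
      * (\<Prod>j\<in>UNIV. (a $ j) ^ nat (pairing u (e j)))" for u
  proof -
    have "deriv_at (\<lambda>j. nat (pairing u (e j))) s = (\<Sum>m\<in>uminus ` ?C. Poly_Mapping.lookup s m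
        * deriv_at (\<lambda>j. nat (pairing u (e j))) (Poly_Mapping.single m 1))"
      unfolding deriv_at_def ev_single mult_1
      using finite_polytope_points[OF fan] by (intro ev_superset s) simp
    also have "\<dots> = (\<Sum>m\<in>?C. Poly_Mapping.lookup s (- m)
        * deriv_at (\<lambda>j. nat (pairing u (e j))) (Poly_Mapping.single (- m) 1))"
      by (subst sum.reindex) (auto simp: inj_on_def)
    also have "\<dots> = (\<Sum>m\<in>?C. (eval_poly (mixed_deriv e u (y_monomial \<Sigma> e d m)) a * Poly_Mapping.lookup s (- m))
        * (\<Prod>j\<in>UNIV. (a $ j) ^ nat (pairing u (e j))))"
    proof (rule sum.cong[OF refl])
      fix m assume m: "m \<in> ?C"
      show "Poly_Mapping.lookup s (- m) * deriv_at (\<lambda>j. nat (pairing u (e j))) (Poly_Mapping.single (- m) 1)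
          = (eval_poly (mixed_deriv e u (y_monomial \<Sigma> e d m)) a * Poly_Mapping.lookup s (- m))
            * (\<Prod>j\<in>UNIV. (a $ j) ^ nat (pairing u (e j)))"
        unfolding deriv_at_monomial[OF fan e rays d a pos[OF m]] by (simp only: mult_ac)
    qed
    finally show ?thesis by (simp only: sum_distrib_right)
  qed
  have nz: "(\<Prod>j\<in>UNIV. (a $ j) ^ nat (pairing u (e j))) \<noteq> 0" for u using a by simp
  have Delta: "u \<in> Delta e \<mu> \<longleftrightarrow> (\<forall>j. 0 \<le> pairing u (e j)) \<and> (\<Sum>j\<in>UNIV. nat (pairing u (e j))) < \<mu>" for u :: "int^'n"
  proof (cases "\<forall>j. 0 \<le> pairing u (e j)")
    case True
    then have "int (\<Sum>j\<in>UNIV. nat (pairing u (e j))) = (\<Sum>j\<in>UNIV. pairing u (e j))" by simp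
    then have "(\<Sum>j\<in>UNIV. pairing u (e j)) \<le> int \<mu> - 1 \<longleftrightarrow> (\<Sum>j\<in>UNIV. nat (pairing u (e j))) < \<mu>"
      by linarith
    then show ?thesis unfolding Delta_def mem_Collect_eq pairing_sum_right using True by blast
  next
    case False
    then show ?thesis unfolding Delta_def by blast
  qed
  \<comment> \<open>Since \<open>e\<close> is a lattice basis, every tuple of orders comes from a
    lattice point.\<close>
  have onto: "\<exists>w. (\<forall>j. 0 \<le> pairing w (e j)) \<and> u = (\<lambda>j. nat (pairing w (e j)))" for u :: "'n \<Rightarrow> nat"
  proof -
    have "pairing (\<Sum>i\<in>UNIV. int (u i) *s dual_basis e i) (e j) = int (u j)" for j
      by (simp add: pairing_sum_left pairing_smult_left dual_basis_pairing[OF e] if_distrib[of "(*) _"] cong: if_cong)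
    then show ?thesis by (intro exI[of _ "\<Sum>i\<in>UNIV. int (u i) *s dual_basis e i"]) simp
  qed
  have "(\<forall>u. sum u UNIV < \<mu> \<longrightarrow> deriv_at u s = 0)
      \<longleftrightarrow> (\<forall>u\<in>Delta e \<mu>. deriv_at (\<lambda>j. nat (pairing u (e j))) s = 0)"
  proof
    assume "\<forall>u. sum u UNIV < \<mu> \<longrightarrow> deriv_at u s = 0"
    then show "\<forall>u\<in>Delta e \<mu>. deriv_at (\<lambda>j. nat (pairing u (e j))) s = 0" using Delta by blast
  next
    assume *: "\<forall>u\<in>Delta e \<mu>. deriv_at (\<lambda>j. nat (pairing u (e j))) s = 0"
    show "\<forall>u. sum u UNIV < \<mu> \<longrightarrow> deriv_at u s = 0"
    proof (intro allI impI)
      fix u :: "'n \<Rightarrow> nat" assume lt: "sum u UNIV < \<mu>"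
      obtain w where w: "\<forall>j. 0 \<le> pairing w (e j)" "u = (\<lambda>j. nat (pairing w (e j)))" using onto by blast
      then have "w \<in> Delta e \<mu>" using lt Delta by simp
      then show "deriv_at u s = 0" unfolding w(2) using * by blast
    qed
  qed
  also have "\<dots> \<longleftrightarrow> (\<forall>u\<in>Delta e \<mu>. (\<Sum>m\<in>?C.
      eval_poly (mixed_deriv e u (y_monomial \<Sigma> e d m)) a * Poly_Mapping.lookup s (- m)) = 0)"
    unfolding der using nz by (simp only: mult_eq_0_iff simp_thms)
  finally show ?thesis using 1 by blast
qed

lemma annihilator_span: "annihilator C (fun_vs.span W) = annihilator C W"
proof
  show "annihilator C (fun_vs.span W) \<subseteq> annihilator C W"
    using fun_vs.span_superset by (fastforce simp: annihilator_def)
  show "annihilator C W \<subseteq> annihilator C (fun_vs.span W)"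
  proof
    fix v assume v: "v \<in> annihilator C W"
    have "fun_vs.subspace {w. (\<Sum>x\<in>C. w x * v x) = 0}"
      by (auto simp: fun_vs.subspace_def distrib_right sum.distrib mult.assoc simp flip: sum_distrib_left)
    then have "fun_vs.span W \<subseteq> {w. (\<Sum>x\<in>C. w x * v x) = 0}"
      using v by (intro fun_vs.span_minimal) (auto simp: annihilator_def)
    then show "v \<in> annihilator C (fun_vs.span W)" using v by (auto simp: annihilator_def)
  qed
qed

text \<open>The rank is the dimension of the row span, and the solution space is the annihilator of
  the rows.\<close>

lemma rank_nullity:
  fixes A :: "'r \<Rightarrow> 'c \<Rightarrow> 'k::field"
  assumes "finite C"
  shows "matrix_rank R C A + fun_vs.dim {v \<in> supported C. \<forall>r\<in>R. (\<Sum>x\<in>C. A r x * v x) = 0} = card C"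
proof -
  let ?W = "(\<lambda>r x. if x \<in> C then A r x else 0) ` R"
  have "?W \<subseteq> supported C" by (auto simp: supported_def)
  then have "fun_vs.span ?W \<subseteq> supported C" by (rule fun_vs.span_minimal[OF _ subspace_supported])
  then have "fun_vs.dim (fun_vs.span ?W) + fun_vs.dim (annihilator C (fun_vs.span ?W)) = card C"
    by (rule dim_annihilator[OF assms fun_vs.subspace_span])
  moreover have "annihilator C ?W = {v \<in> supported C. \<forall>r\<in>R. (\<Sum>x\<in>C. A r x * v x) = 0}"
    by (auto simp: annihilator_def cong: sum.cong)
  ultimately show ?thesis by (simp add: matrix_rank_def annihilator_span)
qed

text \<open>The column of \<open>m\<close> belongs to the character of \<open>- m\<close>, by the
  sign convention of \<open>global_sections\<close>.\<close>

definition section_of :: "(int^'n) set \<Rightarrow> (int^'n \<Rightarrow> 'k) \<Rightarrow> (int^'n) \<Rightarrow>\<^sub>0 'k::field" where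
  "section_of C v = (\<Sum>m\<in>C. Poly_Mapping.single (- m) (v m))"

lemma lookup_section_of:
  assumes "finite C"
  shows "Poly_Mapping.lookup (section_of C v) (- m) = (if m \<in> C then v m else 0)"
proof -
  have "Poly_Mapping.lookup (section_of C v) (- m) = (\<Sum>m'\<in>C. if m' = m then v m else 0)"
    unfolding section_of_def lookup_sum by (intro sum.cong) (auto simp: lookup_single when_def)
  then show ?thesis using assms by simp
qed

lemma linear_section_of:
  "Vector_Spaces.linear (\<lambda>(c::'k) v x. c * v x) alg_scale (section_of C :: _ \<Rightarrow> (int^'n) \<Rightarrow>\<^sub>0 'k::field)"
proof (rule Vector_Spaces.linear_iff[THEN iffD2], intro conjI allI)
  show "vector_space (\<lambda>(c::'k) (v::int^'n \<Rightarrow> 'k) x. c * v x)" by (rule vector_space_fun_scale)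
  show "vector_space (alg_scale :: 'k \<Rightarrow> _ \<Rightarrow> (int^'n) \<Rightarrow>\<^sub>0 'k)" by (rule vector_space_alg_scale)
  show "section_of C (u + v) = section_of C u + section_of C v" for u v :: "int^'n \<Rightarrow> 'k"
    by (simp add: section_of_def single_add sum.distrib)
  show "section_of C (\<lambda>x. c * v x) = alg_scale c (section_of C v)" for c and v :: "int^'n \<Rightarrow> 'k"
    by (simp add: section_of_def alg.scale_sum_right alg_scale_single)
qed

theorem theorem3p4:
  fixes \<Sigma> :: "(real^'n) set set"
    and e :: "'n \<Rightarrow> int^'n"
    and d :: "int^'n \<Rightarrow> int"
    and k :: nat
    and \<mu> :: "nat \<Rightarrow> nat"
    and p :: "nat \<Rightarrow> 'k::{alg_closed_field, field_char_0}^'n"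
  assumes "quasi_transitive TYPE('k) \<Sigma>"
    and "lattice_basis e"
    and "transitive_cone TYPE('k) \<Sigma> (convex_cone hull (range (\<lambda>j. rvec (- e j))))"
    and "standard_form e d"
    and "\<forall>i<k. \<forall>j. p i $ j \<noteq> 0"
    and "very_general \<Sigma> k (\<lambda>i. torus_point e (p i))"
  shows "ls_dim \<Sigma> d k (\<lambda>i. torus_point e (p i)) \<mu>
             = int (class_dim \<Sigma> d) - int (interp_rank \<Sigma> e d k p \<mu>) - 1 \<and>
         ls_dim \<Sigma> d k (\<lambda>i. torus_point e (p i)) \<mu> \<ge> tedim \<Sigma> e d k \<mu> \<and>
         tedim \<Sigma> e d k \<mu> \<ge> edim \<Sigma> d k \<mu>"
proof -
  note e = assms(2) and d = assms(4)
  have fan: "complete_fan \<Sigma>" using assms(1) by (simp add: quasi_transitive_def)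
  interpret complete_fan_loc \<Sigma> by unfold_locales (rule fan)
  obtain \<gamma>0 :: "int^'n \<Rightarrow> 'k" where tr: "transitive_point \<Sigma> (basis_cone e, \<gamma>0)"
    using assms(3) unfolding transitive_cone_def by blast
  let ?x = "(basis_cone e, \<gamma>0)"
  have x: "?x \<in> toric_variety \<Sigma>" using tr by (simp add: transitive_point_def)
  \<comment> \<open>Transitivity is applied to the unit of the torus as target.\<close>
  have "({0}, \<lambda>_. 1 :: 'k) \<in> torus \<Sigma>" by (rule torus_char) (simp add: character_def)
  then obtain g where g: "variety_aut \<Sigma> g" "g ?x = ({0}, \<lambda>_. 1)"
    using tr unfolding transitive_point_def by blast
  then obtain h where h: "variety_endo \<Sigma> h" "\<forall>x\<in>toric_variety \<Sigma>. h (g x) = x \<and> g (h x) = x"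
    unfolding variety_aut_def by blast
  have "moved_fixed_point \<Sigma> e g h ?x"
    by unfold_locales (use e x g h in \<open>auto simp: variety_aut_def\<close>)
  note nonneg = moved_fixed_point.other_rays_nonneg[OF this]
  have rays: "- e j \<in> rays \<Sigma>" for j
    by (rule basis_vector_ray[OF fan e]) (use toric_varietyD(1)[OF x] in simp)
  let ?C = "polytope_points \<Sigma> d" and ?R = "SIGMA i:{..<k}. Delta e (\<mu> i)" and ?A = "interp_entry \<Sigma> e d p"
  let ?L = "linear_system \<Sigma> d k (\<lambda>i. torus_point e (p i)) \<mu>"
  let ?K = "{v \<in> supported ?C. \<forall>r\<in>?R. (\<Sum>x\<in>?C. ?A r x * v x) = 0}"
  have fin: "finite ?C" by (rule finite_polytope_points[OF fan])
  have nz: "p i $ j \<noteq> 0" if "i < k" for i j using assms(5) that by blast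
  have L_iff: "s \<in> ?L \<longleftrightarrow> Poly_Mapping.keys s \<subseteq> uminus ` ?C \<and>
      (\<forall>r\<in>?R. (\<Sum>m\<in>?C. ?A r m * Poly_Mapping.lookup s (- m)) = 0)" for s
  proof (cases "Poly_Mapping.keys s \<subseteq> uminus ` ?C")
    case True
    have "s \<in> ?L \<longleftrightarrow> (\<forall>i<k. s \<in> mult_sections \<Sigma> d (torus_point e (p i)) (\<mu> i))"
      using True by (simp add: linear_system_def global_sections_def)
    also have "\<dots> \<longleftrightarrow> (\<forall>i<k. \<forall>u\<in>Delta e (\<mu> i). (\<Sum>m\<in>?C. ?A (i, u) m * Poly_Mapping.lookup s (- m)) = 0)"
      using mult_sections_iff[OF fan e rays d nz True] by (simp add: interp_entry_def)
    finally show ?thesis using True by auto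
  qed (simp add: linear_system_def global_sections_def)
  have sup: "Poly_Mapping.lookup s (- m) = 0" if "Poly_Mapping.keys s \<subseteq> uminus ` ?C" "m \<notin> ?C" for s :: "(int^'n) \<Rightarrow>\<^sub>0 'k" and m
  proof -
    have "- m \<notin> uminus ` ?C" using that(2) by auto
    then show ?thesis using that(1) by (auto simp: in_keys_iff)
  qed
  \<comment> \<open>Taking coefficients identifies the kernel of the matrix with the space of
    sections, so their dimensions agree.\<close>
  have img: "section_of ?C ` ?K = ?L"
  proof (intro equalityI subsetI)
    fix s assume "s \<in> section_of ?C ` ?K"
    then obtain v where v: "v \<in> ?K" "s = section_of ?C v" by blast
    have "Poly_Mapping.keys s \<subseteq> uminus ` ?C"
    proof
      fix m assume "m \<in> Poly_Mapping.keys s"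
      then have "- m \<in> ?C"
        using lookup_section_of[OF fin, of v "- m"] v(2) by (auto simp: in_keys_iff split: if_splits)
      then show "m \<in> uminus ` ?C" by (rule rev_image_eqI) simp
    qed
    moreover have "(\<Sum>m\<in>?C. ?A r m * Poly_Mapping.lookup s (- m)) = (\<Sum>m\<in>?C. ?A r m * v m)" for r
      unfolding v(2) by (intro sum.cong refl) (simp add: lookup_section_of[OF fin])
    ultimately show "s \<in> ?L" unfolding L_iff using v(1) by simp
  next
    fix s assume "s \<in> ?L"
    then have s: "Poly_Mapping.keys s \<subseteq> uminus ` ?C"
      "\<forall>r\<in>?R. (\<Sum>m\<in>?C. ?A r m * Poly_Mapping.lookup s (- m)) = 0" using L_iff by blast+
    define v where "v = (\<lambda>m. Poly_Mapping.lookup s (- m))"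
    have "v \<in> ?K" using s sup[OF s(1)] by (simp add: v_def supported_def)
    moreover have "s = section_of ?C v"
    proof (rule poly_mapping_eqI)
      fix m
      show "Poly_Mapping.lookup s m = Poly_Mapping.lookup (section_of ?C v) m"
        using lookup_section_of[OF fin, of v "- m"] sup[OF s(1), of "- m"] by (auto simp: v_def)
    qed
    ultimately show "s \<in> section_of ?C ` ?K" by blast
  qed
  have inj: "inj_on (section_of ?C) ?K"
  proof (rule inj_onI)
    fix v w assume vw: "v \<in> ?K" "w \<in> ?K" "section_of ?C v = section_of ?C w"
    show "v = w"
    proof
      fix m show "v m = w m"
        using lookup_section_of[OF fin, of v m] lookup_section_of[OF fin, of w m] vw
        by (cases "m \<in> ?C") (auto simp: supported_def)
    qed
  qed
  have sub: "fun_vs.subspace ?K"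
    using subspace_supported[of ?C] unfolding fun_vs.subspace_def
    by (auto simp: distrib_left sum.distrib mult.left_commute simp flip: sum_distrib_left)
  have "alg.dim ?L = fun_vs.dim ?K" unfolding img[symmetric]
    by (rule dim_injective_image[OF vector_space_fun_scale vector_space_alg_scale linear_section_of sub inj])
  then have dim: "interp_rank \<Sigma> e d k p \<mu> + alg.dim ?L = class_dim \<Sigma> d"
    using rank_nullity[OF fin, of ?R ?A] by (simp add: interp_rank_def class_dim_def)
  have eq: "ls_dim \<Sigma> d k (\<lambda>i. torus_point e (p i)) \<mu>
      = int (class_dim \<Sigma> d) - int (interp_rank \<Sigma> e d k p \<mu>) - 1"
    unfolding ls_dim_def dim[symmetric] by simp
  let ?row = "\<lambda>r x. if x \<in> ?C then ?A r x else 0"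
  let ?R' = "SIGMA i:{..<k}. Delta_in \<Sigma> e d (\<mu> i)"
  \<comment> \<open>If no coordinate of \<open>u\<close> exceeded that of \<open>m\<close>, then
    \<open>u\<close> would lie in the polytope. So some order of differentiation exceeds the
    exponent, which annihilates the monomial of \<open>m\<close>.\<close>
  have entry0: "?A (i, u) m = 0" if i: "i < k" and u: "u \<in> Delta e (\<mu> i)" "u \<notin> ?C" and m: "m \<in> ?C" for i u m
  proof -
    have pm: "0 \<le> pairing m (e j)" for j
      using m rays[of j] d by (force simp: polytope_points_iff standard_form_def pairing_uminus_right)
    have pu: "0 \<le> pairing u (e j)" for j using u(1) by (simp add: Delta_def)
    have "\<exists>j. \<not> pairing u (e j) \<le> pairing m (e j)"
      using orthant_down_closed[OF e d nonneg m pu] u(2) by blast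
    then obtain j where "\<not> pairing u (e j) \<le> pairing m (e j)" ..
    then have j: "pairing m (e j) < pairing u (e j)" by (rule not_le_imp_less)
    interpret torus_coordinates e "snd (torus_point e (p i))"
      using e character_torus_point[OF nz[OF i]] by (simp add: torus_coordinates_def)
    have "ffact (pairing m (e j)) (nat (pairing u (e j))) = 0"
      using j pm[of j] by (intro ffact_eq_0) auto
    then have "(\<Prod>i\<in>UNIV. ffact (pairing m (e i)) (nat (pairing u (e i)))) = 0"
      by (intro prod_zero) auto
    then have "deriv_at (\<lambda>j. nat (pairing u (e j))) (Poly_Mapping.single (- m) 1) = 0"
      by (simp add: deriv_at_def expo_def pairing_uminus_left)
    then have "eval_poly (mixed_deriv e u (y_monomial \<Sigma> e d m)) (p i)
        * (\<Prod>j\<in>UNIV. (p i $ j) ^ nat (pairing u (e j))) = 0"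
      using deriv_at_monomial[OF fan e rays d nz[OF i] pm, of u] by simp
    then show ?thesis using nz[OF i] by (simp add: interp_entry_def)
  qed
  have "?row ` ?R \<subseteq> fun_vs.span (?row ` ?R')"
  proof
    fix w assume "w \<in> ?row ` ?R"
    then obtain i u where iu: "i < k" "u \<in> Delta e (\<mu> i)" "w = ?row (i, u)" by auto
    show "w \<in> fun_vs.span (?row ` ?R')"
    proof (cases "u \<in> ?C")
      case True
      then have "(i, u) \<in> ?R'" using iu by (simp add: Delta_in_def)
      then show ?thesis unfolding iu(3) by (intro fun_vs.span_base imageI)
    next
      case False
      then have "w = 0" unfolding iu(3) using entry0[OF iu(1,2)] by (auto simp: fun_eq_iff)
      then show ?thesis using fun_vs.span_zero by simp
    qed
  qed
  moreover have finR': "finite ?R'" using fin by (simp add: Delta_in_def)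
  ultimately have "interp_rank \<Sigma> e d k p \<mu> \<le> card (?row ` ?R')"
    unfolding interp_rank_def matrix_rank_def by (intro fun_vs.dim_le_card) simp_all
  also have "\<dots> \<le> card ?R'" by (rule card_image_le[OF finR'])
  also have "\<dots> = (\<Sum>i<k. card (Delta_in \<Sigma> e d (\<mu> i)))"
    using fin by (subst card_SigmaI) (auto simp: Delta_in_def)
  finally have rank: "int (interp_rank \<Sigma> e d k p \<mu>) \<le> (\<Sum>i<k. int (card (Delta_in \<Sigma> e d (\<mu> i))))"
    by (simp flip: of_nat_sum)
  \<comment> \<open>Accounts for the lower bound -1 in the maximum that defines
    \<open>tedim\<close>.\<close>
  have "ls_dim \<Sigma> d k (\<lambda>i. torus_point e (p i)) \<mu> \<ge> - 1" by (simp add: ls_dim_def)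
  then have 2: "ls_dim \<Sigma> d k (\<lambda>i. torus_point e (p i)) \<mu> \<ge> tedim \<Sigma> e d k \<mu>"
    using rank eq by (simp add: tedim_def tvdim_def)
  have "card (Delta_in \<Sigma> e d (\<mu> i)) \<le> (CARD('n) + \<mu> i - 1) choose CARD('n)" for i
    using card_Delta_le[OF e, of "\<mu> i"] card_mono[of "Delta e (\<mu> i)" "Delta_in \<Sigma> e d (\<mu> i)"]
    by (force simp: Delta_in_def)
  then have "(\<Sum>i<k. int (card (Delta_in \<Sigma> e d (\<mu> i)))) \<le> (\<Sum>i<k. int ((CARD('n) + \<mu> i - 1) choose CARD('n)))"
    by (intro sum_mono) simp
  then have "tedim \<Sigma> e d k \<mu> \<ge> edim \<Sigma> d k \<mu>"
    by (simp add: tedim_def tvdim_def edim_def vdim_def)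
  then show ?thesis using eq 2 by blast
qed

end
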